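(* For all $k\geq 1$ there exist $C_1,C_2>0$ such that the following holds. Suppose $\mathcal{H}$ is a hereditary $3$-graph property such that $k\otimes U(k)\notin\text{Trip}(\mathcal{H})$ and $\mathcal{H}$ is far from finite VC-dimension. Then $2^{\epsilon^{-C_1}}\leq M_{\mathcal{H}}(\epsilon)\leq M^{hom}_{\mathcal{H}}(\epsilon^4/2)\leq 2^{2^{\epsilon^{-C_2}}}$ for all sufficiently small $\epsilon>0$.
   Context: $3$-graphs $H=(V,E)$, $E\subseteq\binom V3$; hereditary $3$-graph properties are classes of finite $3$-graphs closed under isomorphism and induced sub-$3$-graphs. $d_H(X,Y,Z)=|\{(x,y,z)\in X\times Y\times Z:\{x,y,z\}\in E\}|/(|X||Y||Z|)$. A triple $(X,Y,Z)$ is $\epsilon$-regular if $|d_H(X,Y,Z)-d_H(X',Y',Z')|\le\epsilon$ for all $X'\subseteq X,Y'\subseteq Y,Z'\subseteq Z$ of sizes at least $\epsilon|X|,\epsilon|Y|,\epsilon|Z|$; $\epsilon$-homogeneous if $d_H(X,Y,Z)\in[0,\epsilon)\cup(1-\epsilon,1]$. A partition $\mathcal P$ of $V$ is $\epsilon$-regular (resp. $\epsilon$-homogeneous) if at least $(1-\epsilon)|V|^3$ triples of $V^3$ lie in some $X\times Y\times Z$ with $(X,Y,Z)\in\mathcal P^3$ $\epsilon$-regular (resp. $\epsilon$-homogeneous). $M_{\mathcal H}(\epsilon)$ (resp. $M^{hom}_{\mathcal H}(\epsilon)$) is the least $M$ such that all sufficiently large members of $\mathcal H$ have an $\epsilon$-regular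 (resp. $\epsilon$-homogeneous) partition with at most $M$ parts. $\text{Trip}(H)$ has vertices $x_v,y_v,z_v$ ($v\in V$) and edges $x_vy_{v'}z_{v''}$ for $vv'v''\in E$; $\text{Trip}(\mathcal H)$ is the closure of $\{\text{Trip}(H)\}$ under isomorphism and induced sub-$3$-graphs. $U(k)$: bipartite with parts $\{a_1,..,a_k\}$, $\{b_S:S\subseteq[k]\}$, edges $a_ib_S$ for $i\in S$; $n\otimes G$ for bipartite $G=(U\cup V,E)$ is the $3$-graph on $U\cup V\cup\{c_1,..,c_n\}$ with edges $\{c_i,u,w\}$, $uw\in E$. The VC-dimension of a $3$-graph $H$ is the largest $k$ for which there are vertices $a_1,b_1,\dots,a_k,b_k$ and $c_S$ ($S\subseteq[k]$) with $a_ib_ic_S\in E$ iff $i\in S$; $\textnormal{VC}(\mathcal H)=\sup_{H\in\mathcal H}\textnormal{VC}(H)$. Two $3$-graphs $H=(V,E)$, $H'=(V,E')$ on the same vertex set are $\delta$-close if the ordered edge sets satisfy $|\overline E\Delta\overline{E'}|\le\delta|V|^3$, where $\overline E=\{(x,y,z):xyz\in E\}$. $\mathcal H$ is close to $\mathcal H'$ if for every $\delta>0$ there is $N$ such that every $H\in\mathcal H$ with at least $N$ vertices is $\delta$-close to some $H'\in\mathcal H'$ on the same vertex set. $\mathcal H$ is far from finite VC-dimension if there is no hereditary $\mathcal H'$ with $\textnormal{VC}(\mathcal H')<\infty$ to which $\mathcal H$ is close. *)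

theory Defs
  imports Complex_Main "HOL-Library.Extended_Real" "HOL-Library.Disjoint_Sets"
begin

type_synonym graph3 = "nat set \<times> nat set set"

definition is_3graph :: "graph3 \<Rightarrow> bool" where
  "is_3graph H \<longleftrightarrow> finite (fst H) \<and> (\<forall>e\<in>snd H. e \<subseteq> fst H \<and> card e = 3)"

definition iso3 :: "graph3 \<Rightarrow> graph3 \<Rightarrow> bool" where
  "iso3 H G \<longleftrightarrow> (\<exists>f. bij_betw f (fst H) (fst G) \<and> snd G = (\<lambda>e. f ` e) ` snd H)"

definition induced3 :: "graph3 \<Rightarrow> nat set \<Rightarrow> graph3" where
  "induced3 H W = (W, {e \<in> snd H. e \<subseteq> W})"

definition hereditary3 :: "graph3 set \<Rightarrow> bool" where
  "hereditary3 \<H> \<longleftrightarrow>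
     (\<forall>H\<in>\<H>. is_3graph H) \<and>
     (\<forall>H\<in>\<H>. \<forall>G. is_3graph G \<and> iso3 H G \<longrightarrow> G \<in> \<H>) \<and>
     (\<forall>H\<in>\<H>. \<forall>W. W \<subseteq> fst H \<longrightarrow> induced3 H W \<in> \<H>)"

definition closure3 :: "graph3 set \<Rightarrow> graph3 set" where
  "closure3 S = {G. is_3graph G \<and> (\<exists>H\<in>S. \<exists>W. W \<subseteq> fst H \<and> iso3 (induced3 H W) G)}"

text \<open>Trip(H): vertex x_v is encoded as 3v, y_v as 3v+1, z_v as 3v+2.\<close>
definition Trip :: "graph3 \<Rightarrow> graph3" where
  "Trip H = ((\<lambda>v. 3*v) ` fst H \<union> (\<lambda>v. 3*v+1) ` fst H \<union> (\<lambda>v. 3*v+2) ` fst H,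
             {{3*u, 3*v+1, 3*w+2} | u v w. {u,v,w} \<in> snd H})"

definition TripClass :: "graph3 set \<Rightarrow> graph3 set" where
  "TripClass \<H> = closure3 (Trip ` \<H>)"

text \<open>k \<otimes> U(k): a_i encoded as 3i, b_S as 3 * (sum of 2^i, i in S) + 1, c_j as 3j+2.\<close>
definition setcode :: "nat set \<Rightarrow> nat" where
  "setcode S = (\<Sum>i\<in>S. 2^i)"

definition kU :: "nat \<Rightarrow> graph3" where
  "kU k = ((\<lambda>i. 3*i) ` {1..k} \<union> (\<lambda>S. 3 * setcode S + 1) ` Pow {1..k} \<union> (\<lambda>j. 3*j+2) ` {1..k},
           {{3*j+2, 3*i, 3 * setcode S + 1} | i j S. j \<in> {1..k} \<and> i \<in> {1..k} \<and> S \<subseteq> {1..k} \<and> i \<in> S})"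

definition dens :: "graph3 \<Rightarrow> nat set \<Rightarrow> nat set \<Rightarrow> nat set \<Rightarrow> real" where
  "dens H X Y Z = real (card {(x,y,z) \<in> X \<times> Y \<times> Z. {x,y,z} \<in> snd H}) /
                  (real (card X) * real (card Y) * real (card Z))"

definition reg_triple :: "real \<Rightarrow> graph3 \<Rightarrow> nat set \<Rightarrow> nat set \<Rightarrow> nat set \<Rightarrow> bool" where
  "reg_triple \<epsilon> H X Y Z \<longleftrightarrow>
     (\<forall>X' Y' Z'. X' \<subseteq> X \<and> Y' \<subseteq> Y \<and> Z' \<subseteq> Z \<and>
        real (card X') \<ge> \<epsilon> * card X \<and> real (card Y') \<ge> \<epsilon> * card Y \<and> real (card Z') \<ge> \<epsilon> * card Z
        \<longrightarrow> \<bar>dens H X Y Z - dens H X' Y' Z'\<bar> \<le> \<epsilon>)"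

definition hom_triple :: "real \<Rightarrow> graph3 \<Rightarrow> nat set \<Rightarrow> nat set \<Rightarrow> nat set \<Rightarrow> bool" where
  "hom_triple \<epsilon> H X Y Z \<longleftrightarrow> dens H X Y Z < \<epsilon> \<or> dens H X Y Z > 1 - \<epsilon>"

definition good_partition ::
  "(nat set \<Rightarrow> nat set \<Rightarrow> nat set \<Rightarrow> bool) \<Rightarrow> real \<Rightarrow> nat set \<Rightarrow> nat set set \<Rightarrow> bool" where
  "good_partition Q \<epsilon> V P \<longleftrightarrow> partition_on V P \<and>
     real (card (\<Union>{X \<times> Y \<times> Z | X Y Z. X \<in> P \<and> Y \<in> P \<and> Z \<in> P \<and> Q X Y Z}))
       \<ge> (1 - \<epsilon>) * real (card V) ^ 3"

definition reg_partition :: "real \<Rightarrow> graph3 \<Rightarrow> nat set set \<Rightarrow> bool" where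
  "reg_partition \<epsilon> H P \<longleftrightarrow> good_partition (reg_triple \<epsilon> H) \<epsilon> (fst H) P"

definition hom_partition :: "real \<Rightarrow> graph3 \<Rightarrow> nat set set \<Rightarrow> bool" where
  "hom_partition \<epsilon> H P \<longleftrightarrow> good_partition (hom_triple \<epsilon> H) \<epsilon> (fst H) P"

text \<open>M_H(eps) and M^hom_H(eps), valued in ereal (infinity if no such M exists).\<close>
definition M_reg :: "graph3 set \<Rightarrow> real \<Rightarrow> ereal" where
  "M_reg \<H> \<epsilon> = Inf {ereal (real M) | M. \<exists>N. \<forall>H\<in>\<H>. card (fst H) \<ge> N \<longrightarrow>
                     (\<exists>P. reg_partition \<epsilon> H P \<and> card P \<le> M)}"

definition M_hom :: "graph3 set \<Rightarrow> real \<Rightarrow> ereal" where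
  "M_hom \<H> \<epsilon> = Inf {ereal (real M) | M. \<exists>N. \<forall>H\<in>\<H>. card (fst H) \<ge> N \<longrightarrow>
                     (\<exists>P. hom_partition \<epsilon> H P \<and> card P \<le> M)}"

definition VC_shatters :: "nat \<Rightarrow> graph3 \<Rightarrow> bool" where
  "VC_shatters k H \<longleftrightarrow> (\<exists>a b c.
     (\<forall>i\<in>{1..k}. a i \<in> fst H \<and> b i \<in> fst H) \<and> (\<forall>S. S \<subseteq> {1..k} \<longrightarrow> c S \<in> fst H) \<and>
     (\<forall>i\<in>{1..k}. \<forall>S. S \<subseteq> {1..k} \<longrightarrow> ({a i, b i, c S} \<in> snd H \<longleftrightarrow> i \<in> S)))"

definition VC_class :: "graph3 set \<Rightarrow> enat" where
  "VC_class \<H> = Sup {enat k | k. \<exists>H\<in>\<H>. VC_shatters k H}"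

definition ord_edges :: "nat set set \<Rightarrow> (nat \<times> nat \<times> nat) set" where
  "ord_edges E = {(x,y,z). {x,y,z} \<in> E}"

definition close_to :: "graph3 set \<Rightarrow> graph3 set \<Rightarrow> bool" where
  "close_to \<H> \<H>' \<longleftrightarrow> (\<forall>\<delta>>0. \<exists>N. \<forall>H\<in>\<H>. card (fst H) \<ge> N \<longrightarrow>
     (\<exists>E'. (fst H, E') \<in> \<H>' \<and>
        real (card ((ord_edges (snd H) - ord_edges E') \<union> (ord_edges E' - ord_edges (snd H)))) \<le> \<delta> * real (card (fst H)) ^ 3))"

definition far_from_finite_VC :: "graph3 set \<Rightarrow> bool" where
  "far_from_finite_VC \<H> \<longleftrightarrow> \<not> (\<exists>\<H>'. hereditary3 \<H>' \<and> VC_class \<H>' < \<infinity> \<and> close_to \<H> \<H>')"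

end

theory Submission
  imports Defs "HOL-Library.FuncSet" "HOL-Library.Nat_Bijection"
begin

text \<open>Upper bound. As \<open>kU k\<close> does not occur in \<open>TripClass \<H>\<close>, every sample of vertices carries a
  shattered copy of \<open>U(k)\<close> in boundedly many slices only, so by Sauer-Shelah all but boundedly many
  slices have a small net of neighbourhoods (up to few exceptional vertices). Alternating between
  slices in two directions turns this into polynomially many sets that approximate the joint
  neighbourhoods of almost all pairs of vertices. In the partition generated by these sets,
  resampling one coordinate of a random triple inside its part rarely changes adjacency; resampling
  all three shows that the partition is homogeneous.

  Lower bound. Pick a random representative in every part of such a partition and blow up the
  induced subgraph on the representatives: the result is typically close to \<open>H\<close>. If \<open>\<H>\<close> is far from
  finite VC-dimension, then a positive proportion of the choices of representatives shatters a large
  set, and the hypergraph form of Kovari-Sos-Turan yields exact blow-ups of shattered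
  configurations. In a regular partition of the union of such a blow-up, a typical part meets
  essentially one of the \<open>2 ^ l\<close> classes \<open>c_S\<close>, for otherwise some \<open>i\<close> and two large subsets of that part
  would give densities 0 and 1 against \<open>a_i\<close>, \<open>b_i\<close>.\<close>

text \<open>The nets in different slices are unrelated, so no net for pairs comes directly from
  them. What helps is that the joint neighbourhood is symmetric in the pair: inside a dense set of
  uncovered pairs one coordinate is moved within a good slice, then the other within a second good
  slice, at polynomial cost. The exceptional slices are harmless because their number does not grow
  with the graph.

  For the lower bound, a shattered configuration of bounded size is invisible to a partition that
  may ignore a share \<epsilon> of all triples. Only a configuration whose blown-up vertices fill
  the whole 3-graph forces many parts; heredity permits discarding all other vertices. The blow-up
  on representatives need not belong to the property: it only has to be so close to the given graph
  that its VC-dimension cannot be small. Its adjacency depends on colours alone, and the number of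
  colours is bounded, so one assignment of colours to the roles of a configuration occurs with
  positive density.

  The upper bound obtained is exponential in a polynomial of 1/\<epsilon>, hence well within the
  double exponential claimed.\<close>

abbreviation rcard :: "'a set \<Rightarrow> real" where "rcard A \<equiv> real (card A)"

section \<open>Double counting and averaging\<close>

lemma sum_card_swap:
  assumes "finite A" "finite B"
  shows "(\<Sum>a\<in>A. card {b \<in> B. R a b}) = (\<Sum>b\<in>B. card {a \<in> A. R a b})"
proof -
  have "(\<Sum>a\<in>A. card {b \<in> B. R a b}) = (\<Sum>a\<in>A. \<Sum>b\<in>B. if R a b then 1 else 0)"
    using assms by (intro sum.cong refl) (simp add: sum.If_cases Int_def)
  also have "\<dots> = (\<Sum>b\<in>B. \<Sum>a\<in>A. if R a b then 1 else 0)" by (rule sum.swap)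
  also have "\<dots> = (\<Sum>b\<in>B. card {a \<in> A. R a b})"
    using assms by (intro sum.cong refl) (simp add: sum.If_cases Int_def)
  finally show ?thesis .
qed

lemma card_pairs_sum:
  assumes "finite A" "finite B"
  shows "card {(a, b) \<in> A \<times> B. R a b} = (\<Sum>a\<in>A. card {b \<in> B. R a b})"
proof -
  have "{(a, b) \<in> A \<times> B. R a b} = Sigma A (\<lambda>a. {b \<in> B. R a b})" by auto
  then show ?thesis using assms by simp
qed

lemma exists_ge_average:
  fixes f :: "'a \<Rightarrow> real"
  assumes "finite A" "A \<noteq> {}" "c * rcard A \<le> sum f A"
  shows "\<exists>a\<in>A. c \<le> f a"
proof (rule ccontr)
  assume "\<not> ?thesis"
  then have "\<And>a. a \<in> A \<Longrightarrow> f a < c" by force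
  then have "sum f A < of_nat (card A) * c"
    using assms(1,2) by (intro sum_bounded_above_strict) (auto simp: card_gt_0_iff)
  with assms(3) show False by (simp add: mult.commute)
qed

text \<open>Elements below \<open>c\<close> contribute at most \<open>c * rcard A\<close>, half of
  the guaranteed total; the other half must come from the remaining elements, each worth at most
  \<open>b\<close>.\<close>

lemma card_ge_half_threshold:
  fixes f :: "'a \<Rightarrow> real"
  assumes fin: "finite A" and ub: "\<And>a. a \<in> A \<Longrightarrow> f a \<le> b"
    and c: "c \<ge> 0" and tot: "2 * c * rcard A \<le> sum f A"
  shows "c * rcard A \<le> rcard {a \<in> A. c \<le> f a} * b"
proof -
  have "sum f A = sum f {a \<in> A. c \<le> f a} + sum f {a \<in> A. \<not> c \<le> f a}"
    using fin by (subst sum.union_disjoint[symmetric]) (auto intro!: sum.cong)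
  also have "sum f {a \<in> A. c \<le> f a} \<le> rcard {a \<in> A. c \<le> f a} * b"
    using ub by (intro sum_bounded_above) auto
  also have "sum f {a \<in> A. \<not> c \<le> f a} \<le> rcard {a \<in> A. \<not> c \<le> f a} * c"
    by (intro sum_bounded_above) auto
  also have "rcard {a \<in> A. \<not> c \<le> f a} * c \<le> rcard A * c"
    using fin c by (intro mult_right_mono) (auto intro!: card_mono)
  finally show ?thesis using tot by (simp add: algebra_simps)
qed

subsection \<open>Shattering\<close>

definition shatters :: "'a set set \<Rightarrow> 'a set \<Rightarrow> bool" where
  "shatters F K \<longleftrightarrow> (\<forall>T. T \<subseteq> K \<longrightarrow> (\<exists>A\<in>F. A \<inter> K = T))"

lemma shatters_mono: "shatters F K \<Longrightarrow> L \<subseteq> K \<Longrightarrow> shatters F L"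
  unfolding shatters_def
proof (intro allI impI)
  fix T assume h: "\<forall>T\<subseteq>K. \<exists>A\<in>F. A \<inter> K = T" "L \<subseteq> K" "T \<subseteq> L"
  then obtain A where "A \<in> F" "A \<inter> K = T" by (meson subset_trans)
  then show "\<exists>A\<in>F. A \<inter> L = T" using h by (intro bexI[of _ A]) auto
qed

text \<open>Pajor's form of Sauer-Shelah. Split \<open>F\<close> by membership of \<open>x\<close>:
  sets shattered by one of the traces \<open>F0\<close> and \<open>F1\<close> on \<open>X\<close>
  are shattered by \<open>F\<close>, and a set \<open>K\<close> shattered by both, hence counted
  twice, is compensated by the new set \<open>insert x K\<close>, on which membership of
  \<open>x\<close> can also be prescribed.\<close>

lemma card_le_card_shattered:
  assumes "finite X" "\<And>A. A \<in> F \<Longrightarrow> A \<subseteq> X"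
  shows "card F \<le> card {K. K \<subseteq> X \<and> shatters F K}"
  using assms
proof (induction X arbitrary: F rule: finite_induct)
  case empty
  then have "F \<subseteq> {{}}" by auto
  then consider "F = {}" | "F = {{}}" by blast
  then show ?case
  proof cases
    case 2
    then have "{K. K \<subseteq> {} \<and> shatters F K} = {{}}" by (auto simp: shatters_def)
    then show ?thesis using 2 by simp
  qed simp
next
  case (insert x X)
  define F0 where "F0 = {A \<in> F. x \<notin> A}"
  define F1 where "F1 = (\<lambda>A. A - {x}) ` {A \<in> F. x \<in> A}"
  let ?S = "\<lambda>F. {K. K \<subseteq> X \<and> shatters F K}"
  have finF: "finite F" using insert.prems insert.hyps(1)
    by (meson Pow_iff finite_Pow_iff finite_insert finite_subset subsetI)
  have "card F = card F0 + card {A \<in> F. x \<in> A}"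
    unfolding F0_def using finF by (subst card_Un_disjoint[symmetric]) (auto intro!: arg_cong[of _ _ card])
  also have "card {A \<in> F. x \<in> A} = card F1"
    unfolding F1_def by (rule card_image[symmetric]) (auto simp: inj_on_def)
  also have "card F0 \<le> card (?S F0)"
    using insert.prems insert.hyps by (intro insert.IH) (auto simp: F0_def)
  also have "card F1 \<le> card (?S F1)"
    using insert.prems insert.hyps by (intro insert.IH) (auto simp: F1_def)
  finally have 1: "card F \<le> card (?S F0) + card (?S F1)" by simp
  have finS: "finite (?S F')" for F' :: "'a set set" using insert.hyps(1) by simp
  have "card (?S F0) + card (?S F1) = card (?S F0 \<union> ?S F1) + card (?S F0 \<inter> ?S F1)"
    by (rule card_Un_Int[OF finS finS])
  also have "card (?S F0 \<inter> ?S F1) = card (insert x ` (?S F0 \<inter> ?S F1))"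
    using insert.hyps by (intro card_image[symmetric]) (auto simp: inj_on_def)
  also have "card (?S F0 \<union> ?S F1) + card (insert x ` (?S F0 \<inter> ?S F1)) =
      card ((?S F0 \<union> ?S F1) \<union> insert x ` (?S F0 \<inter> ?S F1))"
    using finS insert.hyps by (intro card_Un_disjoint[symmetric]) auto
  also have "\<dots> \<le> card {K. K \<subseteq> insert x X \<and> shatters F K}"
  proof (intro card_mono)
    show "finite {K. K \<subseteq> insert x X \<and> shatters F K}"
      using insert.hyps(1) by simp
    have a: "shatters F K" if "K \<subseteq> X" "shatters F0 K" for K
      using that(2) unfolding shatters_def F0_def by blast
    have b: "shatters F K" if K: "K \<subseteq> X" "shatters F1 K" for K
      unfolding shatters_def
    proof (intro allI impI)
      fix T assume "T \<subseteq> K"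
      then obtain A where "A \<in> F1" "A \<inter> K = T" using K by (meson shatters_def)
      then obtain B where "B \<in> F" "x \<in> B" "A = B - {x}" by (auto simp: F1_def)
      moreover from this have "B \<inter> K = T" using K insert.hyps \<open>A \<inter> K = T\<close> by auto
      ultimately show "\<exists>A\<in>F. A \<inter> K = T" by blast
    qed
    have c: "shatters F (insert x K)" if K: "K \<subseteq> X" "shatters F0 K" "shatters F1 K" for K
      unfolding shatters_def
    proof (intro allI impI)
      fix T assume T: "T \<subseteq> insert x K"
      show "\<exists>A\<in>F. A \<inter> insert x K = T"
      proof (cases "x \<in> T")
        case True
        have "T - {x} \<subseteq> K" using T by auto
        then obtain A where "A \<in> F1" "A \<inter> K = T - {x}" using K by (meson shatters_def)
        then obtain B where "B \<in> F" "x \<in> B" "A = B - {x}" by (auto simp: F1_def)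
        moreover from this have "B \<inter> insert x K = T"
          using K insert.hyps \<open>A \<inter> K = T - {x}\<close> True by auto
        ultimately show ?thesis by blast
      next
        case False
        then have "T \<subseteq> K" using T by auto
        then obtain A where "A \<in> F0" "A \<inter> K = T" using K by (meson shatters_def)
        then show ?thesis using False by (intro bexI[of _ A]) (auto simp: F0_def)
      qed
    qed
    show "(?S F0 \<union> ?S F1) \<union> insert x ` (?S F0 \<inter> ?S F1) \<subseteq> {K. K \<subseteq> insert x X \<and> shatters F K}"
      using a b c by auto
  qed
  finally show ?case using 1 by linarith
qed

lemma card_small_subsets_less:
  assumes "finite X" "X \<noteq> {}"
  shows "card {K. K \<subseteq> X \<and> card K < k} < (card X + 1) ^ k"
proof (induction k)
  case (Suc k)
  have s: "card X \<ge> 1" using assms by (simp add: Suc_leI card_gt_0_iff)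
  have "{K. K \<subseteq> X \<and> card K < Suc k} = {K. K \<subseteq> X \<and> card K < k} \<union> {K. K \<subseteq> X \<and> card K = k}"
    by auto
  then have "card {K. K \<subseteq> X \<and> card K < Suc k} \<le>
      card {K. K \<subseteq> X \<and> card K < k} + card {K. K \<subseteq> X \<and> card K = k}"
    by (simp add: card_Un_le)
  also have "card {K. K \<subseteq> X \<and> card K = k} = card X choose k"
    using assms by (simp add: n_subsets)
  also have "card X choose k \<le> card X ^ k"
    by (cases "k \<le> card X") (auto intro: binomial_le_pow simp: binomial_eq_0)
  also have "card X ^ k \<le> card X * (card X + 1) ^ k"
    using s power_mono[of "card X" "card X + 1" k] mult_le_mono[of 1 "card X" "card X ^ k" "(card X + 1) ^ k"]
    by simp
  finally show ?case using Suc by simp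
qed simp

text \<open>A family whose shattered sets all had fewer than \<open>k\<close> elements would be
  smaller than assumed; larger shattered sets are cut down to exactly \<open>k\<close> elements. The
  strict inequality in \<open>card_small_subsets_less\<close> settles the boundary case
  \<open>card F = (card X + 1) ^ k\<close>.\<close>

lemma exists_shattered:
  assumes "finite X" "X \<noteq> {}" "\<And>A. A \<in> F \<Longrightarrow> A \<subseteq> X" "card F \<ge> (card X + 1) ^ k"
  shows "\<exists>K. K \<subseteq> X \<and> card K = k \<and> shatters F K"
proof (rule ccontr)
  assume no: "\<not> ?thesis"
  have "card F \<le> card {K. K \<subseteq> X \<and> shatters F K}"
    using assms by (intro card_le_card_shattered) auto
  also have "\<dots> \<le> card {K. K \<subseteq> X \<and> card K < k}"
  proof (rule card_mono)
    show "finite {K. K \<subseteq> X \<and> card K < k}" using assms(1)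
      by simp
    have "card K < k" if K: "shatters F K" "K \<subseteq> X" for K
    proof (rule ccontr)
      assume "\<not> card K < k"
      then obtain L where "L \<subseteq> K" "card L = k" by (meson not_less obtain_subset_with_card_n)
      then show False using no K shatters_mono by blast
    qed
    then show "{K. K \<subseteq> X \<and> shatters F K} \<subseteq> {K. K \<subseteq> X \<and> card K < k}" by blast
  qed
  also have "\<dots> < (card X + 1) ^ k" using card_small_subsets_less assms by blast
  finally show False using assms by simp
qed

subsection \<open>Complete boxes in dense relations\<close>

abbreviation has_box :: "'a set \<Rightarrow> nat \<Rightarrow> ('a \<Rightarrow> 'b set) \<Rightarrow> ('a \<Rightarrow> 'b) set \<Rightarrow> bool" where
  "has_box J t X G \<equiv> \<exists>T. (\<forall>j\<in>J. T j \<subseteq> X j \<and> card (T j) = t) \<and> PiE J T \<subseteq> G"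

text \<open>The partite hypergraph theorem of Kovari-Sos-Turan and Erdos. Remove one coordinate
  \<open>j\<close> and count pairs of a remaining tuple \<open>u\<close> and a \<open>t\<close>-set
  of values that all complete \<open>u\<close> to a member of \<open>G\<close>. Some
  \<open>t\<close>-set \<open>T\<close> serves a positive proportion of all \<open>u\<close>, and
  the induction hypothesis applies to those \<open>u\<close>.\<close>

lemma dense_contains_box:
  assumes "finite J" "c > 0" "t \<ge> 1"
  shows "\<exists>n0. \<forall>X G. (\<forall>j\<in>J. finite (X j) \<and> card (X j) \<ge> n0) \<and> G \<subseteq> PiE J X \<and>
           rcard G \<ge> c * (\<Prod>j\<in>J. rcard (X j)) \<longrightarrow>
           has_box J t X G"
  using assms(1,2)
proof (induction J arbitrary: c rule: finite_induct)
  case empty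
  show ?case
  proof (intro exI[of _ "0::nat"] allI impI)
    fix X :: "'a \<Rightarrow> 'b set" and G :: "('a \<Rightarrow> 'b) set"
    assume *: "(\<forall>j\<in>{}. finite (X j) \<and> 0 \<le> card (X j)) \<and> G \<subseteq> PiE {} X \<and> c * (\<Prod>j\<in>{}. rcard (X j)) \<le> rcard G"
    then have "G \<noteq> {}" using empty by auto
    with * have "G = PiE {} X" by auto
    then show "has_box {} t X G" by auto
  qed
next
  case (insert j J)
  \<comment> \<open>The factor \<open>c / 2\<close> is the proportion of tuples with at least
    \<open>c / 2 * x\<close> completions; \<open>(c / (2 * t)) ^ t\<close> bounds from below the
    number of \<open>t\<close>-sets among so many completions, relative to
    \<open>x ^ t\<close>.\<close>
  define c1 where "c1 = c / 2 * (c / (2 * t)) ^ t"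
  have c1: "c1 > 0" using insert.prems assms(3) by (simp add: c1_def)
  obtain n1 where n1: "\<forall>(X :: 'a \<Rightarrow> 'b set) G. (\<forall>j\<in>J. finite (X j) \<and> card (X j) \<ge> n1) \<and> G \<subseteq> PiE J X \<and>
       rcard G \<ge> c1 * (\<Prod>j\<in>J. rcard (X j)) \<longrightarrow>
           has_box J t X G"
    using insert.IH[OF c1] ..
  \<comment> \<open>The second entry makes \<open>c / 2 * x\<close> exceed \<open>t\<close>, so that
    a large completion set contains a \<open>t\<close>-set at all.\<close>
  define n0 where "n0 = max n1 (nat \<lceil>2 * t / c\<rceil> + 1)"
  show ?case
  proof (intro exI[of _ n0] allI impI)
    fix X :: "'a \<Rightarrow> 'b set" and G :: "('a \<Rightarrow> 'b) set"
    assume *: "(\<forall>i\<in>insert j J. finite (X i) \<and> n0 \<le> card (X i)) \<and> G \<subseteq> PiE (insert j J) X \<and>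
        c * (\<Prod>i\<in>insert j J. rcard (X i)) \<le> rcard G"
    define U where "U = PiE J X"
    define p where "p = (\<Prod>i\<in>J. rcard (X i))"
    define N where "N u = {v \<in> X j. u(j := v) \<in> G}" for u
    define x where "x = rcard (X j)"
    have finX: "finite (X i)" if "i \<in> insert j J" for i using * that by auto
    have finU: "finite U" unfolding U_def using insert.hyps(1) finX by (intro finite_PiE) simp_all
    have cU: "rcard U = p" unfolding U_def p_def using insert.hyps by (simp add: card_PiE)
    have xpos: "x > 2 * t / c" "x > 0"
    proof -
      have "real n0 \<le> x" using * by (simp add: x_def)
      moreover have "2 * t / c < real n0" unfolding n0_def by linarith
      moreover have "2 * t / c \<ge> 0" using insert.prems by simp
      ultimately show "x > 2 * t / c" "x > 0" by linarith+
    qed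
    have p_pos: "p > 0"
    proof -
      have "n0 \<ge> 1" by (simp add: n0_def)
      then show ?thesis unfolding p_def using * by (intro prod_pos) force
    qed
    have "rcard G = (\<Sum>u\<in>U. rcard (N u))"
    proof -
      have "bij_betw (\<lambda>(u, v). u(j := v)) (Sigma U N) G"
      proof (rule bij_betw_imageI)
        show "inj_on (\<lambda>(u, v). u(j := v)) (Sigma U N)"
        proof (rule inj_onI, clarify)
          fix u v u' v' assume h: "u \<in> U" "u' \<in> U" "u(j := v) = u'(j := v')"
          have "u i = u' i" for i
            using h insert.hyps(2) by (cases "i = j") (auto simp: U_def PiE_def extensional_def dest: fun_cong[of _ _ i])
          moreover have "v = v'" using fun_cong[OF h(3), of j] by simp
          ultimately show "u = u' \<and> v = v'" by auto
        qed
        show "(\<lambda>(u, v). u(j := v)) ` Sigma U N = G"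
        proof (intro equalityI subsetI)
          fix g assume g: "g \<in> G"
          then have gP: "g \<in> PiE (insert j J) X" using * by auto
          then have "g(j := undefined) \<in> U" "g j \<in> X j"
            using insert.hyps(2) by (auto simp: U_def PiE_def extensional_def)
          then have "(g(j := undefined), g j) \<in> Sigma U N" using g by (auto simp: N_def)
          moreover have "g = (\<lambda>(u, v). u(j := v)) (g(j := undefined), g j)" by simp
          ultimately show "g \<in> (\<lambda>(u, v). u(j := v)) ` Sigma U N" by (rule rev_image_eqI)
        qed (auto simp: N_def)
      qed
      then have "card G = card (Sigma U N)" by (simp add: bij_betw_same_card)
      also have "\<dots> = (\<Sum>u\<in>U. card (N u))"
        using finU finX by (intro card_SigmaI) (auto simp: N_def)
      finally show ?thesis by simp
    qed
    moreover have "c * (x * p) \<le> rcard G"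
      using * insert.hyps by (simp add: x_def p_def)
    ultimately have "c * (x * p) \<le> (\<Sum>u\<in>U. rcard (N u))" by simp
    then have "c / 2 * x * rcard U \<le> rcard {u \<in> U. c / 2 * x \<le> rcard (N u)} * x"
      using finU xpos insert.prems finX
      by (intro card_ge_half_threshold)
         (auto simp: cU N_def x_def intro!: card_mono)
    then have big: "c / 2 * p \<le> rcard {u \<in> U. c / 2 * x \<le> rcard (N u)}"
      using xpos by (simp add: cU field_simps)
    define D where "D = {u \<in> U. c / 2 * x \<le> rcard (N u)}"
    define TS where "TS = {T. T \<subseteq> X j \<and> card T = t}"
    have finD: "finite D" using finU by (simp add: D_def)
    have finTS: "finite TS" using finX unfolding TS_def by simp
    have cTS: "rcard TS \<le> x ^ t"
    proof -
      have "card TS = card (X j) choose t" unfolding TS_def using finX by (simp add: n_subsets)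
      also have "\<dots> \<le> card (X j) ^ t"
        by (cases "t \<le> card (X j)") (auto intro: binomial_le_pow simp: binomial_eq_0)
      finally show ?thesis by (simp add: x_def flip: of_nat_power)
    qed
    have sub: "(c * x / (2 * t)) ^ t \<le> rcard {T \<in> TS. T \<subseteq> N u}" if u: "u \<in> D" for u
    proof -
      have cu: "c / 2 * x \<le> rcard (N u)" using u by (simp add: D_def)
      have "real t < c / 2 * x" using xpos insert.prems by (simp add: field_simps)
      then have tl: "t \<le> card (N u)" using cu by linarith
      have "{T \<in> TS. T \<subseteq> N u} = {T. T \<subseteq> N u \<and> card T = t}" by (auto simp: TS_def N_def)
      moreover have "finite (N u)" using finX by (simp add: N_def)
      ultimately have "card {T \<in> TS. T \<subseteq> N u} = card (N u) choose t" by (simp add: n_subsets)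
      moreover have "(rcard (N u) / real t) ^ t \<le> real (card (N u) choose t)"
        using tl by (rule binomial_ge_n_over_k_pow_k)
      moreover have "(c * x / (2 * t)) ^ t \<le> (rcard (N u) / real t) ^ t"
        using cu insert.prems xpos assms(3) by (intro power_mono) (auto simp: field_simps)
      ultimately show ?thesis by linarith
    qed
    have "c / 2 * p * (c * x / (2 * t)) ^ t \<le> rcard D * (c * x / (2 * t)) ^ t"
      using big insert.prems xpos by (intro mult_right_mono) (auto simp: D_def)
    also have "\<dots> \<le> (\<Sum>u\<in>D. rcard {T \<in> TS. T \<subseteq> N u})"
      using sub by (intro sum_bounded_below) auto
    also have "\<dots> = (\<Sum>T\<in>TS. rcard {u \<in> D. T \<subseteq> N u})"
      using sum_card_swap[OF finD finTS, of "\<lambda>u T. T \<subseteq> N u"]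
      by (simp flip: of_nat_sum)
    finally have tot: "c1 * p * x ^ t \<le> (\<Sum>T\<in>TS. rcard {u \<in> D. T \<subseteq> N u})"
      by (simp add: c1_def power_mult_distrib power_divide field_simps)
    have "TS \<noteq> {}"
    proof
      assume "TS = {}"
      moreover have "0 < c1 * p * x ^ t" using c1 p_pos xpos by simp
      ultimately show False using tot by simp
    qed
    moreover have "c1 * p * rcard TS \<le> (\<Sum>T\<in>TS. rcard {u \<in> D. T \<subseteq> N u})"
      using order_trans[OF mult_left_mono[OF cTS, of "c1 * p"] tot] c1 p_pos by simp
    ultimately obtain T where T: "T \<in> TS" "c1 * p \<le> rcard {u \<in> D. T \<subseteq> N u}"
      using exists_ge_average[OF finTS, of "c1 * p"] by blast
    have "has_box J t X {u \<in> D. T \<subseteq> N u}"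
    proof (rule n1[rule_format], intro conjI)
      show "\<forall>i\<in>J. finite (X i) \<and> n1 \<le> card (X i)" using * by (auto simp: n0_def)
      show "{u \<in> D. T \<subseteq> N u} \<subseteq> PiE J X" by (auto simp: D_def U_def)
    qed (use T in \<open>auto simp: p_def\<close>)
    then obtain T' where T': "\<forall>i\<in>J. T' i \<subseteq> X i \<and> card (T' i) = t" "PiE J T' \<subseteq> {u \<in> D. T \<subseteq> N u}" by blast
    show "\<exists>T. (\<forall>i\<in>insert j J. T i \<subseteq> X i \<and> card (T i) = t) \<and> PiE (insert j J) T \<subseteq> G"
    proof (intro exI[of _ "T'(j := T)"] conjI subsetI)
      show "\<forall>i\<in>insert j J. (T'(j := T)) i \<subseteq> X i \<and> card ((T'(j := T)) i) = t"
        using T' T by (auto simp: TS_def)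
      fix g assume g: "g \<in> PiE (insert j J) (T'(j := T))"
      then have "g(j := undefined) \<in> PiE J T'" "g j \<in> T"
        using insert.hyps(2) by (auto simp: PiE_def Pi_def extensional_def split: if_splits)
      then have "g j \<in> N (g(j := undefined))" using T'(2) by blast
      then have "(g(j := undefined))(j := g j) \<in> G" unfolding N_def by blast
      then show "g \<in> G" by simp
    qed
  qed
qed

section \<open>Copies of \<open>kU k\<close> in \<open>Trip H\<close>\<close>

lemma setcode_eq: "setcode = set_encode"
  by (auto simp: setcode_def set_encode_def fun_eq_iff)

lemma iso3_sym:
  assumes "iso3 H G" "is_3graph H"
  shows "iso3 G H"
proof -
  obtain f where f: "bij_betw f (fst H) (fst G)" "snd G = (\<lambda>e. f ` e) ` snd H"
    using assms(1) by (auto simp: iso3_def)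
  let ?g = "inv_into (fst H) f"
  have "?g ` f ` e = e" if "e \<in> snd H" for e
    using that f(1) assms(2) by (intro inv_into_image_cancel) (auto simp: is_3graph_def bij_betw_def)
  then have "snd H = (\<lambda>e. ?g ` e) ` snd G"
    unfolding f(2) by (force simp: image_image)
  moreover have "bij_betw ?g (fst G) (fst H)" using f(1) by (rule bij_betw_inv_into)
  ultimately show ?thesis unfolding iso3_def by blast
qed

lemma is_3graph_kU: "is_3graph (kU k)"
proof -
  have "card {3 * j + 2, 3 * i, 3 * s + 1 :: nat} = 3" for i j s
  proof -
    have "3 * j + 2 \<noteq> 3 * i" "3 * j + 2 \<noteq> 3 * s + 1" "3 * i \<noteq> 3 * s + 1" by presburger+
    then show ?thesis by simp
  qed
  then show ?thesis by (auto simp: is_3graph_def kU_def simp del: One_nat_def)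
qed

text \<open>The three roles use the three copies of the vertex set in \<open>Trip H\<close>, so
  vertices of different roles may coincide in \<open>H\<close>. Within a role, \<open>a\<close> and
  \<open>b\<close> are injective because the pattern tells their values apart; the
  \<open>c j\<close> all see the same pattern, so their distinctness is the hypothesis
  \<open>inj\<close>.\<close>

lemma kU_in_TripClass:
  assumes k: "k \<ge> 1" and H: "H \<in> \<H>"
    and a: "\<And>i. i \<in> {1..k} \<Longrightarrow> a i \<in> fst H" and c: "\<And>i. i \<in> {1..k} \<Longrightarrow> c i \<in> fst H"
    and b: "\<And>S. S \<subseteq> {1..k} \<Longrightarrow> b S \<in> fst H"
    and inj: "inj_on c {1..k}"
    and E: "\<And>i j S. i \<in> {1..k} \<Longrightarrow> j \<in> {1..k} \<Longrightarrow> S \<subseteq> {1..k} \<Longrightarrow> {a i, b S, c j} \<in> snd H \<longleftrightarrow> i \<in> S"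
  shows "kU k \<in> TripClass \<H>"
proof -
  \<comment> \<open>\<open>\<phi>\<close> reads the role off the residue mod 3 and preserves that
    residue, so only vertices of the same role have to be told apart.\<close>
  define \<phi> where "\<phi> v = (if v mod 3 = 0 then 3 * a (v div 3)
     else if v mod 3 = 1 then 3 * b (set_decode (v div 3)) + 1 else 3 * c (v div 3) + 2)" for v :: nat
  have p0: "\<phi> (3 * i) = 3 * a i" for i by (simp add: \<phi>_def)
  have p1: "\<phi> (3 * setcode S + 1) = 3 * b S + 1" if "S \<subseteq> {1..k}" for S
  proof -
    have "finite S" using that finite_subset by auto
    moreover have "(3 * setcode S + 1) div 3 = setcode S" by presburger
    moreover have "(3 * setcode S + 1) mod 3 = 1" by presburger
    ultimately show ?thesis by (simp add: \<phi>_def setcode_eq)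
  qed
  have p2: "\<phi> (3 * j + 2) = 3 * c j + 2" for j
  proof -
    have "(3 * j + 2) div 3 = j" "(3 * j + 2) mod 3 = 2" by presburger+
    then show ?thesis by (simp add: \<phi>_def)
  qed
  have inja: "inj_on a {1..k}"
  proof (rule inj_onI)
    fix i i' assume h: "i \<in> {1..k}" "i' \<in> {1..k}" "a i = a i'"
    then show "i = i'" using E[of i 1 "{i}"] E[of i' 1 "{i}"] k by auto
  qed
  have injb: "inj_on b (Pow {1..k})"
  proof (rule inj_onI)
    fix S S' assume h: "S \<in> Pow {1..k}" "S' \<in> Pow {1..k}" "b S = b S'"
    have "i \<in> S \<longleftrightarrow> i \<in> S'" if "i \<in> {1..k}" for i
      using E[of i 1 S] E[of i 1 S'] that h k by auto
    then show "S = S'" using h by blast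
  qed
  define W where "W = \<phi> ` fst (kU k)"
  have Wdef: "W = (\<lambda>i. 3 * a i) ` {1..k} \<union> (\<lambda>S. 3 * b S + 1) ` Pow {1..k} \<union> (\<lambda>j. 3 * c j + 2) ` {1..k}"
    unfolding W_def kU_def fst_conv image_Un image_image
    by (intro arg_cong2[of _ _ _ _ "(\<union>)"] image_cong refl) (simp_all only: p0 p1 p2 Pow_iff)
  have injphi: "inj_on \<phi> (fst (kU k))"
  proof (rule inj_onI)
    fix u v assume uv: "u \<in> fst (kU k)" "v \<in> fst (kU k)" "\<phi> u = \<phi> v"
    have "\<phi> w mod 3 = w mod 3" for w
      by (cases "w mod 3 = 0"; cases "w mod 3 = 1") (simp_all add: \<phi>_def, presburger+)
    then have "u mod 3 = v mod 3" using uv(3) by metis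
    have cases: "(\<exists>i\<in>{1..k}. w = 3 * i) \<or> (\<exists>S. S \<subseteq> {1..k} \<and> w = 3 * setcode S + 1) \<or> (\<exists>j\<in>{1..k}. w = 3 * j + 2)"
      if "w \<in> fst (kU k)" for w using that by (auto simp: kU_def)
    have m: "3 * x mod 3 = (0::nat)" "(3 * x + 1) mod 3 = (1::nat)" "(3 * x + 2) mod 3 = (2::nat)" for x
      by presburger+
    have ne: "(1::nat) \<noteq> 2" "(0::nat) \<noteq> 1" "(0::nat) \<noteq> 2" by simp_all
    have c0: "\<exists>i\<in>{1..k}. w = 3 * i" if "w \<in> fst (kU k)" "w mod 3 = 0" for w
      using cases[OF that(1)] that(2) m ne by metis
    have c1: "\<exists>S. S \<subseteq> {1..k} \<and> w = 3 * setcode S + 1" if "w \<in> fst (kU k)" "w mod 3 = 1" for w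
      using cases[OF that(1)] that(2) m ne by metis
    have c2: "\<exists>j\<in>{1..k}. w = 3 * j + 2" if "w \<in> fst (kU k)" "w mod 3 = 2" for w
      using cases[OF that(1)] that(2) m ne by metis
    have "u mod 3 < 3" by simp
    then consider "u mod 3 = 0" | "u mod 3 = 1" | "u mod 3 = 2" by linarith
    then show "u = v"
    proof cases
      case 1
      then have v1: "v mod 3 = 0" using \<open>u mod 3 = v mod 3\<close> by simp
      obtain i i' where x: "i \<in> {1..k}" "i' \<in> {1..k}" "u = 3 * i" "v = 3 * i'"
        using c0[OF uv(1) 1] c0[OF uv(2) v1] by blast
      have "a i = a i'" using uv(3) unfolding x p0 by simp
      then show ?thesis using inj_onD[OF inja] x by simp
    next
      case 2
      then have v2: "v mod 3 = 1" using \<open>u mod 3 = v mod 3\<close> by simp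
      obtain S S' where y: "S \<subseteq> {1..k}" "S' \<subseteq> {1..k}" "u = 3 * setcode S + 1" "v = 3 * setcode S' + 1"
        using c1[OF uv(1) 2] c1[OF uv(2) v2] by blast
      have "b S = b S'" using uv(3) unfolding y p1[OF y(1)] p1[OF y(2)] by simp
      then have "S = S'" using inj_onD[OF injb] y(1,2) by simp
      then show ?thesis using y by simp
    next
      case 3
      then have v3: "v mod 3 = 2" using \<open>u mod 3 = v mod 3\<close> by simp
      obtain j j' where z: "j \<in> {1..k}" "j' \<in> {1..k}" "u = 3 * j + 2" "v = 3 * j' + 2"
        using c2[OF uv(1) 3] c2[OF uv(2) v3] by blast
      have "c j = c j'" using uv(3) unfolding z p2 by simp
      then show ?thesis using inj_onD[OF inj] z by simp
    qed
  qed
  have sub: "W \<subseteq> fst (Trip H)"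
    unfolding Wdef Trip_def fst_conv using a b c by blast
  have edges: "snd (induced3 (Trip H) W) = (\<lambda>e. \<phi> ` e) ` snd (kU k)"
  proof (intro equalityI subsetI)
    fix e assume "e \<in> snd (induced3 (Trip H) W)"
    then obtain u v w where e: "e = {3 * u, 3 * v + 1, 3 * w + 2}" "{u, v, w} \<in> snd H" "e \<subseteq> W"
      by (auto simp: induced3_def Trip_def)
    have ne: "3 * x \<noteq> 3 * y + 1" "3 * x \<noteq> 3 * y + 2" "3 * x + 1 \<noteq> 3 * y + 2" for x y :: nat
      by presburger+
    have "3 * u \<in> W" "3 * v + 1 \<in> W" "3 * w + 2 \<in> W" using e by auto
    then have "(\<exists>i\<in>{1..k}. 3 * u = 3 * a i)" "(\<exists>S\<in>Pow {1..k}. 3 * v + 1 = 3 * b S + 1)"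
       "(\<exists>j\<in>{1..k}. 3 * w + 2 = 3 * c j + 2)"
      unfolding Wdef Un_iff image_iff using ne by metis+
    then obtain i S j where ij: "i \<in> {1..k}" "S \<subseteq> {1..k}" "j \<in> {1..k}" "u = a i" "v = b S" "w = c j" by auto
    then have "i \<in> S" using e E by auto
    then have "{3 * j + 2, 3 * i, 3 * setcode S + 1} \<in> snd (kU k)" using ij unfolding kU_def snd_conv by blast
    moreover have "e = \<phi> ` {3 * j + 2, 3 * i, 3 * setcode S + 1}"
      unfolding e(1) image_insert image_empty p0 p1[OF ij(2)] p2 ij by auto
    ultimately show "e \<in> (\<lambda>e. \<phi> ` e) ` snd (kU k)" by blast
  next
    fix e assume "e \<in> (\<lambda>e. \<phi> ` e) ` snd (kU k)"
    then obtain i j S where ij: "i \<in> {1..k}" "S \<subseteq> {1..k}" "j \<in> {1..k}" "i \<in> S"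
      and e: "e = \<phi> ` {3 * j + 2, 3 * i, 3 * setcode S + 1}"
      unfolding kU_def snd_conv by blast
    have e': "e = {3 * a i, 3 * b S + 1, 3 * c j + 2}"
      unfolding e image_insert image_empty p0 p1[OF ij(2)] p2 by auto
    have "e \<in> snd (Trip H)" unfolding e' Trip_def snd_conv using E ij by blast
    moreover have "e \<subseteq> W" unfolding e' Wdef using ij by blast
    ultimately show "e \<in> snd (induced3 (Trip H) W)" by (simp add: induced3_def)
  qed
  have "iso3 (kU k) (induced3 (Trip H) W)"
    unfolding iso3_def using injphi edges
    by (intro exI[of _ \<phi>]) (auto simp: bij_betw_def W_def induced3_def)
  then have "iso3 (induced3 (Trip H) W) (kU k)" using is_3graph_kU by (rule iso3_sym)
  then show ?thesis using sub H is_3graph_kU unfolding TripClass_def closure3_def by blast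
qed

section \<open>The symmetric difference as a metric\<close>

definition sdist :: "'a set \<Rightarrow> 'a set \<Rightarrow> real" where
  "sdist A B = rcard ((A - B) \<union> (B - A))"

lemma sdist_commute: "sdist A B = sdist B A"
  by (simp add: sdist_def Un_commute)

lemma sdist_triangle:
  assumes "finite A" "finite B" "finite C"
  shows "sdist A C \<le> sdist A B + sdist B C"
proof -
  have "card ((A - C) \<union> (C - A)) \<le> card (((A - B) \<union> (B - A)) \<union> ((B - C) \<union> (C - B)))"
    using assms by (intro card_mono) auto
  also have "\<dots> \<le> card ((A - B) \<union> (B - A)) + card ((B - C) \<union> (C - B))" by (rule card_Un_le)
  finally show ?thesis by (simp add: sdist_def)
qed

lemma cards_lists: "finite V \<Longrightarrow> rcard {xs. set xs \<subseteq> V \<and> length xs = d} = rcard V ^ d"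
  by (simp add: card_lists_length_eq)

subsection \<open>Neighbourhood nets for relations of bounded slicewise VC-dimension\<close>

text \<open>\<open>noU\<close> is the form in which the absence of \<open>kU k\<close> is used: no
  \<open>k\<close> distinct vertices \<open>c j\<close> see one and the same copy of U(k) in their
  slices. Values of \<open>a\<close>, \<open>b\<close> and \<open>c\<close> may coincide with each
  other.\<close>

locale slicewise =
  fixes V :: "nat set" and f :: "nat \<Rightarrow> nat \<Rightarrow> nat \<Rightarrow> bool" and k :: nat
  assumes finV: "finite V" and k1: "k \<ge> 1"
    and sym12: "f x y z = f y x z" and sym23: "f x y z = f x z y"
    and noU: "\<And>a b c. a ` {1..k} \<subseteq> V \<Longrightarrow> b ` Pow {1..k} \<subseteq> V \<Longrightarrow> c ` {1..k} \<subseteq> V \<Longrightarrow> inj_on c {1..k} \<Longrightarrow>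
        (\<And>i j S. i \<in> {1..k} \<Longrightarrow> j \<in> {1..k} \<Longrightarrow> S \<subseteq> {1..k} \<Longrightarrow> f (a i) (b S) (c j) \<longleftrightarrow> i \<in> S) \<Longrightarrow> False"
begin

definition nb :: "nat \<Rightarrow> nat \<Rightarrow> nat set" where "nb x z = {y \<in> V. f x y z}"

text \<open>This symmetry allows moving \<open>x\<close> inside the slice of \<open>z\<close> and
  afterwards \<open>z\<close> inside the slice of \<open>x\<close>.\<close>

lemma nb_commute: "nb x z = nb z x"
  unfolding nb_def using sym12 sym23 by metis

lemma finite_nb [simp]: "finite (nb x z)" using finV by (simp add: nb_def)

abbreviation "n \<equiv> rcard V"

text \<open>The slice of \<open>z\<close> contains U(k), with the vertices a_i among the entries of
  \<open>ys\<close> and the vertices b_S among those of \<open>xs\<close>. Positions are recorded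
  instead of vertices, so that the number of candidates \<open>(q, p)\<close> depends only on the
  lengths of the lists.\<close>

definition pat :: "nat list \<Rightarrow> nat list \<Rightarrow> (nat \<Rightarrow> nat) \<Rightarrow> (nat set \<Rightarrow> nat) \<Rightarrow> nat \<Rightarrow> bool" where
  "pat xs ys q p z \<longleftrightarrow> (\<forall>i\<in>{1..k}. \<forall>S\<in>Pow {1..k}. f (ys ! q i) (xs ! p S) z \<longleftrightarrow> i \<in> S)"

definition idx :: "nat \<Rightarrow> nat \<Rightarrow> ((nat \<Rightarrow> nat) \<times> (nat set \<Rightarrow> nat)) set" where
  "idx s d = ({1..k} \<rightarrow>\<^sub>E {..<s}) \<times> (Pow {1..k} \<rightarrow>\<^sub>E {..<d})"

definition shat :: "nat list \<Rightarrow> nat list \<Rightarrow> nat \<Rightarrow> bool" where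
  "shat xs ys z \<longleftrightarrow> (\<exists>(q, p)\<in>idx (length ys) (length xs). pat xs ys q p z)"

lemma finite_idx: "finite (idx s d)"
  unfolding idx_def by (intro finite_cartesian_product finite_PiE) auto

text \<open>\<open>k\<close> vertices with the same pattern could serve as the distinct
  \<open>c j\<close> in \<open>noU\<close>.\<close>

lemma card_pat:
  assumes "set xs \<subseteq> V" "set ys \<subseteq> V" "(q, p) \<in> idx (length ys) (length xs)"
  shows "card {z \<in> V. pat xs ys q p z} \<le> k"
proof (rule ccontr)
  assume "\<not> ?thesis"
  then obtain Z where Z: "Z \<subseteq> {z \<in> V. pat xs ys q p z}" "card Z = k" "finite Z"
    by (metis (no_types, lifting) nat_le_linear obtain_subset_with_card_n)
  then obtain c where c: "bij_betw c {1..k} Z"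
    by (metis ex_bij_betw_nat_finite_1)
  have q: "q i < length ys" if "i \<in> {1..k}" for i using assms(3) that by (auto simp: idx_def)
  have p: "p S < length xs" if "S \<in> Pow {1..k}" for S
    using assms(3) that unfolding idx_def by blast
  show False
  proof (rule noU[of "\<lambda>i. ys ! q i" "\<lambda>S. xs ! p S" c])
    show "(\<lambda>i. ys ! q i) ` {1..k} \<subseteq> V" using q assms(2) nth_mem by blast
    show "(\<lambda>S. xs ! p S) ` Pow {1..k} \<subseteq> V" using p assms(1) nth_mem by blast
    show "c ` {1..k} \<subseteq> V" "inj_on c {1..k}" using c Z by (auto simp: bij_betw_def)
    fix i j S assume "i \<in> {1..k}" "j \<in> {1..k}" "S \<subseteq> {1..k}"
    moreover have "c j \<in> Z" using c \<open>j \<in> {1..k}\<close> by (auto simp: bij_betw_def)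
    ultimately show "f (ys ! q i) (xs ! p S) (c j) = (i \<in> S)"
      using Z by (auto simp: pat_def)
  qed
qed

lemma card_shat:
  assumes "set xs \<subseteq> V" "set ys \<subseteq> V"
  shows "card {z \<in> V. shat xs ys z} \<le> k * card (idx (length ys) (length xs))"
proof -
  let ?I = "idx (length ys) (length xs)"
  have "{z \<in> V. shat xs ys z} = (\<Union>(q, p)\<in>?I. {z \<in> V. pat xs ys q p z})"
    by (auto simp: shat_def)
  also have "card \<dots> \<le> (\<Sum>r\<in>?I. card (case r of (q, p) \<Rightarrow> {z \<in> V. pat xs ys q p z}))"
    by (rule card_UN_le[OF finite_idx])
  also have "\<dots> \<le> of_nat (card ?I) * k"
    using card_pat[OF assms] by (intro sum_bounded_above) auto
  finally show ?thesis by (simp add: mult.commute)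
qed

definition far :: "real \<Rightarrow> nat \<Rightarrow> nat \<Rightarrow> nat \<Rightarrow> bool" where
  "far e z x c \<longleftrightarrow> e * n \<le> sdist (nb x z) (nb c z)"

text \<open>Traces are sets of positions in \<open>ys\<close>. There are at least
  \<open>(length ys + 1) ^ k\<close> of them, so \<open>k\<close> positions are shattered;
  \<open>q\<close> enumerates these positions and \<open>p S\<close> points to an entry of
  \<open>xs\<close> whose trace meets them exactly in those belonging to \<open>S\<close>.\<close>

lemma shat_if_traces_distinct:
  assumes ys: "ys \<noteq> []" "set ys \<subseteq> V"
    and inj: "inj_on (\<lambda>i. {t. t < length ys \<and> ys ! t \<in> nb (xs ! i) z}) {..<length xs}"
    and len: "length xs \<ge> (length ys + 1) ^ k"
  shows "shat xs ys z"
proof -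
  let ?tr = "\<lambda>i. {t. t < length ys \<and> ys ! t \<in> nb (xs ! i) z}"
  have "card (?tr ` {..<length xs}) = length xs" using card_image[OF inj] by simp
  then have "\<exists>K. K \<subseteq> {..<length ys} \<and> card K = k \<and> shatters (?tr ` {..<length xs}) K"
    using ys len by (intro exists_shattered) auto
  then obtain K where K: "K \<subseteq> {..<length ys}" "card K = k" "shatters (?tr ` {..<length xs}) K" by blast
  have "finite K" using K finite_subset by blast
  then obtain q0 where q0: "bij_betw q0 {1..k} K" using K ex_bij_betw_nat_finite_1 by metis
  have "\<forall>S\<in>Pow {1..k}. \<exists>i<length xs. ?tr i \<inter> K = q0 ` S"
  proof
    fix S assume "S \<in> Pow {1..k}"
    then have "q0 ` S \<subseteq> K" using q0 by (auto simp: bij_betw_def)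
    then have "\<exists>A\<in>?tr ` {..<length xs}. A \<inter> K = q0 ` S" using K(3) unfolding shatters_def by (elim allE impE)
    then show "\<exists>i<length xs. ?tr i \<inter> K = q0 ` S" by (simp add: Bex_def)
  qed
  then obtain p0 where p0: "\<forall>S\<in>Pow {1..k}. p0 S < length xs \<and> ?tr (p0 S) \<inter> K = q0 ` S" by metis
  define q where "q = restrict q0 {1..k}"
  define p where "p = restrict p0 (Pow {1..k})"
  have "(q, p) \<in> idx (length ys) (length xs)"
    using q0 K p0 by (auto simp: idx_def q_def p_def bij_betw_def)
  moreover have "pat xs ys q p z"
    unfolding pat_def
  proof (intro ballI)
    fix i S assume iS: "i \<in> {1..k}" "S \<in> Pow {1..k}"
    have qi: "q0 i \<in> K" using q0 iS by (auto simp: bij_betw_def)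
    then have ql: "q0 i < length ys" "ys ! q0 i \<in> V" using K ys nth_mem by blast+
    have "f (ys ! q0 i) (xs ! p0 S) z \<longleftrightarrow> ys ! q0 i \<in> nb (xs ! p0 S) z"
      using ql(2) sym12[of "ys ! q0 i" "xs ! p0 S" z] by (simp add: nb_def)
    also have "\<dots> \<longleftrightarrow> q0 i \<in> ?tr (p0 S) \<inter> K" using ql qi by auto
    also have "\<dots> \<longleftrightarrow> q0 i \<in> q0 ` S" using p0 iS by simp
    also have "\<dots> \<longleftrightarrow> i \<in> S" using q0 iS by (intro inj_on_image_mem_iff) (auto simp: bij_betw_def)
    finally show "f (ys ! q i) (xs ! p S) z \<longleftrightarrow> i \<in> S" using iS by (simp add: q_def p_def)
  qed
  ultimately show ?thesis unfolding shat_def by blast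
qed

text \<open>A random \<open>ys\<close> misses the symmetric difference belonging to one far pair of
  entries with probability at most \<open>(1 - e) ^ s\<close>. There are at most
  \<open>d ^ 2\<close> pairs, so with probability at least one half none is missed; then all traces
  differ.\<close>

lemma many_shattering_samples:
  assumes xs: "set xs \<subseteq> V" "sorted_wrt (far e z) xs" "length xs = d"
    and d: "d \<ge> (s + 1) ^ k" and s: "s \<ge> 1" and e: "0 < e" "e < 1" and small: "real d ^ 2 * (1 - e) ^ s \<le> 1 / 2"
  shows "n ^ s / 2 \<le> rcard {ys \<in> {ys. set ys \<subseteq> V \<and> length ys = s}. shat xs ys z}"
proof -
  let ?L = "{ys. set ys \<subseteq> V \<and> length ys = s}"
  define sd where "sd i j = (nb (xs ! i) z - nb (xs ! j) z) \<union> (nb (xs ! j) z - nb (xs ! i) z)" for i j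
  define B where "B i j = {ys. set ys \<subseteq> V - sd i j \<and> length ys = s}" for i j
  define I where "I = {(i, j). i < j \<and> j < d}"
  have I: "I \<subseteq> {..<d} \<times> {..<d}" by (auto simp: I_def)
  have finI: "finite I" using I finite_subset by blast
  have finL: "finite ?L" using finite_lists_length_eq[OF finV] by simp
  have sub: "?L - {ys \<in> ?L. shat xs ys z} \<subseteq> (\<Union>r\<in>I. B (fst r) (snd r))"
  proof
    fix ys assume ys: "ys \<in> ?L - {ys \<in> ?L. shat xs ys z}"
    then have ns: "\<not> shat xs ys z" by blast
    have "\<not> inj_on (\<lambda>i. {t. t < length ys \<and> ys ! t \<in> nb (xs ! i) z}) {..<length xs}"
    proof
      assume "inj_on (\<lambda>i. {t. t < length ys \<and> ys ! t \<in> nb (xs ! i) z}) {..<length xs}"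
      then have "shat xs ys z" using ys xs d s by (intro shat_if_traces_distinct) auto
      with ns show False ..
    qed
    then obtain i j where "i < d" "j < d" "i \<noteq> j"
      and eq: "{t. t < length ys \<and> ys ! t \<in> nb (xs ! i) z} = {t. t < length ys \<and> ys ! t \<in> nb (xs ! j) z}"
      using xs by (auto simp: inj_on_def)
    have *: "ys \<in> B i j \<and> ys \<in> B j i"
    proof -
      have "y \<notin> sd i j \<and> y \<notin> sd j i" if "y \<in> set ys" for y
      proof -
        obtain t where "t < length ys" "y = ys ! t" using \<open>y \<in> set ys\<close> by (metis in_set_conv_nth)
        then show ?thesis using eq unfolding sd_def by blast
      qed
      then show ?thesis using ys unfolding B_def by blast
    qed
    then show "ys \<in> (\<Union>r\<in>I. B (fst r) (snd r))"
    proof (cases "i < j")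
      case True
      then have "(i, j) \<in> I" using \<open>j < d\<close> by (simp add: I_def)
      with * show ?thesis by force
    next
      case False
      then have "(j, i) \<in> I" using \<open>i < d\<close> \<open>i \<noteq> j\<close> by (simp add: I_def)
      with * show ?thesis by force
    qed
  qed
  have cB: "rcard (B i j) \<le> (1 - e) ^ s * n ^ s" if "(i, j) \<in> I" for i j
  proof -
    have ij: "i < j" "j < length xs" using that xs by (auto simp: I_def)
    then have "far e z (xs ! i) (xs ! j)" using xs(2) by (simp add: sorted_wrt_nth_less)
    then have "e * n \<le> rcard (sd i j)" by (simp add: far_def sdist_def sd_def)
    moreover have "sd i j \<subseteq> V" by (auto simp: sd_def nb_def)
    then have "rcard (V - sd i j) = n - rcard (sd i j)"
      using finV by (simp add: card_Diff_subset finite_subset card_mono of_nat_diff)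
    ultimately have "rcard (V - sd i j) \<le> (1 - e) * n" by (simp add: algebra_simps)
    then have "rcard (V - sd i j) ^ s \<le> ((1 - e) * n) ^ s" by (intro power_mono) auto
    then show ?thesis unfolding B_def using finV by (simp add: cards_lists power_mult_distrib)
  qed
  have "rcard (?L - {ys \<in> ?L. shat xs ys z}) \<le> rcard (\<Union>r\<in>I. B (fst r) (snd r))"
  proof -
    have "finite (\<Union>r\<in>I. B (fst r) (snd r))"
      using finI finV unfolding B_def by (intro finite_UN_I finite_lists_length_eq) auto
    then show ?thesis using sub by (simp add: card_mono)
  qed
  also have "\<dots> \<le> real (\<Sum>r\<in>I. card (B (fst r) (snd r)))"
    using card_UN_le[OF finI] by (simp only: of_nat_le_iff)
  also have "\<dots> = (\<Sum>r\<in>I. rcard (B (fst r) (snd r)))" by simp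
  also have "\<dots> \<le> rcard I * ((1 - e) ^ s * n ^ s)"
    using cB by (intro sum_bounded_above) auto
  also have "\<dots> \<le> real d ^ 2 * ((1 - e) ^ s * n ^ s)"
  proof -
    have "card I \<le> d * d" using card_mono[OF _ I] by simp
    then have "rcard I \<le> real d ^ 2" by (simp add: power2_eq_square flip: of_nat_mult)
    then show ?thesis using e by (intro mult_right_mono) auto
  qed
  also have "\<dots> = real d ^ 2 * (1 - e) ^ s * n ^ s" by simp
  also have "\<dots> \<le> 1 / 2 * n ^ s" using small by (intro mult_right_mono) auto
  finally have "rcard (?L - {ys \<in> ?L. shat xs ys z}) \<le> n ^ s / 2" by simp
  moreover have "rcard (?L - {ys \<in> ?L. shat xs ys z}) = n ^ s - rcard {ys \<in> ?L. shat xs ys z}"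
  proof -
    have "rcard (?L - {ys \<in> ?L. shat xs ys z}) = rcard ?L - rcard {ys \<in> ?L. shat xs ys z}"
      by (subst card_Diff_subset) (auto intro!: of_nat_diff card_mono finL rev_finite_subset[OF finL])
    then show ?thesis using cards_lists[OF finV] by simp
  qed
  ultimately show ?thesis by simp
qed

text \<open>\<open>C\<close> is a net for the neighbourhoods in the slice of \<open>z\<close> at
  scale \<open>e * n\<close>, up to a share \<open>\<theta>\<close> of exceptional vertices.\<close>

definition good :: "real \<Rightarrow> real \<Rightarrow> nat \<Rightarrow> nat \<Rightarrow> bool" where
  "good e \<theta> d z \<longleftrightarrow> (\<exists>C\<subseteq>V. card C \<le> d \<and> rcard {x \<in> V. \<forall>c\<in>C. far e z x c} \<le> \<theta> * n)"

text \<open>Greedy choice: in the absence of a net, the entries of a list shorter than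
  \<open>d\<close> leave more than \<open>\<theta> * n\<close> vertices far from all of them, and
  each of these can be prepended.\<close>

lemma many_separated:
  assumes "\<not> good e \<theta> d z" "\<theta> \<ge> 0" "j \<le> d"
  shows "(\<theta> * n) ^ j \<le> rcard {xs. set xs \<subseteq> V \<and> length xs = j \<and> sorted_wrt (far e z) xs}"
  using assms(3)
proof (induction j)
  case 0
  have "{xs. set xs \<subseteq> V \<and> length xs = 0 \<and> sorted_wrt (far e z) xs} = {[]}" by auto
  then show ?case by simp
next
  case (Suc j)
  let ?L = "\<lambda>j. {xs. set xs \<subseteq> V \<and> length xs = j \<and> sorted_wrt (far e z) xs}"
  let ?X = "\<lambda>xs. {x \<in> V. \<forall>c\<in>set xs. far e z x c}"
  have fin: "finite (?L j)" for j
    by (rule finite_subset[OF _ finite_lists_length_eq[OF finV, of j]]) auto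
  have "?L (Suc j) = (\<lambda>(xs, x). x # xs) ` Sigma (?L j) ?X"
  proof (intro equalityI subsetI)
    fix xs assume "xs \<in> ?L (Suc j)"
    then show "xs \<in> (\<lambda>(xs, x). x # xs) ` Sigma (?L j) ?X"
      by (cases xs) (auto intro!: image_eqI[of _ _ "(tl xs, hd xs)"])
  qed auto
  then have "card (?L (Suc j)) = card (Sigma (?L j) ?X)"
    by (simp add: card_image inj_on_def split_def prod_eq_iff)
  also have "\<dots> = (\<Sum>xs\<in>?L j. card (?X xs))"
    using fin finV by (intro card_SigmaI) auto
  finally have "rcard (?L (Suc j)) = (\<Sum>xs\<in>?L j. rcard (?X xs))" by simp
  moreover have "of_nat (card (?L j)) * (\<theta> * n) \<le> (\<Sum>xs\<in>?L j. rcard (?X xs))"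
  proof (intro sum_bounded_below)
    fix xs assume "xs \<in> ?L j"
    then have "set xs \<subseteq> V" "card (set xs) \<le> d" using Suc.prems card_length[of xs] by auto
    then show "\<theta> * n \<le> rcard (?X xs)" using assms(1) unfolding good_def by force
  qed
  moreover have "(\<theta> * n) ^ j * (\<theta> * n) \<le> rcard (?L j) * (\<theta> * n)"
    using Suc assms(2) by (intro mult_right_mono) auto
  ultimately show ?case by (simp add: mult.commute)
qed

text \<open>Double counting of triples \<open>(xs, ys, z)\<close> with \<open>shat xs ys z\<close>:
  a bad slice accounts for at least \<open>(\<theta> * n) ^ d * (n ^ s / 2)\<close> of them, while
  each pair of lists occurs with boundedly many \<open>z\<close>. The powers of \<open>n\<close>
  cancel, so the bound does not depend on \<open>n\<close>.\<close>

lemma few_bad_slices: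
  assumes d: "d \<ge> (s + 1) ^ k" and s: "s \<ge> 1" and e: "0 < e" "e < 1"
    and small: "real d ^ 2 * (1 - e) ^ s \<le> 1 / 2" and th: "\<theta> > 0"
  shows "rcard {z \<in> V. \<not> good e \<theta> d z} \<le> 2 * real (k * card (idx s d)) / \<theta> ^ d"
proof (cases "V = {}")
  case False
  then have n: "n > 0" using finV by (simp add: card_gt_0_iff)
  let ?LX = "{xs. set xs \<subseteq> V \<and> length xs = d}"
  let ?LY = "{ys. set ys \<subseteq> V \<and> length ys = s}"
  let ?LS = "\<lambda>z. {xs. set xs \<subseteq> V \<and> length xs = d \<and> sorted_wrt (far e z) xs}"
  let ?B = "{z \<in> V. \<not> good e \<theta> d z}"
  let ?P = "?LX \<times> ?LY"
  have finP: "finite ?P" using finite_lists_length_eq[OF finV] by simp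
  have finX: "finite ?LX" "finite ?LY" using finite_lists_length_eq[OF finV] by simp_all
  have low: "(\<theta> * n) ^ d * (n ^ s / 2) \<le> rcard {r \<in> ?P. shat (fst r) (snd r) z}" if z: "z \<in> ?B" for z
  proof -
    have "(\<theta> * n) ^ d * (n ^ s / 2) \<le> rcard (?LS z) * (n ^ s / 2)"
      using many_separated[of e \<theta> d z d] z th by (intro mult_right_mono) auto
    also have "\<dots> \<le> (\<Sum>xs\<in>?LS z. rcard {ys \<in> ?LY. shat xs ys z})"
      using many_shattering_samples[OF _ _ _ d s e small] by (intro sum_bounded_below) auto
    also have "\<dots> = rcard (SIGMA xs:?LS z. {ys \<in> ?LY. shat xs ys z})"
    proof -
      have "finite (?LS z)" by (rule finite_subset[OF _ finX(1)]) auto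
      moreover have "finite {ys \<in> ?LY. shat xs ys z}" for xs by (rule rev_finite_subset[OF finX(2)]) auto
      ultimately show ?thesis by (subst card_SigmaI) auto
    qed
    also have "\<dots> \<le> rcard {r \<in> ?P. shat (fst r) (snd r) z}"
      using finP by (intro of_nat_mono card_mono) auto
    finally show ?thesis .
  qed
  have "rcard ?B * ((\<theta> * n) ^ d * (n ^ s / 2)) \<le> (\<Sum>z\<in>?B. rcard {r \<in> ?P. shat (fst r) (snd r) z})"
    using low by (intro sum_bounded_below) auto
  also have "\<dots> \<le> (\<Sum>z\<in>V. rcard {r \<in> ?P. shat (fst r) (snd r) z})"
    using finV by (intro sum_mono2) auto
  also have "\<dots> = (\<Sum>r\<in>?P. rcard {z \<in> V. shat (fst r) (snd r) z})"
    using sum_card_swap[OF finV finP, of "\<lambda>z r. shat (fst r) (snd r) z"] by (simp flip: of_nat_sum)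
  also have "\<dots> \<le> rcard ?P * real (k * card (idx s d))"
  proof (intro sum_bounded_above)
    fix r assume "r \<in> ?P"
    then show "rcard {z \<in> V. shat (fst r) (snd r) z} \<le> real (k * card (idx s d))"
      using card_shat[of "fst r" "snd r"] by (auto simp flip: of_nat_mult)
  qed
  also have "rcard ?P = n ^ d * n ^ s" using cards_lists[OF finV] by (simp add: card_cartesian_product)
  finally have "rcard ?B * \<theta> ^ d / 2 * (n ^ d * n ^ s) \<le> real (k * card (idx s d)) * (n ^ d * n ^ s)"
    by (simp add: power_mult_distrib algebra_simps)
  then have "rcard ?B * \<theta> ^ d / 2 \<le> real (k * card (idx s d))"
    using n by (subst (asm) mult_le_cancel_right) auto
  then show ?thesis using th by (simp add: field_simps)
qed (use th in simp)

text \<open>Pigeonhole: the exceptional vertices take at most \<open>a * n\<close> of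
  \<open>S\<close>, so at least as many remain, and these are shared by at most \<open>d\<close>
  centres.\<close>

lemma cluster:
  assumes g: "good e \<theta> d z" and S: "S \<subseteq> V" "2 * a * n \<le> rcard S" and a: "\<theta> \<le> a" "a > 0" and n: "n > 0"
    and d: "d \<ge> 1"
  shows "\<exists>c\<in>V. a * n / d \<le> rcard {x \<in> S. \<not> far e z x c}"
proof (rule ccontr)
  assume no: "\<not> ?thesis"
  obtain C where C: "C \<subseteq> V" "card C \<le> d" "rcard {x \<in> V. \<forall>c\<in>C. far e z x c} \<le> \<theta> * n"
    using g by (auto simp: good_def)
  have finC: "finite C" using C finV finite_subset by blast
  have finS: "finite S" using S finV finite_subset by blast
  have "card S \<le> card ({x \<in> V. \<forall>c\<in>C. far e z x c} \<union> (\<Union>c\<in>C. {x \<in> S. \<not> far e z x c}))"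
    using S finV finC finS by (intro card_mono) auto
  also have "\<dots> \<le> card {x \<in> V. \<forall>c\<in>C. far e z x c} + (\<Sum>c\<in>C. card {x \<in> S. \<not> far e z x c})"
    by (rule order_trans[OF card_Un_le add_left_mono[OF card_UN_le[OF finC]]])
  finally have *: "rcard S \<le> \<theta> * n + (\<Sum>c\<in>C. rcard {x \<in> S. \<not> far e z x c})"
    using C(3) by (simp flip: of_nat_sum)
  show False
  proof (cases "C = {}")
    case True
    then have "rcard S \<le> a * n" using * mult_right_mono[OF a(1), of n] by simp
    moreover have "a * n < 2 * a * n" using a n by simp
    ultimately show False using S(2) by linarith
  next
    case False
    then have "(\<Sum>c\<in>C. rcard {x \<in> S. \<not> far e z x c}) < of_nat (card C) * (a * n / d)"
      using no C(1) finC by (intro sum_bounded_above_strict) (auto simp: card_gt_0_iff not_le)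
    also have "\<dots> \<le> real d * (a * n / d)"
      using C(2) a n by (intro mult_right_mono) auto
    finally have "rcard S < \<theta> * n + a * n" using * d by simp
    also have "\<dots> \<le> 2 * a * n" using mult_right_mono[OF a(1), of n] by simp
    finally show False using S(2) by simp
  qed
qed

text \<open>Clustering twice. Each good slice \<open>z\<close> with many pairs of \<open>U\<close>
  contains a cluster \<open>Q z\<close> of vertices with nearly equal neighbourhoods; some good
  \<open>x'\<close> lies in many of these clusters, and the corresponding \<open>z\<close> are
  clustered around a \<open>z'\<close> in the slice of \<open>x'\<close>. Replacing \<open>x\<close>
  by \<open>x'\<close> costs \<open>2 * e * n\<close>, replacing \<open>z\<close> by
  \<open>z'\<close> costs another \<open>e * n\<close>.\<close>

lemma heavy_neighbourhood:
  assumes e: "0 < e" and eta: "0 < \<eta>" "\<eta> \<le> 1" and d: "d \<ge> 1"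
    and th: "0 < \<theta>" "\<theta> \<le> \<eta> ^ 2 / (64 * real d)"
    and bad: "rcard {z \<in> V. \<not> good e \<theta> d z} \<le> K" and K: "8 * real d * K / \<eta> \<le> n" and n: "n > 0"
    and U: "U \<subseteq> V \<times> V" "\<eta> * n ^ 2 \<le> rcard U"
  shows "\<exists>x'\<in>V. \<exists>z'\<in>V. \<eta> ^ 3 / (256 * real d ^ 3) * n ^ 2 \<le>
      rcard {p \<in> U. sdist (nb (fst p) (snd p)) (nb x' z') \<le> 3 * e * n}"
proof -
  define Bd where "Bd = {z \<in> V. \<not> good e \<theta> d z}"
  have Bd: "rcard Bd \<le> K" "Bd \<subseteq> V" "finite Bd" using bad finV by (auto simp: Bd_def)
  have K0: "K \<ge> 0" using bad by linarith
  have Kn: "8 * real d * K \<le> \<eta> * n" using K eta by (simp add: field_simps)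
  have Kn': "K \<le> \<eta> * n / (8 * real d)" using Kn d by (simp add: field_simps)
  have Kn2: "K \<le> \<eta> * n / 8"
  proof -
    have "8 * 1 * K \<le> 8 * real d * K" using d K0 by (intro mult_right_mono) auto
    then show ?thesis using Kn by simp
  qed
  define u where "u z = {x \<in> V. (x, z) \<in> U}" for z
  have finU: "finite U" using U finV finite_subset by blast
  have "card U = card {(z, x) \<in> V \<times> V. (x, z) \<in> U}"
  proof (rule bij_betw_same_card[of prod.swap], rule bij_betw_imageI)
    show "prod.swap ` U = {(z, x) \<in> V \<times> V. (x, z) \<in> U}"
      using U by (force simp: image_iff)
  qed simp
  also have "\<dots> = (\<Sum>z\<in>V. card (u z))"
    using card_pairs_sum[OF finV finV, of "\<lambda>z x. (x, z) \<in> U"] by (simp add: u_def)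
  finally have cU: "rcard U = (\<Sum>z\<in>V. rcard (u z))" by simp
  define A where "A = {z \<in> V. \<eta> * n / 2 \<le> rcard (u z)}"
  have finA: "finite A" using finV by (simp add: A_def)
  have "\<eta> * n / 2 * n \<le> rcard A * n"
    unfolding A_def
  proof (rule card_ge_half_threshold[OF finV])
    show "rcard (u z) \<le> n" for z using finV by (auto simp: u_def intro: card_mono)
  qed (use eta n U cU in \<open>auto simp: power2_eq_square algebra_simps\<close>)
  then have A1: "\<eta> * n / 2 \<le> rcard A" using n by simp
  define A' where "A' = A - Bd"
  have A'V: "A' \<subseteq> V" "finite A'" using finA by (auto simp: A'_def A_def)
  have A2: "\<eta> * n / 4 \<le> rcard A'"
  proof -
    have "card A \<le> card A' + card Bd"
      unfolding A'_def using Bd(3) by (metis card_Diff_subset_Int diff_card_le_card_Diff le_diff_conv add.commute)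
    then have "rcard A \<le> rcard A' + K" using Bd(1) by linarith
    then show ?thesis using A1 Kn2 eta n by simp
  qed
  have th2: "\<theta> \<le> \<eta> / 4"
  proof -
    have "\<eta> ^ 2 / (64 * real d) \<le> \<eta> ^ 2 / 64" using d by (intro divide_left_mono) auto
    also have "\<dots> \<le> \<eta> / 64" using eta by (simp add: power2_eq_square mult_left_le)
    also have "\<dots> \<le> \<eta> / 4" using eta by simp
    finally show ?thesis using th by linarith
  qed
  have "\<exists>c. \<eta> / 4 * n / d \<le> rcard {x \<in> u z. \<not> far e z x c}" if "z \<in> A'" for z
    using cluster[of e \<theta> d z "u z" "\<eta> / 4"] that th2 eta n d
    by (force simp: A'_def A_def Bd_def u_def)
  then obtain p where p: "\<And>z. z \<in> A' \<Longrightarrow> \<eta> / 4 * n / d \<le> rcard {x \<in> u z. \<not> far e z x (p z)}" by metis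
  define Q where "Q z = {x \<in> u z. \<not> far e z x (p z)}" for z
  have QV: "Q z \<subseteq> V" "finite (Q z)" for z using finV by (auto simp: Q_def u_def)
  have Q: "\<eta> * n / (4 * real d) \<le> rcard (Q z)" if "z \<in> A'" for z using p[OF that] by (simp add: Q_def)
  have Qclose: "sdist (nb x z) (nb x' z) \<le> 2 * e * n" if "x \<in> Q z" "x' \<in> Q z" for x x' z
  proof -
    have "sdist (nb x z) (nb x' z) \<le> sdist (nb x z) (nb (p z) z) + sdist (nb (p z) z) (nb x' z)"
      by (rule sdist_triangle) auto
    then show ?thesis using that by (simp add: Q_def far_def sdist_commute[of "nb (p z) z"])
  qed
  \<comment> \<open>\<open>x'\<close> will index a slice of its own, so bad vertices are removed
    from the clusters; by \<open>Kn'\<close> this costs at most half of the guaranteed size.\<close>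
  have QB: "\<eta> * n / (8 * real d) \<le> rcard {x \<in> V - Bd. x \<in> Q z}" if "z \<in> A'" for z
  proof -
    have "card (Q z) \<le> card {x \<in> V - Bd. x \<in> Q z} + card Bd"
      using card_Un_le[of "{x \<in> V - Bd. x \<in> Q z}" Bd] card_mono[of "{x \<in> V - Bd. x \<in> Q z} \<union> Bd" "Q z"] QV(1)[of z] finV Bd(3)
      by (auto intro: order_trans)
    then have "rcard (Q z) \<le> rcard {x \<in> V - Bd. x \<in> Q z} + K" using Bd(1) by linarith
    moreover have "\<eta> * n / (4 * real d) = \<eta> * n / (8 * real d) + \<eta> * n / (8 * real d)" by simp
    ultimately show ?thesis using Q[OF that] Kn' by linarith
  qed
  have "\<eta> ^ 2 * n / (32 * real d) * n = \<eta> * n / 4 * (\<eta> * n / (8 * real d))" by (simp add: power2_eq_square)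
  also have "\<dots> \<le> rcard A' * (\<eta> * n / (8 * real d))" using A2 eta n by (intro mult_right_mono) auto
  also have "\<dots> \<le> (\<Sum>z\<in>A'. rcard {x \<in> V - Bd. x \<in> Q z})" using QB by (intro sum_bounded_below) auto
  also have "\<dots> = (\<Sum>x\<in>V - Bd. rcard {z \<in> A'. x \<in> Q z})"
    using sum_card_swap[of A' "V - Bd" "\<lambda>z x. x \<in> Q z"] A'V finV by (simp flip: of_nat_sum)
  finally have tot: "\<eta> ^ 2 * n / (32 * real d) * n \<le> (\<Sum>x\<in>V - Bd. rcard {z \<in> A'. x \<in> Q z})" .
  have pos: "\<eta> ^ 2 * n / (32 * real d) * n > 0" using eta n d by simp
  then have "V - Bd \<noteq> {}" using tot by (intro notI) simp
  moreover have "\<eta> ^ 2 * n / (32 * real d) * rcard (V - Bd) \<le> \<eta> ^ 2 * n / (32 * real d) * n"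
    using finV by (intro mult_left_mono) (auto intro: card_mono)
  ultimately obtain x' where x': "x' \<in> V - Bd" "\<eta> ^ 2 * n / (32 * real d) \<le> rcard {z \<in> A'. x' \<in> Q z}"
    using exists_ge_average[of "V - Bd" "\<eta> ^ 2 * n / (32 * real d)" "\<lambda>x. rcard {z \<in> A'. x \<in> Q z}"] finV tot
    by force
  define Zs where "Zs = {z \<in> A'. x' \<in> Q z}"
  \<comment> \<open>The guaranteed proportion of \<open>Zs\<close> is twice
    \<open>\<eta> ^ 2 / (64 * real d)\<close>; the assumed bound on \<open>\<theta>\<close> is
    exactly what \<open>cluster\<close> asks for here.\<close>
  have "\<exists>c\<in>V. \<eta> ^ 2 / (64 * real d) * n / d \<le> rcard {z \<in> Zs. \<not> far e x' z c}"
  proof (rule cluster)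
    show "good e \<theta> d x'" using x' by (auto simp: Bd_def)
    show "Zs \<subseteq> V" using A'V by (auto simp: Zs_def)
    show "2 * (\<eta>\<^sup>2 / (64 * real d)) * n \<le> rcard Zs" using x'(2) by (simp add: Zs_def)
  qed (use th eta d n in auto)
  then obtain z' where z': "z' \<in> V" "\<eta> ^ 2 / (64 * real d) * n / d \<le> rcard {z \<in> Zs. \<not> far e x' z z'}" by blast
  define Z2 where "Z2 = {z \<in> Zs. \<not> far e x' z z'}"
  have finZ2: "finite Z2" using A'V by (simp add: Z2_def Zs_def)
  have "\<eta> ^ 3 / (256 * real d ^ 3) * n ^ 2 = \<eta> ^ 2 / (64 * real d) * n / d * (\<eta> * n / (4 * real d))"
    by (simp add: power2_eq_square power3_eq_cube mult_ac)
  also have "\<dots> \<le> rcard Z2 * (\<eta> * n / (4 * real d))"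
    using z'(2) eta n unfolding Z2_def by (intro mult_right_mono) auto
  also have "\<dots> \<le> (\<Sum>z\<in>Z2. rcard (Q z))"
    using Q by (intro sum_bounded_below) (auto simp: Z2_def Zs_def)
  also have "\<dots> = rcard (Sigma Z2 Q)" using finZ2 QV by (subst card_SigmaI) auto
  also have "\<dots> = rcard (prod.swap ` Sigma Z2 Q)" by (simp add: card_image)
  also have "\<dots> \<le> rcard {p \<in> U. sdist (nb (fst p) (snd p)) (nb x' z') \<le> 3 * e * n}"
  proof (intro of_nat_mono card_mono subsetI)
    show "finite {p \<in> U. sdist (nb (fst p) (snd p)) (nb x' z') \<le> 3 * e * n}" using finU by simp
    fix p assume "p \<in> prod.swap ` Sigma Z2 Q"
    then obtain x z where xz: "p = (x, z)" "z \<in> Z2" "x \<in> Q z" by auto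
    have "(x, z) \<in> U" using xz by (auto simp: Q_def u_def)
    moreover have "sdist (nb x z) (nb x' z') \<le> sdist (nb x z) (nb x' z) + sdist (nb x' z) (nb x' z')"
      by (rule sdist_triangle) auto
    moreover have "sdist (nb x z) (nb x' z) \<le> 2 * e * n"
      using xz by (intro Qclose) (auto simp: Z2_def Zs_def)
    moreover have "sdist (nb x' z) (nb x' z') \<le> e * n"
      using xz by (auto simp: Z2_def far_def nb_commute[of x'])
    ultimately show "p \<in> {p \<in> U. sdist (nb (fst p) (snd p)) (nb x' z') \<le> 3 * e * n}"
      using xz by auto
  qed
  finally show ?thesis using z'(1) x'(1) by blast
qed

definition uncovered :: "real \<Rightarrow> nat set set \<Rightarrow> (nat \<times> nat) set" where
  "uncovered r \<S> = {p \<in> V \<times> V. \<forall>S\<in>\<S>. \<not> sdist (nb (fst p) (snd p)) S \<le> r}"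

text \<open>Greedy covering by joint neighbourhoods. As long as more than
  \<open>\<eta> * n ^ 2\<close> pairs are uncovered, \<open>heavy_neighbourhood\<close> supplies a
  set covering a further share \<open>\<kappa>\<close> of all pairs, so about
  \<open>1 / \<kappa>\<close> sets suffice.\<close>

lemma exists_net:
  assumes e: "0 < e" and eta: "0 < \<eta>" "\<eta> \<le> 1" and d: "d \<ge> 1"
    and th: "0 < \<theta>" "\<theta> \<le> \<eta> ^ 2 / (64 * real d)"
    and bad: "rcard {z \<in> V. \<not> good e \<theta> d z} \<le> K" and K: "8 * real d * K / \<eta> \<le> n" and n: "n > 0"
  shows "\<exists>\<S>. finite \<S> \<and> \<S> \<subseteq> Pow V \<and> card \<S> \<le> nat \<lceil>256 * real d ^ 3 / \<eta> ^ 3\<rceil> \<and>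
     rcard (uncovered (3 * e * n) \<S>) \<le> \<eta> * n ^ 2"
proof -
  define \<kappa> where "\<kappa> = \<eta> ^ 3 / (256 * real d ^ 3)"
  have \<kappa>: "\<kappa> > 0" using eta d by (simp add: \<kappa>_def)
  have finUn: "finite (uncovered r \<S>)" for r \<S> using finV by (simp add: uncovered_def)
  have "\<exists>\<S>. finite \<S> \<and> \<S> \<subseteq> Pow V \<and> card \<S> \<le> i \<and>
     (rcard (uncovered (3 * e * n) \<S>) \<le> \<eta> * n ^ 2 \<or> rcard (uncovered (3 * e * n) \<S>) \<le> (1 - i * \<kappa>) * n ^ 2)"
    for i :: nat
  proof (induction i)
    case 0
    have "card (uncovered (3 * e * n) {}) \<le> card (V \<times> V)"
      using finV by (intro card_mono) (auto simp: uncovered_def)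
    then have "rcard (uncovered (3 * e * n) {}) \<le> n ^ 2"
      by (simp add: card_cartesian_product power2_eq_square flip: of_nat_mult)
    then show ?case by (intro exI[of _ "{}"]) auto
  next
    case (Suc i)
    then obtain \<S> where S: "finite \<S>" "\<S> \<subseteq> Pow V" "card \<S> \<le> i"
      "rcard (uncovered (3 * e * n) \<S>) \<le> \<eta> * n ^ 2 \<or> rcard (uncovered (3 * e * n) \<S>) \<le> (1 - i * \<kappa>) * n ^ 2" by blast
    show ?case
    proof (cases "rcard (uncovered (3 * e * n) \<S>) \<le> \<eta> * n ^ 2")
      case True then show ?thesis using S by (intro exI[of _ \<S>]) auto
    next
      case False
      let ?U = "uncovered (3 * e * n) \<S>"
      have "\<exists>x'\<in>V. \<exists>z'\<in>V. \<eta> ^ 3 / (256 * real d ^ 3) * n ^ 2 \<le>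
          rcard {p \<in> ?U. sdist (nb (fst p) (snd p)) (nb x' z') \<le> 3 * e * n}"
        using False by (intro heavy_neighbourhood[OF e eta d th bad K n]) (auto simp: uncovered_def)
      then obtain x' z' where xz: "\<kappa> * n ^ 2 \<le> rcard {p \<in> ?U. sdist (nb (fst p) (snd p)) (nb x' z') \<le> 3 * e * n}"
        unfolding \<kappa>_def by blast
      let ?C = "{p \<in> ?U. sdist (nb (fst p) (snd p)) (nb x' z') \<le> 3 * e * n}"
      have "uncovered (3 * e * n) (insert (nb x' z') \<S>) = ?U - ?C" by (auto simp: uncovered_def)
      moreover have "rcard (?U - ?C) = rcard ?U - rcard ?C"
        using finUn by (subst card_Diff_subset) (auto intro!: of_nat_diff card_mono)
      ultimately have "rcard (uncovered (3 * e * n) (insert (nb x' z') \<S>)) \<le> (1 - Suc i * \<kappa>) * n ^ 2"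
        using xz S(4) False by (simp add: algebra_simps)
      moreover have "card (insert (nb x' z') \<S>) \<le> Suc i" using S by (simp add: card_insert_le_m1 card_insert_if)
      moreover have "nb x' z' \<in> Pow V" by (auto simp: nb_def)
      ultimately show ?thesis using S by (intro exI[of _ "insert (nb x' z') \<S>"]) auto
    qed
  qed
  from this[of "nat \<lceil>256 * real d ^ 3 / \<eta> ^ 3\<rceil>"] obtain \<S> where S: "finite \<S>" "\<S> \<subseteq> Pow V"
    "card \<S> \<le> nat \<lceil>256 * real d ^ 3 / \<eta> ^ 3\<rceil>"
    "rcard (uncovered (3 * e * n) \<S>) \<le> \<eta> * n ^ 2 \<or>
     rcard (uncovered (3 * e * n) \<S>) \<le> (1 - real (nat \<lceil>256 * real d ^ 3 / \<eta> ^ 3\<rceil>) * \<kappa>) * n ^ 2" by blast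
  have "1 \<le> real (nat \<lceil>256 * real d ^ 3 / \<eta> ^ 3\<rceil>) * \<kappa>"
  proof -
    have "1 = 256 * real d ^ 3 / \<eta> ^ 3 * \<kappa>" using eta d by (simp add: \<kappa>_def)
    also have "\<dots> \<le> real (nat \<lceil>256 * real d ^ 3 / \<eta> ^ 3\<rceil>) * \<kappa>"
      using \<kappa> by (intro mult_right_mono) linarith+
    finally show ?thesis .
  qed
  then have "(1 - real (nat \<lceil>256 * real d ^ 3 / \<eta> ^ 3\<rceil>) * \<kappa>) * n ^ 2 \<le> 0" by (intro mult_nonpos_nonneg) auto
  moreover have "0 \<le> \<eta> * n ^ 2" using eta by simp
  ultimately have "rcard (uncovered (3 * e * n) \<S>) \<le> \<eta> * n ^ 2" using S(4) by linarith
  then show ?thesis using S by blast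
qed

end

subsection \<open>Averaging over the cells of a colouring\<close>

abbreviation adj :: "graph3 \<Rightarrow> nat \<Rightarrow> nat \<Rightarrow> nat \<Rightarrow> bool" where
  "adj H x y z \<equiv> {x, y, z} \<in> snd H"

lemma card_triples_eq_sum:
  assumes "finite A" "finite B" "finite C"
  shows "rcard {(x, y, z) \<in> A \<times> B \<times> C. R x y z} = (\<Sum>x\<in>A. \<Sum>y\<in>B. \<Sum>z\<in>C. of_bool (R x y z))"
proof -
  have "(\<Sum>x\<in>A. \<Sum>y\<in>B. \<Sum>z\<in>C. of_bool (R x y z) :: real) = (\<Sum>(x, y, z)\<in>A \<times> B \<times> C. of_bool (R x y z))"
    by (simp add: sum.cartesian_product)
  also have "\<dots> = (\<Sum>p\<in>A \<times> B \<times> C. of_bool (case p of (x, y, z) \<Rightarrow> R x y z))"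
    by (intro sum.cong) auto
  also have "\<dots> = rcard ((A \<times> B \<times> C) \<inter> {p. case p of (x, y, z) \<Rightarrow> R x y z})"
    using assms by simp
  also have "(A \<times> B \<times> C) \<inter> {p. case p of (x, y, z) \<Rightarrow> R x y z} = {(x, y, z) \<in> A \<times> B \<times> C. R x y z}" by auto
  finally show ?thesis by simp
qed

context slicewise
begin

definition cell :: "(nat \<Rightarrow> 'c) \<Rightarrow> nat \<Rightarrow> nat set" where
  "cell c x = {v \<in> V. c v = c x}"

text \<open>The conditional expectation of \<open>g\<close> given the colour; \<open>sum_avg\<close>
  is the law of total expectation.\<close>

definition avg :: "(nat \<Rightarrow> 'c) \<Rightarrow> nat \<Rightarrow> (nat \<Rightarrow> real) \<Rightarrow> real" where
  "avg c x g = (\<Sum>v\<in>cell c x. g v) / rcard (cell c x)"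

lemma cell_subset: "cell c x \<subseteq> V" and finite_cell [simp]: "finite (cell c x)"
  using finV by (auto simp: cell_def)

lemma card_cell_pos: "x \<in> V \<Longrightarrow> rcard (cell c x) > 0"
  by (auto simp: cell_def card_gt_0_iff finV)

lemma avg_const: "x \<in> V \<Longrightarrow> avg c x (\<lambda>_. h) = h"
  using card_cell_pos[of x c] by (auto simp: avg_def)

lemma avg_add: "avg c x (\<lambda>v. g v + h v) = avg c x g + avg c x h"
  by (simp add: avg_def sum.distrib add_divide_distrib)

lemma avg_diff: "avg c x (\<lambda>v. g v - h v) = avg c x g - avg c x h"
  by (simp add: avg_def sum_subtractf diff_divide_distrib)

lemma avg_mono: "(\<And>v. v \<in> V \<Longrightarrow> c v = c x \<Longrightarrow> g v \<le> h v) \<Longrightarrow> avg c x g \<le> avg c x h"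
  unfolding avg_def by (intro divide_right_mono sum_mono) (auto simp: cell_def)

lemma avg_cong: "(\<And>v. v \<in> V \<Longrightarrow> c v = c x \<Longrightarrow> g v = h v) \<Longrightarrow> avg c x g = avg c x h"
  unfolding avg_def by (intro arg_cong2[of _ _ _ _ "(/)"] sum.cong) (auto simp: cell_def)

lemma avg_sum: "avg c x (\<lambda>v. \<Sum>y\<in>A. g v y) = (\<Sum>y\<in>A. avg c x (\<lambda>v. g v y))"
  unfolding avg_def by (subst sum.swap) (simp add: sum_divide_distrib)

lemma sum_avg: "(\<Sum>x\<in>V. avg c x g) = (\<Sum>x\<in>V. g x)"
proof -
  have "(\<Sum>x\<in>V. avg c x g) = (\<Sum>x\<in>V. \<Sum>v\<in>V. if c v = c x then g v / rcard (cell c x) else 0)"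
    unfolding avg_def cell_def using finV
    by (intro sum.cong refl) (simp add: sum_divide_distrib sum.inter_filter if_distrib[of "\<lambda>a. a / _"] cong: if_cong)
  also have "\<dots> = (\<Sum>v\<in>V. \<Sum>x\<in>V. if c v = c x then g v / rcard (cell c x) else 0)"
    by (rule sum.swap)
  also have "\<dots> = (\<Sum>v\<in>V. \<Sum>x\<in>cell c v. g v / rcard (cell c v))"
  proof (rule sum.cong[OF refl])
    fix v assume "v \<in> V"
    have "(\<Sum>x\<in>V. if c v = c x then g v / rcard (cell c x) else 0) =
        (\<Sum>x\<in>V. if c x = c v then g v / rcard (cell c v) else 0)"
      by (intro sum.cong refl) (simp add: cell_def)
    also have "\<dots> = (\<Sum>x\<in>{x \<in> V. c x = c v}. g v / rcard (cell c v))"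
      by (rule sum.inter_filter[OF finV, symmetric])
    finally show "(\<Sum>x\<in>V. if c v = c x then g v / rcard (cell c x) else 0) =
       (\<Sum>x\<in>cell c v. g v / rcard (cell c v))" unfolding cell_def .
  qed
  also have "\<dots> = (\<Sum>v\<in>V. g v)"
    using card_cell_pos[of _ c] by (intro sum.cong refl) (force)
  finally show ?thesis .
qed

text \<open>The probability that independent resampling of \<open>x\<close>, \<open>y\<close>,
  \<open>z\<close> within their cells changes the adjacency. Below, \<open>vary\<close> resamples
  the middle coordinate alone and is already summed over it.\<close>

definition flip :: "(nat \<Rightarrow> 'c) \<Rightarrow> nat \<Rightarrow> nat \<Rightarrow> nat \<Rightarrow> real" where
  "flip c x y z = avg c x (\<lambda>x'. avg c y (\<lambda>y'. avg c z (\<lambda>z'. of_bool (f x' y' z' \<noteq> f x y z))))"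

abbreviation flips :: "(nat \<Rightarrow> 'c) \<Rightarrow> real" where
  "flips c \<equiv> (\<Sum>x\<in>V. \<Sum>y\<in>V. \<Sum>z\<in>V. flip c x y z)"

definition vary :: "(nat \<Rightarrow> 'c) \<Rightarrow> nat \<Rightarrow> nat \<Rightarrow> real" where
  "vary c x z = (\<Sum>y\<in>V. avg c y (\<lambda>y'. of_bool (f x y z \<noteq> f x y' z)))"

text \<open>Resample the three coordinates one after the other: each resampled triple is again uniform.\<close>
lemma sum_flip_le:
  "flips c \<le> 3 * (\<Sum>x\<in>V. \<Sum>z\<in>V. vary c x z)"
proof -
  let ?T = "\<Sum>x\<in>V. \<Sum>z\<in>V. vary c x z"
  define t1 where "t1 x y z = avg c x (\<lambda>x'. of_bool (f x y z \<noteq> f x' y z))" for x y z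
  define t2 where "t2 x y z = avg c x (\<lambda>x'. avg c y (\<lambda>y'. of_bool (f x' y z \<noteq> f x' y' z)))" for x y z
  define t3 where "t3 x y z = avg c x (\<lambda>x'. avg c y (\<lambda>y'. avg c z (\<lambda>z'. of_bool (f x' y' z \<noteq> f x' y' z'))))" for x y z
  have "flip c x y z \<le> t1 x y z + (t2 x y z + t3 x y z)" if xyz: "x \<in> V" "y \<in> V" "z \<in> V" for x y z
  proof -
    have "flip c x y z \<le> avg c x (\<lambda>x'. avg c y (\<lambda>y'. avg c z (\<lambda>z'. of_bool (f x y z \<noteq> f x' y z) +
        (of_bool (f x' y z \<noteq> f x' y' z) + of_bool (f x' y' z \<noteq> f x' y' z')))))"
      unfolding flip_def by (intro avg_mono) auto
    also have "\<dots> = t1 x y z + (t2 x y z + t3 x y z)"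
      unfolding t1_def t2_def t3_def using xyz by (simp add: avg_add avg_const)
    finally show ?thesis .
  qed
  then have "flips c \<le>
     (\<Sum>x\<in>V. \<Sum>y\<in>V. \<Sum>z\<in>V. t1 x y z + (t2 x y z + t3 x y z))"
    by (intro sum_mono) auto
  also have "\<dots> = (\<Sum>x\<in>V. \<Sum>y\<in>V. \<Sum>z\<in>V. t1 x y z) + ((\<Sum>x\<in>V. \<Sum>y\<in>V. \<Sum>z\<in>V. t2 x y z) + (\<Sum>x\<in>V. \<Sum>y\<in>V. \<Sum>z\<in>V. t3 x y z))"
    by (simp add: sum.distrib)
  also have "(\<Sum>x\<in>V. \<Sum>y\<in>V. \<Sum>z\<in>V. t1 x y z) = ?T"
  proof -
    have "(\<Sum>x\<in>V. \<Sum>y\<in>V. \<Sum>z\<in>V. t1 x y z) = (\<Sum>y\<in>V. \<Sum>x\<in>V. \<Sum>z\<in>V. t1 x y z)" by (rule sum.swap)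
    also have "\<dots> = (\<Sum>y\<in>V. \<Sum>z\<in>V. \<Sum>x\<in>V. t1 x y z)" by (intro sum.cong refl sum.swap)
    also have "\<dots> = ?T"
      unfolding t1_def vary_def
    proof (intro sum.cong refl avg_cong)
      fix y z x x'
      show "of_bool (f x y z \<noteq> f x' y z) = (of_bool (f y x z \<noteq> f y x' z) :: real)"
        using sym12[of x y z] sym12[of x' y z] by simp
    qed
    finally show ?thesis .
  qed
  also have "(\<Sum>x\<in>V. \<Sum>y\<in>V. \<Sum>z\<in>V. t2 x y z) = ?T"
  proof -
    have "(\<Sum>x\<in>V. \<Sum>y\<in>V. \<Sum>z\<in>V. t2 x y z) = (\<Sum>x\<in>V. \<Sum>z\<in>V. \<Sum>y\<in>V. t2 x y z)"
      by (intro sum.cong refl sum.swap)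
    also have "\<dots> = (\<Sum>x\<in>V. avg c x (\<lambda>x'. \<Sum>z\<in>V. vary c x' z))"
      unfolding t2_def vary_def by (simp only: avg_sum)
    also have "\<dots> = ?T" by (rule sum_avg)
    finally show ?thesis .
  qed
  also have "(\<Sum>x\<in>V. \<Sum>y\<in>V. \<Sum>z\<in>V. t3 x y z) = ?T"
  proof -
    have "vary c x y = (\<Sum>z\<in>V. avg c z (\<lambda>z'. of_bool (f x y z \<noteq> f x y z')))" for x y
      unfolding vary_def
    proof (intro sum.cong refl avg_cong)
      fix z z'
      show "of_bool (f x z y \<noteq> f x z' y) = (of_bool (f x y z \<noteq> f x y z') :: real)"
        using sym23[of x z y] sym23[of x z' y] by simp
    qed
    then have "(\<Sum>x\<in>V. \<Sum>y\<in>V. \<Sum>z\<in>V. t3 x y z) = (\<Sum>x\<in>V. avg c x (\<lambda>x'. \<Sum>y\<in>V. avg c y (\<lambda>y'. vary c x' y')))"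
      unfolding t3_def by (simp only: avg_sum)
    also have "\<dots> = (\<Sum>x\<in>V. avg c x (\<lambda>x'. \<Sum>y\<in>V. vary c x' y))"
      by (simp only: sum_avg)
    also have "\<dots> = ?T" by (rule sum_avg)
    finally show ?thesis .
  qed
  finally show ?thesis by simp
qed

text \<open>Members of \<open>\<S>\<close> are unions of cells. For a pair whose neighbourhood is
  within \<open>r\<close> of some \<open>S\<close>, adjacency can therefore change only if the old
  or the new \<open>y\<close> lies in the symmetric difference, and each of these two events
  contributes at most \<open>r\<close>. An uncovered pair contributes at most
  \<open>n\<close>.\<close>

lemma sum_vary_le:
  assumes S: "\<S> \<subseteq> Pow V" "rcard (uncovered r \<S>) \<le> \<eta> * n ^ 2" and r: "r \<ge> 0"
    and c: "\<And>S v w. S \<in> \<S> \<Longrightarrow> v \<in> V \<Longrightarrow> w \<in> V \<Longrightarrow> c v = c w \<Longrightarrow> v \<in> S \<longleftrightarrow> w \<in> S"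
  shows "(\<Sum>x\<in>V. \<Sum>z\<in>V. vary c x z) \<le> 2 * r * n ^ 2 + \<eta> * n ^ 3"
proof -
  have v: "vary c x z \<le> 2 * r + n * of_bool ((x, z) \<in> uncovered r \<S>)" if xz: "x \<in> V" "z \<in> V" for x z
  proof (cases "(x, z) \<in> uncovered r \<S>")
    case True
    have "vary c x z \<le> (\<Sum>y\<in>V. avg c y (\<lambda>_. 1))"
      unfolding vary_def by (intro sum_mono avg_mono) auto
    also have "\<dots> = n" by (simp add: avg_const)
    finally show ?thesis using True r by simp
  next
    case False
    then obtain S where SS: "S \<in> \<S>" "sdist (nb x z) S \<le> r" using xz by (auto simp: uncovered_def)
    define D where "D = (nb x z - S) \<union> (S - nb x z)"
    have "S \<subseteq> V" using SS(1) S(1) by blast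
    then have DV: "D \<subseteq> V" unfolding D_def nb_def by blast
    have "vary c x z \<le> (\<Sum>y\<in>V. avg c y (\<lambda>y'. of_bool (y \<in> D) + of_bool (y' \<in> D)))"
      unfolding vary_def
    proof (intro sum_mono avg_mono)
      fix y y' assume "y \<in> V" "y' \<in> V" "c y' = c y"
      then have "y \<in> S \<longleftrightarrow> y' \<in> S" "f x y z \<longleftrightarrow> y \<in> nb x z" "f x y' z \<longleftrightarrow> y' \<in> nb x z"
        using c[of S y y'] SS(1) by (simp_all add: nb_def)
      then show "of_bool (f x y z \<noteq> f x y' z) \<le> (of_bool (y \<in> D) + of_bool (y' \<in> D) :: real)"
        by (auto simp: D_def)
    qed
    also have "\<dots> = 2 * (\<Sum>y\<in>V. of_bool (y \<in> D))"
      by (simp add: avg_add avg_const sum.distrib sum_avg)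
    also have "(\<Sum>y\<in>V. of_bool (y \<in> D)) = rcard D"
      using finV DV by (simp add: Int_absorb1 Int_absorb2)
    also have "rcard D \<le> r" using SS by (simp add: sdist_def D_def)
    finally show ?thesis using False by simp
  qed
  have unc: "uncovered r \<S> \<subseteq> V \<times> V" by (auto simp: uncovered_def)
  have "(\<Sum>x\<in>V. \<Sum>z\<in>V. vary c x z) \<le> (\<Sum>x\<in>V. \<Sum>z\<in>V. 2 * r + n * of_bool ((x, z) \<in> uncovered r \<S>))"
    using v by (intro sum_mono) auto
  also have "\<dots> = (\<Sum>p\<in>V \<times> V. 2 * r + n * of_bool (p \<in> uncovered r \<S>))"
    by (simp add: sum.cartesian_product split_def)
  also have "\<dots> = 2 * r * n ^ 2 + n * (\<Sum>p\<in>V \<times> V. of_bool (p \<in> uncovered r \<S>))"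
    by (simp add: sum.distrib card_cartesian_product power2_eq_square sum_distrib_left)
  also have "(\<Sum>p\<in>V \<times> V. of_bool (p \<in> uncovered r \<S>)) = rcard (uncovered r \<S>)"
    using finV unc by (simp add: Int_absorb1 Int_absorb2)
  also have "n * rcard (uncovered r \<S>) \<le> n * (\<eta> * n ^ 2)"
    using S by (intro mult_left_mono) auto
  finally show ?thesis by (simp add: power3_eq_cube power2_eq_square algebra_simps)
qed

text \<open>21 = 3 * 7: three resampled coordinates, each contributing \<open>2 * 3 * \<eta>\<close>
  from covered and \<open>\<eta>\<close> from uncovered pairs.\<close>

lemma sum_flip_net:
  assumes "\<S> \<subseteq> Pow V" "rcard (uncovered (3 * \<eta> * n) \<S>) \<le> \<eta> * n ^ 2" and "\<eta> \<ge> 0"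
    and "\<And>S v w. S \<in> \<S> \<Longrightarrow> v \<in> V \<Longrightarrow> w \<in> V \<Longrightarrow> c v = c w \<Longrightarrow> v \<in> S \<longleftrightarrow> w \<in> S"
  shows "flips c \<le> 21 * \<eta> * n ^ 3"
proof -
  have "(\<Sum>x\<in>V. \<Sum>z\<in>V. vary c x z) \<le> 2 * (3 * \<eta> * n) * n ^ 2 + \<eta> * n ^ 3"
    using assms(3) by (intro sum_vary_le[OF assms(1,2) _ assms(4)]) simp_all
  also have "\<dots> = 7 * \<eta> * n ^ 3" by (simp add: power3_eq_cube power2_eq_square)
  finally show ?thesis using sum_flip_le[of c] by simp
qed

lemma avg_eq_card:
  "avg c x (\<lambda>x'. avg c y (\<lambda>y'. avg c z (\<lambda>z'. of_bool (R x' y' z')))) =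
     rcard {(x', y', z') \<in> cell c x \<times> cell c y \<times> cell c z. R x' y' z'} /
     (rcard (cell c x) * rcard (cell c y) * rcard (cell c z))"
  by (subst card_triples_eq_sum) (simp_all add: avg_def sum_divide_distrib mult_ac)

text \<open>\<open>flip\<close> equals the density of the cells or its complement to 1, depending on
  the adjacency of \<open>x\<close>, \<open>y\<close>, \<open>z\<close>; if the cells are not
  homogeneous, both are at least \<open>\<delta>\<close>.\<close>

lemma flip_ge:
  assumes xyz: "x \<in> V" "y \<in> V" "z \<in> V" and f: "f = (adj H)"
    and "\<not> hom_triple \<delta> H (cell c x) (cell c y) (cell c z)"
  shows "\<delta> \<le> flip c x y z"
proof -
  let ?d = "dens H (cell c x) (cell c y) (cell c z)"
  have d: "?d = avg c x (\<lambda>x'. avg c y (\<lambda>y'. avg c z (\<lambda>z'. of_bool (f x' y' z'))))"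
    unfolding dens_def f by (subst avg_eq_card) simp
  have "flip c x y z = (if f x y z then 1 - ?d else ?d)"
  proof (cases "f x y z")
    case True
    then have "flip c x y z = avg c x (\<lambda>x'. avg c y (\<lambda>y'. avg c z (\<lambda>z'. 1 - of_bool (f x' y' z'))))"
      unfolding flip_def by (intro avg_cong) auto
    also have "\<dots> = 1 - ?d" unfolding d using xyz by (simp add: avg_diff avg_const)
    finally show ?thesis using True by simp
  qed (simp add: flip_def d)
  then show ?thesis using assms(5) by (auto simp: hom_triple_def split: if_splits)
qed

text \<open>Markov's inequality: each triple in an inhomogeneous product of cells costs at least
  \<open>\<delta>\<close>, so a total cost of \<open>\<delta> ^ 2 * n ^ 3\<close> leaves at most
  \<open>\<delta> * n ^ 3\<close> such triples.\<close>

lemma hom_partition_cells: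
  assumes f: "f = (adj H)" and V: "V = fst H" and \<delta>: "\<delta> > 0"
    and tot: "flips c \<le> \<delta> ^ 2 * n ^ 3"
  shows "hom_partition \<delta> H (cell c ` V)"
proof -
  let ?P = "cell c ` V"
  let ?bad = "\<lambda>x y z. \<not> hom_triple \<delta> H (cell c x) (cell c y) (cell c z)"
  let ?B = "{(x, y, z) \<in> V \<times> V \<times> V. ?bad x y z}"
  let ?G = "\<Union>{X \<times> Y \<times> Z | X Y Z. X \<in> ?P \<and> Y \<in> ?P \<and> Z \<in> ?P \<and> hom_triple \<delta> H X Y Z}"
  have part: "partition_on V ?P"
    by (rule partition_onI) (auto simp: cell_def disjnt_def)
  have flip0: "flip c x y z \<ge> 0" for x y z
    unfolding flip_def avg_def by (intro divide_nonneg_nonneg sum_nonneg) auto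
  have "\<delta> * rcard ?B = (\<Sum>x\<in>V. \<Sum>y\<in>V. \<Sum>z\<in>V. \<delta> * of_bool (?bad x y z))"
    using card_triples_eq_sum[OF finV finV finV, of ?bad] by (simp only: sum_distrib_left)
  also have "\<dots> \<le> flips c"
    using flip_ge[OF _ _ _ f, of _ _ _ \<delta> c] flip0 by (intro sum_mono) (auto simp: of_bool_def)
  also have "\<dots> \<le> \<delta> * (\<delta> * n ^ 3)" using tot by (simp add: power2_eq_square mult.assoc)
  finally have B: "rcard ?B \<le> \<delta> * n ^ 3" using \<delta> by simp
  have cm: "v \<in> cell c v" if "v \<in> V" for v using that by (simp add: cell_def)
  have sub: "V \<times> V \<times> V \<subseteq> ?G \<union> ?B"
  proof
    fix p assume p: "p \<in> V \<times> V \<times> V"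
    obtain x y z where pe: "p = (x, y, z)" by (metis prod_cases3)
    show "p \<in> ?G \<union> ?B"
    proof (cases "?bad x y z")
      case False
      then have "cell c x \<times> cell c y \<times> cell c z \<in>
         {X \<times> Y \<times> Z | X Y Z. X \<in> ?P \<and> Y \<in> ?P \<and> Z \<in> ?P \<and> hom_triple \<delta> H X Y Z}" using p pe by blast
      moreover have "p \<in> cell c x \<times> cell c y \<times> cell c z" using cm p pe by auto
      ultimately show ?thesis by blast
    qed (use p pe in auto)
  qed
  have GV: "?G \<subseteq> V \<times> V \<times> V" using cell_subset by fastforce
  have fin3: "finite (V \<times> V \<times> V)" using finV by simp
  have "finite (?G \<union> ?B)" using GV by (intro finite_subset[OF _ fin3]) auto
  then have "card (V \<times> V \<times> V) \<le> card (?G \<union> ?B)" using sub by (intro card_mono)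
  also have "\<dots> \<le> card ?G + card ?B" by (rule card_Un_le)
  finally have "n ^ 3 \<le> rcard ?G + rcard ?B"
    by (simp add: card_cartesian_product power3_eq_cube flip: of_nat_mult of_nat_add)
  then have "(1 - \<delta>) * n ^ 3 \<le> rcard ?G" using B by (simp add: algebra_simps)
  then show ?thesis using part V unfolding hom_partition_def good_partition_def by simp
qed

end

section \<open>Nets and homogeneous partitions for all large members of a property\<close>

lemma slicewise_if_kU_notin:
  assumes "k \<ge> 1" "hereditary3 \<H>" "kU k \<notin> TripClass \<H>" "H \<in> \<H>"
  shows "slicewise (fst H) (adj H) k"
proof
  show "finite (fst H)" using assms by (auto simp: hereditary3_def is_3graph_def)
  show "({x, y, z} \<in> snd H) = ({y, x, z} \<in> snd H)" "({x, y, z} \<in> snd H) = ({x, z, y} \<in> snd H)" for x y z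
    by (simp_all add: insert_commute)
  fix a b c
  assume *: "a ` {1..k} \<subseteq> fst H" "b ` Pow {1..k} \<subseteq> fst H" "c ` {1..k} \<subseteq> fst H" "inj_on c {1..k}"
    "\<And>i j S. i \<in> {1..k} \<Longrightarrow> j \<in> {1..k} \<Longrightarrow> S \<subseteq> {1..k} \<Longrightarrow> ({a i, b S, c j} \<in> snd H) = (i \<in> S)"
  have "kU k \<in> TripClass \<H>"
  proof (rule kU_in_TripClass[OF assms(1,4)])
    show "\<And>i. i \<in> {1..k} \<Longrightarrow> a i \<in> fst H" "\<And>i. i \<in> {1..k} \<Longrightarrow> c i \<in> fst H"
      "\<And>S. S \<subseteq> {1..k} \<Longrightarrow> b S \<in> fst H" using * by blast+
  qed (use * in blast)+
  then show False using assms by simp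
qed (use assms in simp)

abbreviation has_net :: "real \<Rightarrow> nat \<Rightarrow> graph3 \<Rightarrow> bool" where
  "has_net \<eta> r G \<equiv> \<exists>\<S>. finite \<S> \<and> \<S> \<subseteq> Pow (fst G) \<and> card \<S> \<le> r \<and>
    rcard (slicewise.uncovered (fst G) (adj G) (3 * \<eta> * rcard (fst G)) \<S>) \<le> \<eta> * rcard (fst G) ^ 2"

text \<open>The bound on the number of bad slices, and with it \<open>N\<close>, depends on
  \<open>\<eta>\<close>, \<open>s\<close>, \<open>d\<close> and \<open>k\<close> only. Both
  accuracies in \<open>exists_net\<close> are set to \<open>\<eta>\<close>.\<close>

lemma eventually_net:
  assumes k: "k \<ge> 1" and H: "hereditary3 \<H>" "kU k \<notin> TripClass \<H>"
    and eta: "0 < \<eta>" "\<eta> < 1" and s: "s \<ge> 1" and d: "d = (s + 1) ^ k"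
    and small: "real d ^ 2 * (1 - \<eta>) ^ s \<le> 1 / 2"
  shows "\<exists>N. \<forall>H\<in>\<H>. card (fst H) \<ge> N \<longrightarrow>
    has_net \<eta> (nat \<lceil>256 * real d ^ 3 / \<eta> ^ 3\<rceil>) H"
proof -
  define \<theta> where "\<theta> = \<eta> ^ 2 / (64 * real d)"
  have d1: "d \<ge> 1" by (simp add: d)
  then have th: "\<theta> > 0" using eta by (simp add: \<theta>_def)
  \<comment> \<open>\<open>I\<close> restates \<open>idx s d\<close> outside the locale, so that
    \<open>K\<close> and \<open>N\<close> are fixed before any graph is.\<close>
  define I where "I = ({1..k} \<rightarrow>\<^sub>E {..<s}) \<times> (Pow {1..k} \<rightarrow>\<^sub>E {..<d})"
  define K where "K = 2 * real (k * card I) / \<theta> ^ d"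
  define N where "N = nat \<lceil>8 * real d * K / \<eta>\<rceil> + 1"
  show ?thesis
  proof (intro exI[of _ N] ballI impI)
    fix G assume G: "G \<in> \<H>" "N \<le> card (fst G)"
    interpret slicewise "fst G" "adj G" k
      using slicewise_if_kU_notin[OF k H G(1)] .
    have "I = idx s d" by (simp add: I_def idx_def)
    then have bad: "rcard {z \<in> fst G. \<not> good \<eta> \<theta> d z} \<le> K"
      using few_bad_slices[OF _ s eta small th] d unfolding K_def by simp
    have "8 * real d * K / \<eta> \<le> real N" unfolding N_def by linarith
    then have "8 * real d * K / \<eta> \<le> rcard (fst G)" using G(2) by linarith
    moreover have "rcard (fst G) > 0" using G(2) by (simp add: N_def)
    ultimately show "\<exists>\<S>. finite \<S> \<and> \<S> \<subseteq> Pow (fst G) \<and> card \<S> \<le> nat \<lceil>256 * real d ^ 3 / \<eta> ^ 3\<rceil> \<and>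
      rcard (uncovered (3 * \<eta> * rcard (fst G)) \<S>) \<le> \<eta> * rcard (fst G) ^ 2"
      using exists_net[OF eta(1) eta(1) _ d1 th _ bad] eta(2) by (simp add: \<theta>_def)
  qed
qed

abbreviation ample :: "nat \<Rightarrow> real \<Rightarrow> nat \<Rightarrow> bool" where
  "ample k \<eta> s \<equiv> \<eta> < 1 \<and> s \<ge> 1 \<and> real ((s + 1) ^ k) ^ 2 * (1 - \<eta>) ^ s \<le> 1 / 2"

text \<open>With \<open>s\<close> about \<open>1 / \<eta> ^ 2\<close>, the factor
  \<open>(1 - \<eta>) ^ s\<close> is at most \<open>exp (- (1 / \<eta>))\<close>, which beats
  \<open>(s + 1) ^ (2 * k)\<close>, a polynomial in \<open>1 / \<eta>\<close>.\<close>

lemma eventually_small_sample: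
  "\<exists>\<eta>0>0. \<forall>\<eta>::real. 0 < \<eta> \<and> \<eta> < \<eta>0 \<longrightarrow>
     ample k \<eta> (nat \<lceil>1 / \<eta> ^ 2\<rceil>)"
proof -
  have "((\<lambda>x::real. x ^ (6 * k) / exp x) \<longlongrightarrow> 0) at_top" by (rule tendsto_power_div_exp_0)
  then have "\<forall>\<^sub>F x in at_top. x ^ (6 * k) / exp x < (1/2::real)" by (rule order_tendstoD) simp
  then obtain X where X: "\<And>x. x \<ge> X \<Longrightarrow> x ^ (6 * k) / exp x < (1/2::real)"
    by (auto simp: eventually_at_top_linorder)
  \<comment> \<open>Beyond 3, \<open>x ^ 3\<close> absorbs \<open>s + 1 \<le> x ^ 2 + 2\<close>;
    this is the origin of the exponent \<open>6 * k\<close>.\<close>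
  define \<eta>0 where "\<eta>0 = 1 / max 3 X"
  show ?thesis
  proof (intro exI[of _ \<eta>0] conjI allI impI)
    show "\<eta>0 > 0" by (simp add: \<eta>0_def)
    fix \<eta> :: real assume eta: "0 < \<eta> \<and> \<eta> < \<eta>0"
    define x where "x = 1 / \<eta>"
    have x: "x > 3" "x > X"
    proof -
      have "\<eta> < 1 / max 3 X" using eta by (simp add: \<eta>0_def)
      then have "max 3 X < 1 / \<eta>" using eta less_divide_eq[of "max 3 X" 1 \<eta>] less_divide_eq[of \<eta> 1 "max 3 X"]
        by (simp add: mult.commute less_max_iff_disj)
      then have "max 3 X < x" by (simp add: x_def)
      then show "x > 3" "x > X" by auto
    qed
    have \<eta>x: "\<eta> = 1 / x" by (simp add: x_def)
    show lt1: "\<eta> < 1" using x by (simp add: \<eta>x)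
    define s where "s = nat \<lceil>1 / \<eta> ^ 2\<rceil>"
    have sx: "x ^ 2 \<le> real s" "real s \<le> x ^ 2 + 1"
      unfolding s_def \<eta>x by (simp_all add: power_divide)
    have x2: "x ^ 2 \<ge> 9" using power_mono[of 3 x 2] x by simp
    show "nat \<lceil>1 / \<eta> ^ 2\<rceil> \<ge> 1" using sx x2 unfolding s_def[symmetric] by linarith
    have "real s + 1 \<le> x ^ 3"
    proof -
      have "x ^ 2 + 2 \<le> x ^ 2 * 3" using x2 by simp
      also have "\<dots> \<le> x ^ 2 * x" using x by (intro mult_left_mono) auto
      finally show ?thesis using sx by (simp add: power3_eq_cube power2_eq_square)
    qed
    then have "(real s + 1) ^ (2 * k) \<le> (x ^ 3) ^ (2 * k)" by (intro power_mono) auto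
    then have 1: "real ((s + 1) ^ k) ^ 2 \<le> x ^ (6 * k)"
      by (simp add: power_mult[symmetric] mult.commute add.commute)
    have "(1 - \<eta>) ^ s \<le> exp (- \<eta>) ^ s"
      using exp_ge_add_one_self[of "- \<eta>"] lt1 by (intro power_mono) auto
    also have "\<dots> = exp (- (\<eta> * real s))" by (simp add: exp_of_nat_mult[symmetric] mult.commute)
    also have "\<dots> \<le> exp (- x)"
    proof -
      have "\<eta> * x ^ 2 \<le> \<eta> * real s" using sx eta by (intro mult_left_mono) auto
      then show ?thesis using x by (simp add: \<eta>x power2_eq_square)
    qed
    finally have 2: "(1 - \<eta>) ^ s \<le> exp (- x)" .
    have "real ((s + 1) ^ k) ^ 2 * (1 - \<eta>) ^ s \<le> x ^ (6 * k) * exp (- x)"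
      using 1 2 lt1 x by (intro mult_mono) auto
    also have "\<dots> \<le> 1 / 2" using X[of x] x by (simp add: exp_minus field_simps)
    finally show "real ((nat \<lceil>1 / \<eta> ^ 2\<rceil> + 1) ^ k) ^ 2 * (1 - \<eta>) ^ nat \<lceil>1 / \<eta> ^ 2\<rceil> \<le> 1 / 2"
      unfolding s_def .
  qed
qed

text \<open>The colour of a vertex is the set of net members containing it. This makes every net
  member a union of cells, and the number of cells is at most 2 to the size of the net.\<close>

lemma M_hom_le:
  assumes k: "k \<ge> 1" and H: "hereditary3 \<H>" "kU k \<notin> TripClass \<H>"
    and eta: "0 < \<eta>" "\<eta> < 1" and s: "s \<ge> 1" and d: "d = (s + 1) ^ k"
    and small: "real d ^ 2 * (1 - \<eta>) ^ s \<le> 1 / 2" and \<delta>: "\<delta> > 0" "21 * \<eta> \<le> \<delta> ^ 2"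
  shows "M_hom \<H> \<delta> \<le> ereal (2 ^ nat \<lceil>256 * real d ^ 3 / \<eta> ^ 3\<rceil>)"
proof -
  let ?r = "nat \<lceil>256 * real d ^ 3 / \<eta> ^ 3\<rceil>"
  obtain N where N: "\<And>G. G \<in> \<H> \<Longrightarrow> card (fst G) \<ge> N \<Longrightarrow>
    has_net \<eta> ?r G"
    using eventually_net[OF k H eta s d small] by blast
  have "\<exists>P. hom_partition \<delta> G P \<and> card P \<le> 2 ^ ?r" if G: "G \<in> \<H>" "N \<le> card (fst G)" for G
  proof -
    interpret slicewise "fst G" "adj G" k
      using slicewise_if_kU_notin[OF k H G(1)] .
    obtain \<S> where S: "finite \<S>" "\<S> \<subseteq> Pow (fst G)" "card \<S> \<le> ?r"
      "rcard (uncovered (3 * \<eta> * rcard (fst G)) \<S>) \<le> \<eta> * rcard (fst G) ^ 2"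
      using N[OF G] by blast
    define c where "c v = {S \<in> \<S>. v \<in> S}" for v
    have "flips c \<le> 21 * \<eta> * n ^ 3"
      using eta by (intro sum_flip_net[OF S(2,4)]) (auto simp: c_def)
    also have "\<dots> \<le> \<delta> ^ 2 * n ^ 3" using \<delta> by (intro mult_right_mono) auto
    finally have "hom_partition \<delta> G (cell c ` fst G)"
      using \<delta> by (intro hom_partition_cells) auto
    moreover have "card (cell c ` fst G) \<le> 2 ^ ?r"
    proof -
      have "cell c ` fst G = (\<lambda>T. {v \<in> fst G. c v = T}) ` c ` fst G" by (auto simp: cell_def)
      also have "card \<dots> \<le> card (c ` fst G)" using finV by (intro card_image_le) auto
      also have "\<dots> \<le> card (Pow \<S>)" using S by (intro card_mono) (auto simp: c_def)
      also have "\<dots> = 2 ^ card \<S>" by (simp add: card_Pow S)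
      also have "\<dots> \<le> 2 ^ ?r" using S by (intro power_increasing) auto
      finally show ?thesis .
    qed
    ultimately show ?thesis by blast
  qed
  then have "\<exists>N. \<forall>G\<in>\<H>. card (fst G) \<ge> N \<longrightarrow> (\<exists>P. hom_partition \<delta> G P \<and> card P \<le> 2 ^ ?r)"
    by blast
  then have "ereal (real (2 ^ ?r)) \<in> {ereal (real M) | M. \<exists>N. \<forall>G\<in>\<H>. card (fst G) \<ge> N \<longrightarrow>
      (\<exists>P. hom_partition \<delta> G P \<and> card P \<le> M)}"
    by blast
  then have "M_hom \<H> \<delta> \<le> ereal (real (2 ^ ?r))" unfolding M_hom_def by (rule Inf_lower)
  then show ?thesis by simp
qed

subsection \<open>Blow-ups in properties far from finite VC-dimension\<close>

abbreviation edge_dist :: "nat set set \<Rightarrow> nat set set \<Rightarrow> real" where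
  "edge_dist E E' \<equiv> rcard ((ord_edges E - ord_edges E') \<union> (ord_edges E' - ord_edges E))"

text \<open>The largest hereditary class of VC-dimension less than \<open>j\<close>; a property far
  from finite VC-dimension is close to none of these classes.\<close>

definition VC_below :: "nat \<Rightarrow> graph3 set" where
  "VC_below j = {H. is_3graph H \<and> \<not> VC_shatters j H}"

lemma VC_shatters_mono:
  assumes "VC_shatters i H" "j \<le> i"
  shows "VC_shatters j H"
proof -
  obtain a b c where *: "\<forall>m\<in>{1..i}. a m \<in> fst H \<and> b m \<in> fst H" "\<forall>S. S \<subseteq> {1..i} \<longrightarrow> c S \<in> fst H"
     "\<forall>m\<in>{1..i}. \<forall>S. S \<subseteq> {1..i} \<longrightarrow> ({a m, b m, c S} \<in> snd H \<longleftrightarrow> m \<in> S)"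
    using assms(1) unfolding VC_shatters_def by blast
  have s: "{1..j} \<subseteq> {1..i}" using assms(2) by auto
  show ?thesis unfolding VC_shatters_def
  proof (rule exI[of _ a], rule exI[of _ b], rule exI[of _ c], intro conjI)
    show "\<forall>m\<in>{1..j}. a m \<in> fst H \<and> b m \<in> fst H" using *(1) s by blast
    show "\<forall>S. S \<subseteq> {1..j} \<longrightarrow> c S \<in> fst H" using *(2) s by (meson subset_trans)
    show "\<forall>m\<in>{1..j}. \<forall>S. S \<subseteq> {1..j} \<longrightarrow> ({a m, b m, c S} \<in> snd H \<longleftrightarrow> m \<in> S)"
      using *(3) s by (meson subset_trans subsetD)
  qed
qed

lemma VC_shatters_iso:
  assumes "VC_shatters j H" "iso3 H G" "is_3graph H"
  shows "VC_shatters j G"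
proof -
  obtain f where f: "bij_betw f (fst H) (fst G)" "snd G = (\<lambda>e. f ` e) ` snd H"
    using assms(2) by (auto simp: iso3_def)
  obtain a b c where *: "\<forall>m\<in>{1..j}. a m \<in> fst H \<and> b m \<in> fst H" "\<forall>S. S \<subseteq> {1..j} \<longrightarrow> c S \<in> fst H"
     "\<forall>m\<in>{1..j}. \<forall>S. S \<subseteq> {1..j} \<longrightarrow> ({a m, b m, c S} \<in> snd H \<longleftrightarrow> m \<in> S)"
    using assms(1) unfolding VC_shatters_def by blast
  have e: "{f x, f y, f z} \<in> snd G \<longleftrightarrow> {x, y, z} \<in> snd H" if "x \<in> fst H" "y \<in> fst H" "z \<in> fst H" for x y z
  proof -
    have "{f x, f y, f z} = f ` {x, y, z}" by simp
    moreover have "f ` {x, y, z} \<in> (\<lambda>e. f ` e) ` snd H \<longleftrightarrow> {x, y, z} \<in> snd H"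
    proof
      assume "f ` {x, y, z} \<in> (\<lambda>e. f ` e) ` snd H"
      then obtain e' where e': "e' \<in> snd H" "f ` {x, y, z} = f ` e'" by blast
      then have "e' \<subseteq> fst H" using assms(3) by (auto simp: is_3graph_def)
      then have "{x, y, z} = e'"
        using e' that f(1) inj_on_image_eq_iff[of f "fst H" "{x, y, z}" e'] by (simp add: bij_betw_def)
      then show "{x, y, z} \<in> snd H" using e' by simp
    qed blast
    ultimately show ?thesis using f(2) by simp
  qed
  have fV: "f x \<in> fst G" if "x \<in> fst H" for x using that f(1) by (auto simp: bij_betw_def)
  show ?thesis unfolding VC_shatters_def
  proof (rule exI[of _ "f \<circ> a"], rule exI[of _ "f \<circ> b"], rule exI[of _ "f \<circ> c"], intro conjI ballI allI impI)
    fix m S assume m: "m \<in> {1..j}" "S \<subseteq> {1..j}"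
    then have "{(f \<circ> a) m, (f \<circ> b) m, (f \<circ> c) S} \<in> snd G \<longleftrightarrow> {a m, b m, c S} \<in> snd H"
      unfolding o_apply using * by (intro e) blast+
    then show "{(f \<circ> a) m, (f \<circ> b) m, (f \<circ> c) S} \<in> snd G \<longleftrightarrow> m \<in> S" using * m by blast
  qed (use * fV in auto)
qed

lemma VC_shatters_induced:
  assumes "VC_shatters j (induced3 H W)" "W \<subseteq> fst H"
  shows "VC_shatters j H"
proof -
  obtain a b c where *: "\<forall>m\<in>{1..j}. a m \<in> W \<and> b m \<in> W" "\<forall>S. S \<subseteq> {1..j} \<longrightarrow> c S \<in> W"
     "\<forall>m\<in>{1..j}. \<forall>S. S \<subseteq> {1..j} \<longrightarrow> ({a m, b m, c S} \<in> {e \<in> snd H. e \<subseteq> W} \<longleftrightarrow> m \<in> S)"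
    using assms(1) unfolding VC_shatters_def induced3_def fst_conv snd_conv
    by (elim exE conjE) (rule that)
  have "{a m, b m, c S} \<in> snd H \<longleftrightarrow> m \<in> S" if "m \<in> {1..j}" "S \<subseteq> {1..j}" for m S
  proof -
    have "{a m, b m, c S} \<subseteq> W" using *(1,2) that by simp
    then show ?thesis using *(3)[rule_format, OF that] by blast
  qed
  then have "\<forall>m\<in>{1..j}. \<forall>S. S \<subseteq> {1..j} \<longrightarrow> ({a m, b m, c S} \<in> snd H \<longleftrightarrow> m \<in> S)" by blast
  moreover have "\<forall>m\<in>{1..j}. a m \<in> fst H \<and> b m \<in> fst H" "\<forall>S. S \<subseteq> {1..j} \<longrightarrow> c S \<in> fst H"
    using *(1,2) assms(2) by blast+
  ultimately show ?thesis unfolding VC_shatters_def by (intro exI conjI)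
qed

lemma hereditary_VC_below: "hereditary3 (VC_below j)"
  unfolding hereditary3_def
proof (intro conjI ballI allI impI)
  show "is_3graph H" if "H \<in> VC_below j" for H using that by (simp add: VC_below_def)
  show "G \<in> VC_below j" if "H \<in> VC_below j" "is_3graph G \<and> iso3 H G" for H G
    using that VC_shatters_iso[of j G H] iso3_sym[of H G] by (auto simp: VC_below_def)
  show "induced3 H W \<in> VC_below j" if "H \<in> VC_below j" "W \<subseteq> fst H" for H W
  proof -
    have "is_3graph (induced3 H W)"
      using that by (auto simp: VC_below_def is_3graph_def induced3_def intro: finite_subset)
    then show ?thesis using that VC_shatters_induced[of j H W] by (auto simp: VC_below_def)
  qed
qed

lemma VC_class_VC_below: "VC_class (VC_below j) < \<infinity>"
proof -
  have "VC_class (VC_below j) \<le> enat j"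
    unfolding VC_class_def
  proof (rule Sup_least)
    fix x assume "x \<in> {enat i | i. \<exists>H\<in>VC_below j. VC_shatters i H}"
    then obtain i H where "x = enat i" "H \<in> VC_below j" "VC_shatters i H" by blast
    then show "x \<le> enat j" using VC_shatters_mono[of i H j] by (cases "j \<le> i") (auto simp: VC_below_def)
  qed
  then show ?thesis by (meson enat_ord_code(4) le_less_trans)
qed

text \<open>Greedy choice: every \<open>U i\<close> has room for all the sets together, so it keeps
  \<open>s i\<close> elements outside those chosen before. The \<open>U i\<close> may overlap or
  coincide, as happens when several roles share a colour.\<close>

lemma disjoint_subsets:
  assumes "finite I" "\<And>i. i \<in> I \<Longrightarrow> finite (U i) \<and> (\<Sum>j\<in>I. s j) \<le> card (U i)"
  shows "\<exists>D. (\<forall>i\<in>I. D i \<subseteq> U i \<and> card (D i) = s i) \<and> disjoint_family_on D I"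
  using assms
proof (induction I rule: finite_induct)
  case (insert i I)
  then have "\<And>j. j \<in> I \<Longrightarrow> finite (U j) \<and> (\<Sum>j\<in>I. s j) \<le> card (U j)" by force
  with insert.IH obtain D where D: "\<forall>j\<in>I. D j \<subseteq> U j \<and> card (D j) = s j" "disjoint_family_on D I" by blast
  have fin: "finite (\<Union>j\<in>I. D j)" using D(1) insert.hyps(1) insert.prems by (meson finite_UN finite_subset insertCI)
  have "card (\<Union>j\<in>I. D j) \<le> (\<Sum>j\<in>I. s j)"
    using card_UN_le[of I D] insert.hyps D by simp
  then have "s i \<le> card (U i) - card (\<Union>j\<in>I. D j)" using insert.prems[of i] insert.hyps
    by (auto simp del: UN_simps)
  also have "\<dots> \<le> card (U i - (\<Union>j\<in>I. D j))" using fin by (rule diff_card_le_card_Diff)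
  finally have "s i \<le> card (U i - (\<Union>j\<in>I. D j))" .
  then obtain Y where Y: "Y \<subseteq> U i - (\<Union>j\<in>I. D j)" "card Y = s i"
    by (rule obtain_subset_with_card_n)
  show ?case
  proof (intro exI[of _ "D(i := Y)"] conjI)
    show "\<forall>j\<in>insert i I. (D(i := Y)) j \<subseteq> U j \<and> card ((D(i := Y)) j) = s j"
      using D Y by auto
    show "disjoint_family_on (D(i := Y)) (insert i I)"
      unfolding disjoint_family_on_def
    proof (intro ballI impI)
      fix j l assume jl: "j \<in> insert i I" "l \<in> insert i I" "j \<noteq> l"
      consider "j = i" "l \<in> I" "l \<noteq> i" | "l = i" "j \<in> I" "j \<noteq> i" | "j \<in> I" "l \<in> I" "j \<noteq> i" "l \<noteq> i"
        using jl by blast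
      then show "(D(i := Y)) j \<inter> (D(i := Y)) l = {}"
      proof cases
        case 3 then show ?thesis using D(2) jl(3) by (simp add: disjoint_family_on_def)
      qed (use Y(1) in auto)
    qed
  qed
qed (simp add: disjoint_family_on_def)

definition roles :: "nat \<Rightarrow> ((nat + nat) + nat set) set" where
  "roles l = ({1..l} <+> {1..l}) <+> Pow {1..l}"

text \<open>\<open>D (Inl (Inl i))\<close>, \<open>D (Inl (Inr i))\<close>, \<open>D (Inr S)\<close> replace the vertices \<open>a_i\<close>, \<open>b_i\<close>, \<open>c_S\<close>
  of a shattered configuration; the sizes make the three unions equally large.\<close>
definition blowup :: "graph3 \<Rightarrow> nat \<Rightarrow> nat \<Rightarrow> ((nat + nat) + nat set \<Rightarrow> nat set) \<Rightarrow> bool" where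
  "blowup H l u D \<longleftrightarrow> disjoint_family_on D (roles l) \<and> (\<forall>r\<in>roles l. D r \<subseteq> fst H) \<and>
     (\<forall>i\<in>{1..l}. card (D (Inl (Inl i))) = 2 ^ l * u \<and> card (D (Inl (Inr i))) = 2 ^ l * u) \<and>
     (\<forall>S\<in>Pow {1..l}. card (D (Inr S)) = l * u) \<and>
     (\<forall>i\<in>{1..l}. \<forall>S\<in>Pow {1..l}. \<forall>a\<in>D (Inl (Inl i)). \<forall>b\<in>D (Inl (Inr i)). \<forall>c\<in>D (Inr S).
        {a, b, c} \<in> snd H \<longleftrightarrow> i \<in> S)"

section \<open>Counting in products; colourings with small classes and few flips\<close>

lemma card_PiE_fixed3:
  assumes J: "finite J" "p \<in> J" "q \<in> J" "r \<in> J" "p \<noteq> q" "q \<noteq> r" "p \<noteq> r"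
    and x: "x \<in> X p" "y \<in> X q" "z \<in> X r"
  shows "card {w \<in> PiE J X. w p = x \<and> w q = y \<and> w r = z} * (card (X p) * card (X q) * card (X r)) = card (PiE J X)"
proof -
  let ?Y = "X(p := {x}, q := {y}, r := {z})"
  have "{w \<in> PiE J X. w p = x \<and> w q = y \<and> w r = z} = PiE J ?Y"
  proof (intro equalityI subsetI)
    fix w assume w: "w \<in> PiE J ?Y"
    have "w p = x" "w q = y" "w r = z" using PiE_mem[OF w J(2)] PiE_mem[OF w J(3)] PiE_mem[OF w J(4)] J by auto
    moreover have "w j \<in> X j" if "j \<in> J" for j
      using PiE_mem[OF w that] x by (auto split: if_splits)
    moreover have "w \<in> extensional J" using w by (simp add: PiE_def)
    ultimately show "w \<in> {w \<in> PiE J X. w p = x \<and> w q = y \<and> w r = z}" by (simp add: PiE_def)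
  qed (auto simp: PiE_def)
  then have "card {w \<in> PiE J X. w p = x \<and> w q = y \<and> w r = z} = (\<Prod>j\<in>J. card (?Y j))"
    using J by (simp add: card_PiE)
  also have "\<dots> = (\<Prod>j\<in>J - {p, q, r}. card (?Y j)) * (\<Prod>j\<in>{p, q, r}. card (?Y j))"
    using J by (intro prod.subset_diff) auto
  also have "(\<Prod>j\<in>{p, q, r}. card (?Y j)) = 1" using J by simp
  also have "(\<Prod>j\<in>J - {p, q, r}. card (?Y j)) = (\<Prod>j\<in>J - {p, q, r}. card (X j))"
    by (intro prod.cong) auto
  finally have "card {w \<in> PiE J X. w p = x \<and> w q = y \<and> w r = z} = (\<Prod>j\<in>J - {p, q, r}. card (X j))" by simp
  moreover have "card (PiE J X) = (\<Prod>j\<in>J - {p, q, r}. card (X j)) * (\<Prod>j\<in>{p, q, r}. card (X j))"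
    unfolding card_PiE[OF J(1)] using J by (intro prod.subset_diff) auto
  moreover have "(\<Prod>j\<in>{p, q, r}. card (X j)) = card (X p) * card (X q) * card (X r)"
    using J by (simp add: mult.assoc)
  ultimately show ?thesis by simp
qed

text \<open>The entries of a uniformly random element of \<open>PiE J X\<close> at three distinct
  positions are independent and uniform; the identity is multiplied out to stay in the
  naturals.\<close>

lemma card_PiE_marginal3:
  assumes J: "finite J" "p \<in> J" "q \<in> J" "r \<in> J" "p \<noteq> q" "q \<noteq> r" "p \<noteq> r"
    and fin: "\<And>j. j \<in> J \<Longrightarrow> finite (X j)"
  shows "card {w \<in> PiE J X. R (w p) (w q) (w r)} * (card (X p) * card (X q) * card (X r)) =
     card (PiE J X) * card {(x, y, z) \<in> X p \<times> X q \<times> X r. R x y z}"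
proof -
  let ?T = "{(x, y, z) \<in> X p \<times> X q \<times> X r. R x y z}"
  let ?W = "\<lambda>t. {w \<in> PiE J X. w p = fst t \<and> w q = fst (snd t) \<and> w r = snd (snd t)}"
  have finW: "finite (PiE J X)" using J fin by (intro finite_PiE) auto
  have finT: "finite ?T"
    by (rule finite_subset[of _ "X p \<times> X q \<times> X r"]) (use fin J in auto)
  have eq: "{w \<in> PiE J X. R (w p) (w q) (w r)} = (\<Union>t\<in>?T. ?W t)"
  proof (intro equalityI subsetI)
    fix w assume w: "w \<in> {w \<in> PiE J X. R (w p) (w q) (w r)}"
    then have "(w p, w q, w r) \<in> ?T" using J by auto
    then show "w \<in> (\<Union>t\<in>?T. ?W t)" using w by (intro UN_I[of "(w p, w q, w r)"]) auto
  qed auto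
  have "card {w \<in> PiE J X. R (w p) (w q) (w r)} = (\<Sum>t\<in>?T. card (?W t))"
    unfolding eq
  proof (rule card_UN_disjoint[OF finT])
    show "\<forall>t\<in>?T. finite (?W t)" using finW by simp
    show "\<forall>t\<in>?T. \<forall>t'\<in>?T. t \<noteq> t' \<longrightarrow> ?W t \<inter> ?W t' = {}" by (auto simp: prod_eq_iff)
  qed
  then have "card {w \<in> PiE J X. R (w p) (w q) (w r)} * (card (X p) * card (X q) * card (X r)) =
    (\<Sum>t\<in>?T. card (?W t) * (card (X p) * card (X q) * card (X r)))" by (simp only: sum_distrib_right)
  also have "\<dots> = (\<Sum>t\<in>?T. card (PiE J X))"
    using card_PiE_fixed3[OF J] by (intro sum.cong refl) auto
  finally show ?thesis by (simp add: mult.commute)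
qed

text \<open>The shattered configuration can be chosen with the colours of the \<open>c_S\<close> different from those of
  the \<open>a_i\<close> and \<open>b_i\<close>: the \<open>l + 1\<close> spare elements of the shattered set provide more than \<open>2 * l\<close>
  differently coloured candidates for every \<open>c_S\<close>.\<close>
lemma clean_configuration:
  fixes R :: "'c \<Rightarrow> 'c \<Rightarrow> 'c \<Rightarrow> bool" and l :: nat
  assumes sh: "\<And>i S. i \<in> {1..2 * l + 1} \<Longrightarrow> S \<subseteq> {1..2 * l + 1} \<Longrightarrow> R (a i) (b i) (c S) \<longleftrightarrow> i \<in> S"
    and R: "\<And>x y z. R x y z \<Longrightarrow> x \<in> J \<and> y \<in> J \<and> z \<in> J \<and> x \<noteq> y"
  shows "\<exists>\<alpha>\<in>{1..l} \<rightarrow>\<^sub>E J. \<exists>\<beta>\<in>{1..l} \<rightarrow>\<^sub>E J. \<exists>\<zeta>\<in>Pow {1..l} \<rightarrow>\<^sub>E J.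
    \<forall>i\<in>{1..l}. \<forall>S\<in>Pow {1..l}. \<alpha> i \<noteq> \<beta> i \<and> \<zeta> S \<noteq> \<alpha> i \<and> \<zeta> S \<noteq> \<beta> i \<and> (R (\<alpha> i) (\<beta> i) (\<zeta> S) \<longleftrightarrow> i \<in> S)"
proof -
  let ?K = "{1..2 * l + 1}"
  let ?F = "a ` {1..l} \<union> b ` {1..l}"
  have injc: "inj_on c (Pow ?K)"
  proof (rule inj_onI)
    fix S S' assume "S \<in> Pow ?K" "S' \<in> Pow ?K" "c S = c S'"
    then have "i \<in> S \<longleftrightarrow> i \<in> S'" if "i \<in> ?K" for i using sh[OF that, of S] sh[OF that, of S'] by simp
    then show "S = S'" using \<open>S \<in> Pow ?K\<close> \<open>S' \<in> Pow ?K\<close> by blast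
  qed
  have ab: "a i \<in> J" "b i \<in> J" "a i \<noteq> b i" if "i \<in> ?K" for i
    using R[of "a i" "b i" "c {i}"] sh[OF that, of "{i}"] that by auto
  have cJ: "c S \<in> J" if S: "S \<subseteq> ?K" "S \<noteq> {}" for S
  proof -
    obtain i where "i \<in> S" using S by blast
    then show ?thesis using R[of "a i" "b i" "c S"] sh[of i S] S by auto
  qed
  have "\<exists>U. U \<subseteq> {l + 1..2 * l + 1} \<and> U \<noteq> {} \<and> c (S \<union> U) \<notin> ?F" if S: "S \<subseteq> {1..l}" for S
  proof (rule ccontr)
    assume no: "\<not> ?thesis"
    \<comment> \<open>\<open>U\<close> is taken non-empty so that \<open>S \<union> U\<close> is:
      only then is there an edge that puts \<open>c (S \<union> U)\<close> into
      \<open>J\<close>.\<close>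
    let ?P = "Pow {l + 1..2 * l + 1} - {{}}"
    have SU: "S \<union> U \<subseteq> ?K" if "U \<in> ?P" for U
    proof
      fix x assume "x \<in> S \<union> U"
      then have "x \<in> {1..l} \<or> x \<in> {l + 1..2 * l + 1}" using S that by blast
      then show "x \<in> ?K" by auto
    qed
    have dis: "S \<inter> U = {}" if "U \<in> ?P" for U
    proof -
      have "{1..l} \<inter> {l + 1..2 * l + 1} = {}" by auto
      then show ?thesis using S that by blast
    qed
    have "inj_on (\<lambda>U. c (S \<union> U)) ?P"
    proof (rule inj_onI)
      fix U U' assume U: "U \<in> ?P" "U' \<in> ?P" "c (S \<union> U) = c (S \<union> U')"
      then have "S \<union> U = S \<union> U'" using SU by (intro inj_onD[OF injc]) auto
      then show "U = U'" using dis[OF U(1)] dis[OF U(2)] by blast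
    qed
    then have "card ?P = card ((\<lambda>U. c (S \<union> U)) ` ?P)" by (simp add: card_image)
    also have "\<dots> \<le> card ?F" using no by (intro card_mono) auto
    also have "\<dots> \<le> card (a ` {1..l}) + card (b ` {1..l})" by (rule card_Un_le)
    also have "\<dots> \<le> l + l" using card_image_le[of "{1..l}" a] card_image_le[of "{1..l}" b] by simp
    finally have "card ?P \<le> 2 * l" by simp
    moreover have "card ?P = 2 ^ (l + 1) - 1" by (simp add: card_Pow card_Diff_singleton)
    moreover have "l + 1 \<le> 2 ^ l" by (induction l) auto
    then have "2 * l + 2 \<le> (2::nat) ^ (l + 1)" by simp
    ultimately show False by linarith
  qed
  then obtain U where U: "\<And>S. S \<subseteq> {1..l} \<Longrightarrow> U S \<subseteq> {l + 1..2 * l + 1} \<and> U S \<noteq> {} \<and> c (S \<union> U S) \<notin> ?F" by metis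
  have SU: "S \<union> U S \<subseteq> ?K" "S \<union> U S \<noteq> {}" "i \<in> S \<union> U S \<longleftrightarrow> i \<in> S" if "S \<subseteq> {1..l}" "i \<in> {1..l}" for i S
  proof -
    have "{l + 1..2 * l + 1} \<subseteq> ?K" "{1..l} \<subseteq> ?K" "i \<notin> {l + 1..2 * l + 1}" using that(2) by auto
    then show "S \<union> U S \<subseteq> ?K" "S \<union> U S \<noteq> {}" "i \<in> S \<union> U S \<longleftrightarrow> i \<in> S" using U[OF that(1)] that(1) by blast+
  qed
  have SU': "c (S \<union> U S) \<in> J" if "S \<subseteq> {1..l}" for S
  proof -
    have "{l + 1..2 * l + 1} \<subseteq> ?K" "{1..l} \<subseteq> ?K" by auto
    then show ?thesis using U[OF that] that by (intro cJ) blast+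
  qed
  define \<alpha> where "\<alpha> = restrict a {1..l}"
  define \<beta> where "\<beta> = restrict b {1..l}"
  define \<zeta> where "\<zeta> = restrict (\<lambda>S. c (S \<union> U S)) (Pow {1..l})"
  have "\<alpha> \<in> {1..l} \<rightarrow>\<^sub>E J" "\<beta> \<in> {1..l} \<rightarrow>\<^sub>E J" using ab by (auto simp: \<alpha>_def \<beta>_def)
  moreover have "\<zeta> \<in> Pow {1..l} \<rightarrow>\<^sub>E J" using SU' by (auto simp: \<zeta>_def)
  moreover have "\<alpha> i \<noteq> \<beta> i \<and> \<zeta> S \<noteq> \<alpha> i \<and> \<zeta> S \<noteq> \<beta> i \<and> (R (\<alpha> i) (\<beta> i) (\<zeta> S) \<longleftrightarrow> i \<in> S)"
    if i: "i \<in> {1..l}" and S: "S \<in> Pow {1..l}" for i S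
  proof -
    have "i \<in> ?K" using i by auto
    moreover have "R (a i) (b i) (c (S \<union> U S)) \<longleftrightarrow> i \<in> S"
      using sh[OF \<open>i \<in> ?K\<close> SU(1)[of S i]] SU(3)[of S i] i S by simp
    moreover have "c (S \<union> U S) \<noteq> a i" "c (S \<union> U S) \<noteq> b i" using U[of S] S i by blast+
    ultimately show ?thesis using ab i S by (simp add: \<alpha>_def \<beta>_def \<zeta>_def)
  qed
  ultimately show ?thesis by blast
qed

abbreviation nicely_coloured :: "nat \<Rightarrow> real \<Rightarrow> graph3 \<Rightarrow> bool" where
  "nicely_coloured M \<mu> G \<equiv> \<exists>c :: nat \<Rightarrow> nat. c ` fst G \<subseteq> {..<M} \<and>
    (\<forall>p. rcard {v \<in> fst G. c v = p} \<le> \<mu> * rcard (fst G)) \<and>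
    slicewise.flips (fst G) (adj G) c \<le> \<mu> * rcard (fst G) ^ 3"

text \<open>The net colouring is refined by cutting an enumeration \<open>h\<close> of the vertices
  into intervals of length \<open>t\<close>. Net members stay unions of cells, the classes become
  small, and the number of colours is still bounded independently of the graph.\<close>

lemma nice_colouring:
  assumes k: "k \<ge> 1" and H: "hereditary3 \<H>" "kU k \<notin> TripClass \<H>" and mu: "\<mu> > (0::real)"
  shows "\<exists>M N. \<forall>G\<in>\<H>. card (fst G) \<ge> N \<longrightarrow> nicely_coloured M \<mu> G"
proof -
  obtain \<eta>0 where \<eta>0: "\<eta>0 > 0" "\<And>\<eta>::real. 0 < \<eta> \<and> \<eta> < \<eta>0 \<Longrightarrow>
     ample k \<eta> (nat \<lceil>1 / \<eta> ^ 2\<rceil>)"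
    using eventually_small_sample[of k] by blast
  define \<eta> where "\<eta> = min (\<eta>0 / 2) (\<mu> / 21)"
  have eta: "0 < \<eta>" "\<eta> < \<eta>0" "21 * \<eta> \<le> \<mu>" using \<eta>0(1) mu by (auto simp: \<eta>_def)
  define s where "s = nat \<lceil>1 / \<eta> ^ 2\<rceil>"
  define d where "d = (s + 1) ^ k"
  have sd: "\<eta> < 1" "s \<ge> 1" "real d ^ 2 * (1 - \<eta>) ^ s \<le> 1 / 2"
    using \<eta>0(2)[of \<eta>] eta unfolding s_def d_def by blast+
  define r where "r = nat \<lceil>256 * real d ^ 3 / \<eta> ^ 3\<rceil>"
  obtain N where N: "\<And>G. G \<in> \<H> \<Longrightarrow> card (fst G) \<ge> N \<Longrightarrow>
    has_net \<eta> r G"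
    using eventually_net[OF k H eta(1) sd(1,2) d_def sd(3)] unfolding r_def by blast
  define L where "L = nat \<lceil>2 / \<mu>\<rceil> + 1"
  define M where "M = 2 ^ r * L"
  define N' where "N' = max N (nat \<lceil>2 / \<mu>\<rceil> + 1)"
  show ?thesis
  proof (rule exI[of _ M], rule exI[of _ N'], intro ballI impI)
    fix G assume G: "G \<in> \<H>" "N' \<le> card (fst G)"
    let ?V = "fst G"
    let ?n = "rcard ?V"
    interpret slicewise ?V "adj G" k
      using slicewise_if_kU_notin[OF k H G(1)] .
    obtain \<S> where S: "finite \<S>" "\<S> \<subseteq> Pow ?V" "card \<S> \<le> r"
      "rcard (uncovered (3 * \<eta> * ?n) \<S>) \<le> \<eta> * ?n ^ 2"
      using N[of G] G by (auto simp: N'_def)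
    have n2: "?n \<ge> 2 / \<mu>" "?n > 0"
    proof -
      have "real N' \<le> ?n" using G(2) by simp
      moreover have "2 / \<mu> \<le> real N'" unfolding N'_def by linarith
      moreover have "N' \<ge> 1" by (simp add: N'_def)
      ultimately show "?n \<ge> 2 / \<mu>" "?n > 0" by linarith+
    qed
    \<comment> \<open>At least \<open>\<mu> * ?n / 2\<close> keeps the number of intervals within
      \<open>L\<close>; at most \<open>\<mu> * ?n\<close> limits the classes. Rounding up respects
      the latter because \<open>?n \<ge> 2 / \<mu>\<close>.\<close>
    define t where "t = nat \<lceil>\<mu> * ?n / 2\<rceil>"
    have t: "\<mu> * ?n / 2 \<le> real t" "real t \<le> \<mu> * ?n" "t > 0"
    proof -
      have pos: "\<mu> * ?n / 2 > 0" using mu n2 by simp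
      then show "\<mu> * ?n / 2 \<le> real t" "t > 0" unfolding t_def by linarith+
      have "1 \<le> \<mu> * ?n / 2" using n2(1) mu by (simp add: field_simps)
      then show "real t \<le> \<mu> * ?n" using pos unfolding t_def by linarith
    qed
    obtain h where h: "bij_betw h ?V {..<card ?V}"
      using ex_bij_betw_finite_nat[OF finV] by (auto simp: lessThan_atLeast0)
    define c0 where "c0 v = ({S \<in> \<S>. v \<in> S}, h v div t)" for v
    have c0V: "c0 ` ?V \<subseteq> Pow \<S> \<times> {..<L}"
    proof
      fix p assume "p \<in> c0 ` ?V"
      then obtain v where v: "v \<in> ?V" "p = c0 v" by blast
      have "h v < card ?V" using h v by (auto simp: bij_betw_def)
      then have "real (h v) \<le> ?n" by simp
      also have "?n \<le> 2 / \<mu> * real t" using t(1) mu by (simp add: field_simps)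
      finally have hv: "real (h v) \<le> 2 / \<mu> * real t" .
      have "real (h v div t) * real t \<le> real (h v)"
        by (metis div_times_less_eq_dividend of_nat_le_iff of_nat_mult)
      then have "real (h v div t) * real t \<le> 2 / \<mu> * real t" using hv by linarith
      then have "real (h v div t) \<le> 2 / \<mu>" by (rule mult_right_le_imp_le) (use t(3) in simp)
      then have "h v div t < L" unfolding L_def by linarith
      then show "p \<in> Pow \<S> \<times> {..<L}" using v by (auto simp: c0_def)
    qed
    have finP: "finite (Pow \<S> \<times> {..<L})" using S by simp
    have cM: "card (Pow \<S> \<times> {..<L}) \<le> M"
      using S by (simp add: M_def card_cartesian_product card_Pow)
    \<comment> \<open>Renumbering the pairs by naturals below \<open>M\<close> gives all graphs the
      same range of colours.\<close>
    obtain \<iota> where \<iota>: "bij_betw \<iota> (Pow \<S> \<times> {..<L}) {..<card (Pow \<S> \<times> {..<L})}"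
      using ex_bij_betw_finite_nat[OF finP] by (auto simp: lessThan_atLeast0)
    have \<iota>M: "\<iota> x < M" if "x \<in> Pow \<S> \<times> {..<L}" for x
      using bij_betw_apply[OF \<iota> that] cM unfolding lessThan_iff by linarith
    define c where "c v = \<iota> (c0 v)" for v
    have ceq: "c v = c w \<longleftrightarrow> c0 v = c0 w" if "v \<in> ?V" "w \<in> ?V" for v w
    proof -
      have "c0 v \<in> Pow \<S> \<times> {..<L}" "c0 w \<in> Pow \<S> \<times> {..<L}" using that c0V by blast+
      then show ?thesis using \<iota> unfolding c_def bij_betw_def by (metis inj_on_eq_iff)
    qed
    have "flips c \<le> 21 * \<eta> * ?n ^ 3"
    proof (rule sum_flip_net[OF S(2,4)])
      fix T v w assume "T \<in> \<S>" "v \<in> ?V" "w \<in> ?V" "c v = c w"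
      then have "{S \<in> \<S>. v \<in> S} = {S \<in> \<S>. w \<in> S}" using ceq[of v w] by (simp add: c0_def)
      then show "v \<in> T \<longleftrightarrow> w \<in> T" using \<open>T \<in> \<S>\<close> by blast
    qed (use eta in simp)
    also have "\<dots> \<le> \<mu> * ?n ^ 3" using eta by (intro mult_right_mono) auto
    finally have flips: "flips c \<le> \<mu> * ?n ^ 3" .
    have "rcard {v \<in> ?V. c v = p} \<le> \<mu> * ?n" for p
    proof (cases "{v \<in> ?V. c v = p} = {}")
      case True
      then have "rcard {v \<in> ?V. c v = p} = 0" by (simp only: card.empty of_nat_0)
      also have "\<dots> \<le> \<mu> * ?n" using mu by simp
      finally show ?thesis .
    next
      case False
      then obtain w where w: "w \<in> ?V" "c w = p" by blast
      define q where "q = h w div t"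
      have "h ` {v \<in> ?V. c v = p} \<subseteq> {q * t..<q * t + t}"
      proof
        fix y assume "y \<in> h ` {v \<in> ?V. c v = p}"
        then obtain v where v: "v \<in> ?V" "c v = c w" "y = h v" using w by auto
        then have "y div t = q" using ceq[OF v(1) w(1)] by (simp add: c0_def q_def)
        then show "y \<in> {q * t..<q * t + t}"
          using t(3) by (metis add.commute atLeastLessThan_iff dividend_less_div_times div_times_less_eq_dividend)
      qed
      then have "card (h ` {v \<in> ?V. c v = p}) \<le> t"
        using card_mono[of "{q * t..<q * t + t}" "h ` {v \<in> ?V. c v = p}"] by simp
      moreover have "card (h ` {v \<in> ?V. c v = p}) = card {v \<in> ?V. c v = p}"
        using h by (intro card_image) (auto simp: bij_betw_def inj_on_def)
      ultimately show ?thesis using t(2) by linarith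
    qed
    moreover have "c ` ?V \<subseteq> {..<M}" using \<iota>M c0V by (auto simp: c_def)
    ultimately show "nicely_coloured M \<mu> G" using flips by blast
  qed
qed

text \<open>Blow-up of the induced subgraph on one representative \<open>w p\<close> per colour \<open>p \<in> J\<close>.\<close>
definition rep_edges :: "graph3 \<Rightarrow> (nat \<Rightarrow> nat) \<Rightarrow> nat set \<Rightarrow> (nat \<Rightarrow> nat) \<Rightarrow> nat set set" where
  "rep_edges H c J w = {e. e \<subseteq> fst H \<and> card e = 3 \<and> c ` e \<subseteq> J \<and> (\<lambda>v. w (c v)) ` e \<in> snd H}"

lemma is_3graph_distinct:
  assumes "is_3graph H" "{x, y, z} \<in> snd H"
  shows "x \<noteq> y" "y \<noteq> z" "x \<noteq> z"
proof -
  have "card {x, y, z} = 3" using assms by (auto simp: is_3graph_def)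
  then show "x \<noteq> y" "y \<noteq> z" "x \<noteq> z" by (auto simp: card_insert_if split: if_splits)
qed

text \<open>An edge between representatives has distinct ends, hence \<open>x\<close>,
  \<open>y\<close>, \<open>z\<close> are distinct and form a set of size 3.\<close>

lemma rep_edges_iff:
  assumes "is_3graph H" "x \<in> fst H" "y \<in> fst H" "z \<in> fst H"
  shows "{x, y, z} \<in> rep_edges H c J w \<longleftrightarrow>
    c x \<in> J \<and> c y \<in> J \<and> c z \<in> J \<and> {w (c x), w (c y), w (c z)} \<in> snd H"
proof -
  have "card {x, y, z} = 3" if "{w (c x), w (c y), w (c z)} \<in> snd H"
  proof -
    have "x \<noteq> y" "y \<noteq> z" "x \<noteq> z" using is_3graph_distinct[OF assms(1) that] by auto
    then show ?thesis by simp
  qed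
  then show ?thesis using assms by (auto simp: rep_edges_def)
qed

lemma is_3graph_rep: "is_3graph H \<Longrightarrow> is_3graph (fst H, rep_edges H c J w)"
  by (auto simp: is_3graph_def rep_edges_def)

section \<open>Random representatives of the colour classes\<close>

context slicewise
begin

context
  fixes H :: graph3 and c :: "nat \<Rightarrow> nat" and M :: nat and \<mu> \<gamma> :: real
  assumes V: "V = fst H" and f: "f = (adj H)" and H3: "is_3graph H"
    and cM: "c ` V \<subseteq> {..<M}"
    and mu: "\<And>p. rcard {v \<in> V. c v = p} \<le> \<mu> * n" "\<mu> \<ge> 0" and gam: "\<gamma> > 0"
    and flips: "flips c \<le> \<mu> * n ^ 3"
    and n0: "n > 0"
begin

definition X :: "nat \<Rightarrow> nat set" where "X p = {v \<in> V. c v = p}"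

text \<open>Colours with small classes are discarded, since finding a box requires large
  sides.\<close>

definition J :: "nat set" where "J = {p. p < M \<and> \<gamma> * n \<le> rcard (X p)}"

text \<open>Restricted to three different colours, because only then are the three representatives
  independent.\<close>

definition clash :: "(nat \<Rightarrow> nat) \<Rightarrow> nat \<times> nat \<times> nat \<Rightarrow> bool" where
  "clash w t \<longleftrightarrow> (case t of (x, y, z) \<Rightarrow> c x \<in> J \<and> c y \<in> J \<and> c z \<in> J \<and> c x \<noteq> c y \<and> c y \<noteq> c z \<and> c x \<noteq> c z \<and>
     f (w (c x)) (w (c y)) (w (c z)) \<noteq> f x y z)"

abbreviation clashes :: "(nat \<Rightarrow> nat) \<Rightarrow> (nat \<times> nat \<times> nat) set" where
  "clashes w \<equiv> {t \<in> V \<times> V \<times> V. clash w t}"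

lemma finX: "finite (X p)" using finV by (simp add: X_def)

lemma finJ: "finite J" by (simp add: J_def)

lemma finW: "finite (PiE J X)" using finJ finX by (intro finite_PiE) auto

lemma cell_X: "x \<in> V \<Longrightarrow> cell c x = X (c x)" by (simp add: cell_def X_def)

lemma card_X_pos: "p \<in> J \<Longrightarrow> card (X p) > 0"
proof -
  assume "p \<in> J"
  moreover have "0 < \<gamma> * n" using gam n0 by (rule mult_pos_pos)
  ultimately have "0 < rcard (X p)" by (simp add: J_def)
  then show ?thesis by simp
qed

lemma card_W_pos: "card (PiE J X) > 0"
  using card_X_pos finJ by (simp add: card_PiE prod_pos)

text \<open>For a triple with three different colours in \<open>J\<close>, the representatives are
  independent and uniform in the cells, so a clash has probability \<open>flip c x y z\<close>; any
  other triple never clashes. Summing over the triples bounds the expected number of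
  clashes.\<close>

lemma sum_clash_le:
  "(\<Sum>w\<in>PiE J X. rcard (clashes w)) \<le> rcard (PiE J X) * (\<mu> * n ^ 3)"
proof -
  let ?W = "PiE J X"
  let ?V3 = "V \<times> V \<times> V"
  have fin3: "finite ?V3" using finV by simp
  have aux: "a = r * (b / p)" if "a * p = r * b" "p > 0" for a b p r :: real
    using that by (simp add: field_simps)
  have "(\<Sum>w\<in>?W. rcard {t \<in> ?V3. clash w t}) = (\<Sum>t\<in>?V3. rcard {w \<in> ?W. clash w t})"
    using sum_card_swap[OF finW fin3, of clash] by (simp flip: of_nat_sum)
  also have "\<dots> \<le> (\<Sum>(x, y, z)\<in>?V3. rcard ?W * flip c x y z)"
  proof (rule sum_mono)
    fix t assume t: "t \<in> ?V3"
    obtain x y z where xyz: "t = (x, y, z)" by (metis prod_cases3)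
    then have xV: "x \<in> V" "y \<in> V" "z \<in> V" using t by auto
    have flip0: "flip c x y z \<ge> 0"
      unfolding flip_def avg_def by (intro divide_nonneg_nonneg sum_nonneg) auto
    have "rcard {w \<in> ?W. clash w t} \<le> rcard ?W * flip c x y z"
    proof (cases "c x \<in> J \<and> c y \<in> J \<and> c z \<in> J \<and> c x \<noteq> c y \<and> c y \<noteq> c z \<and> c x \<noteq> c z")
      case True
      let ?R = "\<lambda>x' y' z'. f x' y' z' \<noteq> f x y z"
      let ?P = "card (X (c x)) * card (X (c y)) * card (X (c z))"
      have pos: "real ?P > 0" using card_X_pos True by simp
      have "{w \<in> ?W. clash w t} = {w \<in> ?W. ?R (w (c x)) (w (c y)) (w (c z))}"
        using True by (simp add: clash_def xyz)
      then have "card {w \<in> ?W. clash w t} * ?P =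
          card ?W * card {(x', y', z') \<in> X (c x) \<times> X (c y) \<times> X (c z). ?R x' y' z'}"
        using True finX card_PiE_marginal3[OF finJ, of "c x" "c y" "c z" X ?R] by simp
      then have "rcard {w \<in> ?W. clash w t} * real ?P =
          rcard ?W * rcard {(x', y', z') \<in> X (c x) \<times> X (c y) \<times> X (c z). ?R x' y' z'}"
        unfolding of_nat_mult[symmetric] by (simp only:)
      then have "rcard {w \<in> ?W. clash w t} =
          rcard ?W * (rcard {(x', y', z') \<in> X (c x) \<times> X (c y) \<times> X (c z). ?R x' y' z'} / real ?P)"
        using pos by (rule aux)
      also have "rcard {(x', y', z') \<in> X (c x) \<times> X (c y) \<times> X (c z). ?R x' y' z'} / real ?P = flip c x y z"
        unfolding flip_def using xV by (subst avg_eq_card) (simp add: cell_X)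
      finally show ?thesis by simp
    next
      case False
      then have "{w \<in> ?W. clash w t} = {}" by (auto simp: clash_def xyz)
      then have "rcard {w \<in> ?W. clash w t} = 0" by (simp only: card.empty of_nat_0)
      then show ?thesis using flip0 by (simp only: mult_nonneg_nonneg of_nat_0_le_iff)
    qed
    then show "rcard {w \<in> ?W. clash w t} \<le> (case t of (x, y, z) \<Rightarrow> rcard ?W * flip c x y z)"
      by (simp add: xyz)
  qed
  also have "\<dots> = rcard ?W * flips c"
    by (simp add: sum.cartesian_product[symmetric] sum_distrib_left)
  also have "\<dots> \<le> rcard ?W * (\<mu> * n ^ 3)" using flips by (intro mult_left_mono) auto
  finally show ?thesis .
qed

text \<open>Markov's inequality. For \<open>\<mu> = 0\<close> the bound cannot be cancelled, but
  then no clash occurs at all.\<close>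

lemma many_good_reps:
  "rcard (PiE J X) \<le> 2 * rcard {w \<in> PiE J X. rcard (clashes w) \<le> 2 * \<mu> * n ^ 3}"
proof (cases "\<mu> = 0")
  case True
  have "(\<Sum>w\<in>PiE J X. rcard (clashes w)) = 0"
    using sum_clash_le True by (intro antisym sum_nonneg) auto
  then have "rcard (clashes w) = 0" if "w \<in> PiE J X" for w
    using that finW by (subst (asm) sum_nonneg_eq_0_iff) auto
  then have "{w \<in> PiE J X. rcard (clashes w) \<le> 2 * \<mu> * n ^ 3} = PiE J X"
    using True by auto
  then show ?thesis by simp
next
  case False
  let ?W = "PiE J X"
  let ?c = "\<lambda>w. rcard (clashes w)"
  let ?b = "2 * \<mu> * n ^ 3"
  have b: "?b > 0" using False mu(2) n0 by simp
  have "rcard {w \<in> ?W. \<not> ?c w \<le> ?b} * ?b \<le> (\<Sum>w\<in>{w \<in> ?W. \<not> ?c w \<le> ?b}. ?c w)"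
    by (intro sum_bounded_below) auto
  also have "\<dots> \<le> (\<Sum>w\<in>?W. ?c w)" using finW by (intro sum_mono2) auto
  also have "\<dots> \<le> rcard ?W * (\<mu> * n ^ 3)" by (rule sum_clash_le)
  finally have "2 * rcard {w \<in> ?W. \<not> ?c w \<le> ?b} * (\<mu> * n ^ 3) \<le> rcard ?W * (\<mu> * n ^ 3)"
    by (simp add: algebra_simps)
  then have "2 * rcard {w \<in> ?W. \<not> ?c w \<le> ?b} \<le> rcard ?W"
    by (rule mult_right_le_imp_le) (use b in simp)
  moreover have "card ?W = card {w \<in> ?W. ?c w \<le> ?b} + card {w \<in> ?W. \<not> ?c w \<le> ?b}"
  proof -
    have "?W = {w \<in> ?W. ?c w \<le> ?b} \<union> {w \<in> ?W. \<not> ?c w \<le> ?b}" by blast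
    then show ?thesis using card_Un_disjoint[of "{w \<in> ?W. ?c w \<le> ?b}" "{w \<in> ?W. \<not> ?c w \<le> ?b}"] finW by auto
  qed
  ultimately show ?thesis by simp
qed

lemma card_minor_colours: "rcard {v \<in> V. c v \<notin> J} \<le> real M * \<gamma> * n"
proof -
  have "{v \<in> V. c v \<notin> J} = (\<Union>p\<in>{..<M} - J. X p)" using cM by (auto simp: X_def)
  then have "rcard {v \<in> V. c v \<notin> J} \<le> real (\<Sum>p\<in>{..<M} - J. card (X p))"
    using card_UN_le[of "{..<M} - J" X] by (simp only: of_nat_le_iff) simp
  also have "\<dots> = (\<Sum>p\<in>{..<M} - J. rcard (X p))" by simp
  also have "\<dots> \<le> rcard ({..<M} - J) * (\<gamma> * n)" by (intro sum_bounded_above) (auto simp: J_def)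
  also have "\<dots> \<le> real M * (\<gamma> * n)"
    using gam card_mono[of "{..<M}" "{..<M} - J"] by (intro mult_right_mono) auto
  finally show ?thesis by (simp add: mult.assoc)
qed

text \<open>A triple on which \<open>H\<close> and the blow-up disagree is a clash, or has two equal
  colours (three choices, at most \<open>\<mu> * n ^ 3\<close> each), or contains a vertex of a
  discarded colour (three choices, at most \<open>real M * \<gamma> * n ^ 3\<close> each).\<close>

lemma symdiff_rep_le:
  assumes w: "w \<in> PiE J X"
  shows "edge_dist (snd H) (rep_edges H c J w) \<le>
    rcard (clashes w) + (3 * \<mu> + 3 * real M * \<gamma>) * n ^ 3"
proof -
  let ?E = "ord_edges (snd H)" and ?E' = "ord_edges (rep_edges H c J w)"
  let ?C = "clashes w"
  let ?B = "{v \<in> V. c v \<notin> J}"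
  let ?D1 = "{(x, y, z) \<in> V \<times> V \<times> V. c x = c y}"
  let ?D2 = "{(x, y, z) \<in> V \<times> V \<times> V. c y = c z}"
  let ?D3 = "{(x, y, z) \<in> V \<times> V \<times> V. c x = c z}"
  let ?U = "((?C \<union> (?D1 \<union> (?D2 \<union> ?D3))) \<union> ((?B \<times> V \<times> V) \<union> ((V \<times> ?B \<times> V) \<union> (V \<times> V \<times> ?B))))"
  have sub: "(?E - ?E') \<union> (?E' - ?E) \<subseteq> ?U"
  proof
    fix t assume t: "t \<in> (?E - ?E') \<union> (?E' - ?E)"
    obtain x y z where xyz: "t = (x, y, z)" by (metis prod_cases3)
    have d: "{x, y, z} \<in> snd H \<longleftrightarrow> {x, y, z} \<notin> rep_edges H c J w" using t by (auto simp: xyz ord_edges_def)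
    then have "{x, y, z} \<subseteq> fst H" using H3 by (auto simp: is_3graph_def rep_edges_def)
    then have xV: "x \<in> V" "y \<in> V" "z \<in> V" using V by auto
    then have d': "{x, y, z} \<in> snd H \<longleftrightarrow> \<not> (c x \<in> J \<and> c y \<in> J \<and> c z \<in> J \<and> {w (c x), w (c y), w (c z)} \<in> snd H)"
      using d rep_edges_iff[OF H3] V by simp
    show "t \<in> ?U"
    proof (rule ccontr)
      assume no: "t \<notin> ?U"
      then have "c x \<in> J" "c y \<in> J" "c z \<in> J" "c x \<noteq> c y" "c y \<noteq> c z" "c x \<noteq> c z"
        using xV unfolding xyz by simp_all
      moreover have "f x y z \<longleftrightarrow> {x, y, z} \<in> snd H" for x y z by (simp add: f)
      ultimately have "clash w t" using d' unfolding clash_def xyz prod.case by blast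
      then show False using no xV unfolding xyz by simp
    qed
  qed
  have fin: "finite ?U"
    by (rule finite_subset[of _ "V \<times> V \<times> V"]) (use finV in auto)
  have "card ((?E - ?E') \<union> (?E' - ?E)) \<le> card ?U" using sub fin by (rule card_mono[rotated])
  also have "\<dots> \<le> (card ?C + (card ?D1 + (card ?D2 + card ?D3))) +
      (card (?B \<times> V \<times> V) + (card (V \<times> ?B \<times> V) + card (V \<times> V \<times> ?B)))"
    by (intro order_trans[OF card_Un_le] add_mono order_refl)
  finally have 1: "rcard ((?E - ?E') \<union> (?E' - ?E)) \<le> (rcard ?C + (rcard ?D1 + (rcard ?D2 + rcard ?D3))) +
      (rcard (?B \<times> V \<times> V) + (rcard (V \<times> ?B \<times> V) + rcard (V \<times> V \<times> ?B)))"
    by (simp only: of_nat_add[symmetric] of_nat_le_iff)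
  have same: "(\<Sum>y\<in>V. of_bool (c x = c y)) \<le> \<mu> * n" for x
  proof -
    have "(\<Sum>y\<in>V. of_bool (c x = c y)) = rcard {v \<in> V. c v = c x}"
      using finV by (simp add: Int_def eq_commute conj_commute)
    then show ?thesis using mu(1) by simp
  qed
  have k0: "(\<Sum>x\<in>V. \<Sum>y\<in>V. \<mu> * n) = \<mu> * n ^ 3" by (simp add: power3_eq_cube)
  have D1: "rcard ?D1 \<le> \<mu> * n ^ 3"
  proof -
    have "rcard ?D1 = (\<Sum>x\<in>V. \<Sum>y\<in>V. \<Sum>z\<in>V. of_bool (c x = c y))"
      by (rule card_triples_eq_sum[OF finV finV finV])
    also have "\<dots> = (\<Sum>x\<in>V. \<Sum>z\<in>V. \<Sum>y\<in>V. of_bool (c x = c y))" by (intro sum.cong refl sum.swap)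
    also have "\<dots> \<le> (\<Sum>x\<in>V. \<Sum>z\<in>V. \<mu> * n)" by (intro sum_mono same)
    finally show ?thesis unfolding k0 .
  qed
  have D2: "rcard ?D2 \<le> \<mu> * n ^ 3"
  proof -
    have "rcard ?D2 = (\<Sum>x\<in>V. \<Sum>y\<in>V. \<Sum>z\<in>V. of_bool (c y = c z))"
      by (rule card_triples_eq_sum[OF finV finV finV])
    also have "\<dots> \<le> (\<Sum>x\<in>V. \<Sum>y\<in>V. \<mu> * n)" by (intro sum_mono same)
    finally show ?thesis unfolding k0 .
  qed
  have D3: "rcard ?D3 \<le> \<mu> * n ^ 3"
  proof -
    have "rcard ?D3 = (\<Sum>x\<in>V. \<Sum>y\<in>V. \<Sum>z\<in>V. of_bool (c x = c z))"
      by (rule card_triples_eq_sum[OF finV finV finV])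
    also have "\<dots> \<le> (\<Sum>x\<in>V. \<Sum>y\<in>V. \<mu> * n)" by (intro sum_mono same)
    finally show ?thesis unfolding k0 .
  qed
  have "rcard ?B * (n * n) \<le> real M * \<gamma> * n * (n * n)"
    using card_minor_colours by (intro mult_right_mono) auto
  then have B: "rcard ?B * (n * n) \<le> real M * \<gamma> * n ^ 3" by (simp add: power3_eq_cube)
  have "rcard (?B \<times> V \<times> V) \<le> real M * \<gamma> * n ^ 3" "rcard (V \<times> ?B \<times> V) \<le> real M * \<gamma> * n ^ 3"
    "rcard (V \<times> V \<times> ?B) \<le> real M * \<gamma> * n ^ 3"
    using B by (simp_all add: card_cartesian_product mult_ac)
  then show ?thesis using 1 D1 D2 D3 by (simp add: algebra_simps)
qed

definition role_maps :: "nat \<Rightarrow> ((nat \<Rightarrow> nat) \<times> (nat \<Rightarrow> nat) \<times> (nat set \<Rightarrow> nat)) set" where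
  "role_maps l = ({1..l} \<rightarrow>\<^sub>E J) \<times> ({1..l} \<rightarrow>\<^sub>E J) \<times> (Pow {1..l} \<rightarrow>\<^sub>E J)"

text \<open>The inequalities between colours permit changing the three representatives independently
  of one another.\<close>

definition realises :: "nat \<Rightarrow> (nat \<Rightarrow> nat) \<Rightarrow> (nat \<Rightarrow> nat) \<times> (nat \<Rightarrow> nat) \<times> (nat set \<Rightarrow> nat) \<Rightarrow> bool" where
  "realises l w \<rho> \<longleftrightarrow> (case \<rho> of (\<alpha>, \<beta>, \<zeta>) \<Rightarrow> \<forall>i\<in>{1..l}. \<forall>S\<in>Pow {1..l}.
     \<alpha> i \<noteq> \<beta> i \<and> \<zeta> S \<noteq> \<alpha> i \<and> \<zeta> S \<noteq> \<beta> i \<and> ({w (\<alpha> i), w (\<beta> i), w (\<zeta> S)} \<in> snd H \<longleftrightarrow> i \<in> S))"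

text \<open>Adjacency in the blow-up depends on colours only, so a shattered configuration of
  vertices can be read as one of colours. From size \<open>2 * l + 1\<close>,
  \<open>clean_configuration\<close> extracts one of size \<open>l\<close> with the required
  inequalities.\<close>

lemma rep_shatters_realises:
  assumes w: "w \<in> PiE J X" and sh: "VC_shatters (2 * l + 1) (fst H, rep_edges H c J w)"
  shows "\<exists>\<rho>\<in>role_maps l. realises l w \<rho>"
proof -
  obtain a b cc where *: "\<forall>i\<in>{1..2 * l + 1}. a i \<in> fst H \<and> b i \<in> fst H" "\<forall>S. S \<subseteq> {1..2 * l + 1} \<longrightarrow> cc S \<in> fst H"
    "\<forall>i\<in>{1..2 * l + 1}. \<forall>S. S \<subseteq> {1..2 * l + 1} \<longrightarrow> ({a i, b i, cc S} \<in> rep_edges H c J w \<longleftrightarrow> i \<in> S)"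
    using sh unfolding VC_shatters_def fst_conv snd_conv by (elim exE conjE) (rule that)
  let ?R = "\<lambda>p q r. p \<in> J \<and> q \<in> J \<and> r \<in> J \<and> {w p, w q, w r} \<in> snd H"
  have "\<exists>\<alpha>\<in>{1..l} \<rightarrow>\<^sub>E J. \<exists>\<beta>\<in>{1..l} \<rightarrow>\<^sub>E J. \<exists>\<zeta>\<in>Pow {1..l} \<rightarrow>\<^sub>E J.
    \<forall>i\<in>{1..l}. \<forall>S\<in>Pow {1..l}. \<alpha> i \<noteq> \<beta> i \<and> \<zeta> S \<noteq> \<alpha> i \<and> \<zeta> S \<noteq> \<beta> i \<and> (?R (\<alpha> i) (\<beta> i) (\<zeta> S) \<longleftrightarrow> i \<in> S)"
  proof (rule clean_configuration[of l ?R "\<lambda>i. c (a i)" "\<lambda>i. c (b i)" "\<lambda>S. c (cc S)"])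
    fix i S assume iS: "i \<in> {1..2 * l + 1}" "S \<subseteq> {1..2 * l + 1}"
    then have "a i \<in> fst H" "b i \<in> fst H" "cc S \<in> fst H" "{a i, b i, cc S} \<in> rep_edges H c J w \<longleftrightarrow> i \<in> S"
      using * by blast+
    then show "?R (c (a i)) (c (b i)) (c (cc S)) \<longleftrightarrow> i \<in> S" using rep_edges_iff[OF H3, of "a i" "b i" "cc S"] by simp
  next
    fix p q r assume "?R p q r"
    moreover from this have "w p \<noteq> w q" using is_3graph_distinct(1)[OF H3] by blast
    ultimately show "p \<in> J \<and> q \<in> J \<and> r \<in> J \<and> p \<noteq> q" by metis
  qed
  then obtain \<alpha> \<beta> \<zeta> where abz: "\<alpha> \<in> {1..l} \<rightarrow>\<^sub>E J" "\<beta> \<in> {1..l} \<rightarrow>\<^sub>E J" "\<zeta> \<in> Pow {1..l} \<rightarrow>\<^sub>E J"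
    "\<forall>i\<in>{1..l}. \<forall>S\<in>Pow {1..l}.
       \<alpha> i \<noteq> \<beta> i \<and> \<zeta> S \<noteq> \<alpha> i \<and> \<zeta> S \<noteq> \<beta> i \<and> (?R (\<alpha> i) (\<beta> i) (\<zeta> S) \<longleftrightarrow> i \<in> S)"
    by (elim bexE) (rule that)
  have "realises l w (\<alpha>, \<beta>, \<zeta>)"
    unfolding realises_def prod.case
  proof (intro ballI)
    fix i S assume iS: "i \<in> {1..l}" "S \<in> Pow {1..l}"
    then have "\<alpha> i \<in> J" "\<beta> i \<in> J" "\<zeta> S \<in> J" using PiE_mem[OF abz(1)] PiE_mem[OF abz(2)] PiE_mem[OF abz(3)] by blast+
    then show "\<alpha> i \<noteq> \<beta> i \<and> \<zeta> S \<noteq> \<alpha> i \<and> \<zeta> S \<noteq> \<beta> i \<and> ({w (\<alpha> i), w (\<beta> i), w (\<zeta> S)} \<in> snd H \<longleftrightarrow> i \<in> S)"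
      using bspec[OF bspec[OF abz(4) iS(1)] iS(2)] by simp
  qed
  moreover have "(\<alpha>, \<beta>, \<zeta>) \<in> role_maps l" using abz(1-3) by (simp add: role_maps_def)
  ultimately show ?thesis by blast
qed

lemma card_role_maps: "finite (role_maps l)" "card (role_maps l) \<le> M ^ (2 * l + 2 ^ l)"
proof -
  show "finite (role_maps l)" unfolding role_maps_def using finJ by (intro finite_cartesian_product finite_PiE) auto
  have "card J \<le> M" using card_mono[of "{..<M}" J] by (auto simp: J_def)
  have "card (role_maps l) = card J ^ l * (card J ^ l * card J ^ (2 ^ l))"
    by (simp add: role_maps_def card_cartesian_product card_PiE card_Pow)
  also have "\<dots> = card J ^ (2 * l + 2 ^ l)" by (simp add: power_add mult_2)
  also have "\<dots> \<le> M ^ (2 * l + 2 ^ l)" using \<open>card J \<le> M\<close> by (rule power_mono) simp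
  finally show "card (role_maps l) \<le> M ^ (2 * l + 2 ^ l)" .
qed

text \<open>At least half of the choices \<open>w\<close> produce a blow-up so close to
  \<open>H\<close> that it cannot lie in \<open>VC_below\<close>, and each of these realises some
  role map. There are boundedly many role maps, so one is realised by a positive share of all
  \<open>w\<close>. The \<open>5 * \<mu>\<close> consists of \<open>2 * \<mu>\<close> for clashes
  and \<open>3 * \<mu>\<close> for coinciding colours.\<close>

lemma dense_role:
  assumes far: "\<And>E'. (fst H, E') \<in> VC_below (2 * l + 1) \<Longrightarrow>
      \<delta> * n ^ 3 < edge_dist (snd H) E'"
    and \<delta>: "5 * \<mu> + 3 * real M * \<gamma> \<le> \<delta>"
  shows "\<exists>\<rho>\<in>role_maps l. rcard (PiE J X) / (2 * real (M ^ (2 * l + 2 ^ l)))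
     \<le> rcard {w \<in> PiE J X. realises l w \<rho>}"
proof -
  let ?W = "PiE J X"
  let ?G = "{w \<in> ?W. rcard (clashes w) \<le> 2 * \<mu> * n ^ 3}"
  let ?m = "real (M ^ (2 * l + 2 ^ l))"
  have aux: "a / (2 * b) * b = a / 2" if "b > 0" for a b :: real using that by simp
  have ex: "\<exists>\<rho>\<in>role_maps l. realises l w \<rho>" if w: "w \<in> ?G" for w
  proof -
    have "edge_dist (snd H) (rep_edges H c J w) \<le> 2 * \<mu> * n ^ 3 + (3 * \<mu> + 3 * real M * \<gamma>) * n ^ 3"
      using symdiff_rep_le[of w] w by force
    also have "\<dots> = (5 * \<mu> + 3 * real M * \<gamma>) * n ^ 3" by (simp add: algebra_simps)
    also have "\<dots> \<le> \<delta> * n ^ 3" using \<delta> by (intro mult_right_mono) auto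
    finally have "(fst H, rep_edges H c J w) \<notin> VC_below (2 * l + 1)" using far by fastforce
    then have "VC_shatters (2 * l + 1) (fst H, rep_edges H c J w)"
      using is_3graph_rep[OF H3] by (simp add: VC_below_def)
    then show ?thesis using w by (intro rep_shatters_realises) auto
  qed
  have "?G \<subseteq> (\<Union>\<rho>\<in>role_maps l. {w \<in> ?W. realises l w \<rho>})" using ex by blast
  then have "card ?G \<le> card (\<Union>\<rho>\<in>role_maps l. {w \<in> ?W. realises l w \<rho>})"
    using card_role_maps(1) finW by (intro card_mono) auto
  also have "\<dots> \<le> (\<Sum>\<rho>\<in>role_maps l. card {w \<in> ?W. realises l w \<rho>})"
    by (rule card_UN_le[OF card_role_maps(1)])
  finally have "rcard ?G \<le> (\<Sum>\<rho>\<in>role_maps l. rcard {w \<in> ?W. realises l w \<rho>})"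
    by (simp only: of_nat_sum[symmetric] of_nat_le_iff)
  then have tot: "rcard ?W / 2 \<le> (\<Sum>\<rho>\<in>role_maps l. rcard {w \<in> ?W. realises l w \<rho>})"
    using many_good_reps by linarith
  have ne: "role_maps l \<noteq> {}"
  proof
    assume "role_maps l = {}"
    then show False using tot card_W_pos by simp
  qed
  then have "card (role_maps l) > 0" using card_role_maps(1) by (simp add: card_gt_0_iff)
  then have m: "?m > 0" "rcard (role_maps l) \<le> ?m" using card_role_maps(2)[of l]
    by (simp_all only: of_nat_le_iff of_nat_0_less_iff)
  have "rcard ?W / (2 * ?m) * rcard (role_maps l) \<le> rcard ?W / (2 * ?m) * ?m"
    using m by (intro mult_left_mono) auto
  also have "\<dots> = rcard ?W / 2" using m(1) by (rule aux)
  finally show ?thesis using exists_ge_average[OF card_role_maps(1) ne order_trans[OF _ tot]] by blast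
qed

text \<open>Within the dense set of choices realising one role map, \<open>box\<close> finds sets
  \<open>T j\<close> such that every choice from them realises it. Roles of the same colour share
  one \<open>T j\<close>, so disjoint pieces have to be cut out; \<open>3 * l * 2 ^ l * u\<close> is
  the total size of all pieces.\<close>

lemma exists_blowup:
  assumes l: "l \<ge> 1" "u \<ge> 1"
    and far: "\<And>E'. (fst H, E') \<in> VC_below (2 * l + 1) \<Longrightarrow>
      \<delta> * n ^ 3 < edge_dist (snd H) E'"
    and \<delta>: "5 * \<mu> + 3 * real M * \<gamma> \<le> \<delta>"
    and n0': "real n0 \<le> \<gamma> * n"
    and box: "\<And>G. (\<forall>j\<in>J. finite (X j) \<and> card (X j) \<ge> n0) \<Longrightarrow> G \<subseteq> PiE J X \<Longrightarrow>
           rcard G \<ge> 1 / (2 * real (M ^ (2 * l + 2 ^ l))) * (\<Prod>j\<in>J. rcard (X j)) \<Longrightarrow>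
           has_box J (3 * l * 2 ^ l * u) X G"
  shows "\<exists>D. blowup H l u D"
proof -
  let ?t = "3 * l * 2 ^ l * u"
  obtain \<rho> where \<rho>: "\<rho> \<in> role_maps l" "rcard (PiE J X) / (2 * real (M ^ (2 * l + 2 ^ l)))
     \<le> rcard {w \<in> PiE J X. realises l w \<rho>}" using dense_role[OF far \<delta>] by blast
  obtain \<alpha> \<beta> \<zeta> where abz: "\<rho> = (\<alpha>, \<beta>, \<zeta>)" by (metis prod_cases3)
  have aJ: "\<alpha> i \<in> J" "\<beta> i \<in> J" if "i \<in> {1..l}" for i using \<rho>(1) that by (auto simp: role_maps_def abz)
  have zJ: "\<zeta> S \<in> J" if "S \<in> Pow {1..l}" for S using \<rho>(1) PiE_mem[OF _ that] by (auto simp: role_maps_def abz)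
  have "has_box J ?t X {w \<in> PiE J X. realises l w \<rho>}"
  proof (rule box)
    show "\<forall>j\<in>J. finite (X j) \<and> n0 \<le> card (X j)"
    proof
      fix j assume "j \<in> J"
      then have "real n0 \<le> rcard (X j)" using n0' by (simp add: J_def)
      then show "finite (X j) \<and> n0 \<le> card (X j)" using finX by simp
    qed
    show "1 / (2 * real (M ^ (2 * l + 2 ^ l))) * (\<Prod>j\<in>J. rcard (X j)) \<le> rcard {w \<in> PiE J X. realises l w \<rho>}"
      using \<rho>(2) finJ by (simp add: card_PiE)
  qed blast
  then obtain T where T: "\<And>j. j \<in> J \<Longrightarrow> T j \<subseteq> X j \<and> card (T j) = ?t"
     "PiE J T \<subseteq> {w \<in> PiE J X. realises l w \<rho>}" by blast
  define U where "U r = (case r of Inl (Inl i) \<Rightarrow> T (\<alpha> i) | Inl (Inr i) \<Rightarrow> T (\<beta> i) | Inr S \<Rightarrow> T (\<zeta> S))" for r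
  define sz where "sz r = (case r of Inl _ \<Rightarrow> 2 ^ l * u | Inr _ \<Rightarrow> l * u)" for r :: "(nat + nat) + nat set"
  have finR: "finite (roles l)" by (simp add: roles_def)
  have szsum: "(\<Sum>r\<in>roles l. sz r) = ?t"
  proof -
    have "(\<Sum>r\<in>roles l. sz r) = (\<Sum>r\<in>{1..l} <+> {1..l}. 2 ^ l * u) + (\<Sum>S\<in>Pow {1..l}. l * u)"
      unfolding roles_def by (subst sum.Plus) (simp_all add: sz_def)
    also have "\<dots> = ?t" by (simp add: card_Plus card_Pow algebra_simps)
    finally show ?thesis .
  qed
  have Uc: "\<exists>j\<in>J. U r = T j" if "r \<in> roles l" for r
    using that aJ zJ unfolding roles_def U_def by (elim PlusE) auto
  have "\<exists>D. (\<forall>r\<in>roles l. D r \<subseteq> U r \<and> card (D r) = sz r) \<and> disjoint_family_on D (roles l)"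
  proof (rule disjoint_subsets[OF finR])
    fix r assume "r \<in> roles l"
    then obtain j where j: "j \<in> J" "U r = T j" using Uc by blast
    then show "finite (U r) \<and> (\<Sum>r\<in>roles l. sz r) \<le> card (U r)"
      using T(1)[OF j(1)] finX szsum by (auto intro: finite_subset)
  qed
  then obtain D where D: "\<And>r. r \<in> roles l \<Longrightarrow> D r \<subseteq> U r \<and> card (D r) = sz r" "disjoint_family_on D (roles l)" by blast
  have r: "Inl (Inl i) \<in> roles l" "Inl (Inr i) \<in> roles l" if "i \<in> {1..l}" for i
    using that by (auto simp: roles_def)
  have r': "Inr S \<in> roles l" if "S \<in> Pow {1..l}" for S using that by (auto simp: roles_def)
  have ne: "T j \<noteq> {}" if "j \<in> J" for j using T(1)[OF that] l by auto
  have edge: "{a, b, cc} \<in> snd H \<longleftrightarrow> i \<in> S"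
    if iS: "i \<in> {1..l}" "S \<in> Pow {1..l}" and abc: "a \<in> T (\<alpha> i)" "b \<in> T (\<beta> i)" "cc \<in> T (\<zeta> S)" for i S a b cc
  proof -
    obtain w0 where w0: "w0 \<in> PiE J T" using ne by (metis PiE_eq_empty_iff ex_in_conv)
    have "realises l w0 \<rho>" using w0 T(2) by blast
    then have dis: "\<alpha> i \<noteq> \<beta> i" "\<zeta> S \<noteq> \<alpha> i" "\<zeta> S \<noteq> \<beta> i"
      using iS unfolding realises_def abz prod.case by blast+
    \<comment> \<open>Three entries of an arbitrary choice \<open>w0\<close> are overwritten; as the
      colours differ, no overwriting undoes another.\<close>
    define w where "w = w0(\<alpha> i := a, \<beta> i := b, \<zeta> S := cc)"
    have "w \<in> PiE J T" unfolding w_def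
    proof (rule PiE_I)
      fix j assume j: "j \<in> J"
      show "(w0(\<alpha> i := a, \<beta> i := b, \<zeta> S := cc)) j \<in> T j"
        using PiE_mem[OF w0 j] abc by auto
    next
      fix j assume j: "j \<notin> J"
      have "j \<noteq> \<alpha> i" "j \<noteq> \<beta> i" "j \<noteq> \<zeta> S" using aJ[OF iS(1)] zJ[OF iS(2)] j by auto
      then show "(w0(\<alpha> i := a, \<beta> i := b, \<zeta> S := cc)) j = undefined" using PiE_arb[OF w0 j] by simp
    qed
    then have "realises l w \<rho>" using T(2) by blast
    then have "{w (\<alpha> i), w (\<beta> i), w (\<zeta> S)} \<in> snd H \<longleftrightarrow> i \<in> S"
      using iS unfolding realises_def abz prod.case by blast
    moreover have "w (\<alpha> i) = a" "w (\<beta> i) = b" "w (\<zeta> S) = cc" using dis by (auto simp: w_def)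
    ultimately show ?thesis by simp
  qed
  have "blowup H l u D"
    unfolding blowup_def
  proof (intro conjI ballI)
    show "disjoint_family_on D (roles l)" by (rule D(2))
    fix q assume q: "q \<in> roles l"
    obtain j where j: "j \<in> J" "U q = T j" using Uc[OF q] by blast
    have "X j \<subseteq> V" by (auto simp: X_def)
    then have "X j \<subseteq> fst H" unfolding V[symmetric] .
    then show "D q \<subseteq> fst H" using D(1)[OF q] T(1)[OF j(1)] j(2) by blast
  next
    fix i assume i: "i \<in> {1..l}"
    show "card (D (Inl (Inl i))) = 2 ^ l * u" "card (D (Inl (Inr i))) = 2 ^ l * u"
      using D(1)[OF r(1)[OF i]] D(1)[OF r(2)[OF i]] by (simp_all add: sz_def)
  next
    fix S assume S: "S \<in> Pow {1..l}"
    show "card (D (Inr S)) = l * u" using D(1)[OF r'[OF S]] by (simp add: sz_def)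
  next
    fix i S a b cc assume iS: "i \<in> {1..l}" "S \<in> Pow {1..l}"
      and abc: "a \<in> D (Inl (Inl i))" "b \<in> D (Inl (Inr i))" "cc \<in> D (Inr S)"
    have "a \<in> T (\<alpha> i)" "b \<in> T (\<beta> i)" "cc \<in> T (\<zeta> S)"
      using abc D(1)[OF r(1)[OF iS(1)]] D(1)[OF r(2)[OF iS(1)]] D(1)[OF r'[OF iS(2)]] by (auto simp: U_def)
    then show "{a, b, cc} \<in> snd H \<longleftrightarrow> i \<in> S" using edge[OF iS] by blast
  qed
  then show ?thesis by blast
qed

end

end

text \<open>The order of choice matters: \<open>\<delta>\<close> witnesses that the property is not
  close to \<open>VC_below\<close>, \<open>\<mu>\<close> is a tenth of it, \<open>M\<close> bounds
  the number of colours needed for \<open>\<mu>\<close>, and only then is \<open>\<gamma>\<close>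
  chosen small compared with \<open>1 / M\<close>. One half of \<open>\<delta>\<close> pays for
  \<open>5 * \<mu>\<close>, the other for \<open>3 * real M * \<gamma>\<close>.\<close>

lemma far_imp_blowup:
  assumes k: "k \<ge> 1" and H: "hereditary3 \<H>" "kU k \<notin> TripClass \<H>" and far: "far_from_finite_VC \<H>"
    and l: "l \<ge> 1" "u \<ge> 1"
  shows "\<exists>G\<in>\<H>. \<exists>D. blowup G l u D"
proof -
  have "\<not> close_to \<H> (VC_below (2 * l + 1))"
    using far hereditary_VC_below VC_class_VC_below unfolding far_from_finite_VC_def by blast
  then obtain \<delta> where \<delta>: "\<delta> > 0" and far\<delta>: "\<And>N. \<exists>G\<in>\<H>. card (fst G) \<ge> N \<and>
     (\<forall>E'. (fst G, E') \<in> VC_below (2 * l + 1) \<longrightarrow>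
       \<delta> * rcard (fst G) ^ 3 < edge_dist (snd G) E')"
    unfolding close_to_def by (meson not_less)
  define \<mu> where "\<mu> = \<delta> / 10"
  have mu: "\<mu> > 0" using \<delta> by (simp add: \<mu>_def)
  obtain M N where MN: "\<forall>G\<in>\<H>. card (fst G) \<ge> N \<longrightarrow> nicely_coloured M \<mu> G"
    using nice_colouring[OF k H mu] by blast
  define \<gamma> where "\<gamma> = \<delta> / (6 * (real M + 1))"
  have gam: "\<gamma> > 0" "3 * real M * \<gamma> \<le> \<delta> / 2"
  proof -
    show "\<gamma> > 0" using \<delta> by (simp add: \<gamma>_def)
    have "3 * real M * \<gamma> = \<delta> / 2 * (real M / (real M + 1))" by (simp add: \<gamma>_def field_simps)
    also have "\<dots> \<le> \<delta> / 2 * 1" using \<delta> by (intro mult_left_mono) auto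
    finally show "3 * real M * \<gamma> \<le> \<delta> / 2" by simp
  qed
  \<comment> \<open>The maximum with 1 keeps the density \<open>1 / (2 * m)\<close> positive before
    a non-empty graph shows \<open>M \<ge> 1\<close>.\<close>
  define m where "m = max 1 (real (M ^ (2 * l + 2 ^ l)))"
  define t where "t = 3 * l * 2 ^ l * u"
  have t1: "t \<ge> 1" using l by (simp add: t_def Suc_le_eq)
  let ?box = "\<lambda>J n0. \<forall>(X :: nat \<Rightarrow> nat set) G. (\<forall>j\<in>J. finite (X j) \<and> card (X j) \<ge> n0) \<and> G \<subseteq> PiE J X \<and>
           rcard G \<ge> 1 / (2 * m) * (\<Prod>j\<in>J. rcard (X j)) \<longrightarrow>
           has_box J t X G"
  have "\<forall>J\<in>Pow {..<M}. \<exists>n0. ?box J n0"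
  proof
    fix J assume "J \<in> Pow {..<M}"
    then have "finite J" using finite_subset by auto
    moreover have "1 / (2 * m) > 0" by (simp add: m_def)
    ultimately show "\<exists>n0. ?box J n0" using t1 by (rule dense_contains_box)
  qed
  then obtain n1 where n1: "\<And>J. J \<in> Pow {..<M} \<Longrightarrow> ?box J (n1 J)" by metis
  \<comment> \<open>The set of large colours varies with the graph, so the threshold must serve all
    subsets of \<open>{..<M}\<close>.\<close>
  define n0 where "n0 = Max (n1 ` Pow {..<M})"
  have n10: "n1 J \<le> n0" if "J \<in> Pow {..<M}" for J using that unfolding n0_def by (intro Max_ge) auto
  define N' where "N' = max N (nat \<lceil>real n0 / \<gamma>\<rceil> + 1)"
  obtain G where G: "G \<in> \<H>" "N' \<le> card (fst G)"
     and farG: "\<And>E'. (fst G, E') \<in> VC_below (2 * l + 1) \<Longrightarrow>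
       \<delta> * rcard (fst G) ^ 3 < edge_dist (snd G) E'"
    using far\<delta>[of N'] by blast
  have N: "N \<le> card (fst G)" "rcard (fst G) > 0" "real n0 \<le> \<gamma> * rcard (fst G)"
  proof -
    show "N \<le> card (fst G)" using G(2) by (simp add: N'_def)
    have "nat \<lceil>real n0 / \<gamma>\<rceil> + 1 \<le> card (fst G)" using G(2) by (simp add: N'_def)
    then have "real n0 / \<gamma> \<le> rcard (fst G)" "card (fst G) \<ge> 1" by linarith+
    then show "rcard (fst G) > 0" "real n0 \<le> \<gamma> * rcard (fst G)" using gam(1) by (simp_all add: field_simps)
  qed
  interpret slicewise "fst G" "adj G" k
    using slicewise_if_kU_notin[OF k H G(1)] .
  obtain c :: "nat \<Rightarrow> nat" where c: "c ` fst G \<subseteq> {..<M}" "\<And>p. rcard {v \<in> fst G. c v = p} \<le> \<mu> * n"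
     "flips c \<le> \<mu> * n ^ 3"
    using MN G(1) N(1) by blast
  have G3: "is_3graph G" using G(1) H(1) by (simp add: hereditary3_def)
  have "fst G \<noteq> {}" using N(2) by auto
  then have "M \<ge> 1" using c(1) by (cases M) auto
  then have m: "m = real (M ^ (2 * l + 2 ^ l))" by (simp add: m_def)
  let ?J = "J c M \<gamma>"
  have mu0: "0 \<le> \<mu>" using mu by simp
  have JM: "?J \<in> Pow {..<M}"
    unfolding J_def[OF refl refl G3 c(1,2) mu0 gam(1) c(3) N(2)] by auto
  have "\<exists>D. blowup G l u D"
  proof (rule exists_blowup[OF refl refl G3 c(1,2) mu0 gam(1) c(3) N(2) l farG _ N(3)])
    show "5 * \<mu> + 3 * real M * \<gamma> \<le> \<delta>" using gam(2) by (simp add: \<mu>_def)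
    fix F assume F: "\<forall>j\<in>?J. finite (X c j) \<and> n0 \<le> card (X c j)" "F \<subseteq> PiE ?J (X c)"
      "1 / (2 * real (M ^ (2 * l + 2 ^ l))) * (\<Prod>j\<in>?J. rcard (X c j)) \<le> rcard F"
    have "\<forall>j\<in>?J. finite (X c j) \<and> n1 ?J \<le> card (X c j)" using F(1) n10[OF JM] by (meson le_trans)
    then show "has_box ?J (3 * l * 2 ^ l * u) (X c) F"
      using n1[OF JM] F(2,3) unfolding m t_def by blast
  qed
  then show ?thesis using G(1) by blast
qed

subsection \<open>Regular partitions of a blow-up\<close>

text \<open>Each poor part \<open>X\<close> contains fewer than \<open>\<alpha> * rcard X\<close>
  elements of \<open>A\<close>, and the sizes of the parts add up to that of
  \<open>V\<close>.\<close>

lemma card_poor_parts: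
  assumes V: "finite V" "partition_on V P" and \<alpha>: "\<alpha> \<ge> 0" and A: "A \<subseteq> V"
  shows "rcard {v \<in> A. \<exists>X\<in>P. v \<in> X \<and> rcard (X \<inter> A) < \<alpha> * rcard X} \<le> \<alpha> * rcard V"
proof -
  let ?Q = "{X \<in> P. rcard (X \<inter> A) < \<alpha> * rcard X}"
  have finP: "finite P" using V finite_elements by blast
  have finX: "finite X" if "X \<in> P" for X
    using that V by (auto simp: partition_on_def intro: finite_subset[OF Union_upper])
  have "{v \<in> A. \<exists>X\<in>P. v \<in> X \<and> rcard (X \<inter> A) < \<alpha> * rcard X} \<subseteq> (\<Union>X\<in>?Q. X \<inter> A)" by blast
  then have "card {v \<in> A. \<exists>X\<in>P. v \<in> X \<and> rcard (X \<inter> A) < \<alpha> * rcard X} \<le> card (\<Union>X\<in>?Q. X \<inter> A)"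
  proof (intro card_mono)
    have "finite A" using A V(1) by (rule finite_subset)
    then show "finite (\<Union>X\<in>?Q. X \<inter> A)" by (rule rev_finite_subset) blast
  qed
  also have "\<dots> \<le> (\<Sum>X\<in>?Q. card (X \<inter> A))" using finP by (intro card_UN_le) auto
  finally have "rcard {v \<in> A. \<exists>X\<in>P. v \<in> X \<and> rcard (X \<inter> A) < \<alpha> * rcard X} \<le> (\<Sum>X\<in>?Q. rcard (X \<inter> A))"
    by (simp only: of_nat_sum[symmetric] of_nat_le_iff)
  also have "\<dots> \<le> (\<Sum>X\<in>?Q. \<alpha> * rcard X)" by (intro sum_mono) auto
  also have "\<dots> \<le> (\<Sum>X\<in>P. \<alpha> * rcard X)" using finP \<alpha> by (intro sum_mono2) auto
  also have "\<dots> = \<alpha> * real (\<Sum>X\<in>P. card X)" by (simp add: sum_distrib_left)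
  also have "(\<Sum>X\<in>P. card X) = card V"
    using V finX by (metis card_Union_disjoint partition_onD1 partition_onD2 disjoint_def pairwiseI disjnt_def)
  finally show ?thesis .
qed

lemma dens_eq_1:
  assumes "finite X" "finite Y" "finite Z" "X \<noteq> {}" "Y \<noteq> {}" "Z \<noteq> {}"
    and "\<And>x y z. x \<in> X \<Longrightarrow> y \<in> Y \<Longrightarrow> z \<in> Z \<Longrightarrow> {x, y, z} \<in> snd H"
  shows "dens H X Y Z = 1"
proof -
  have "{(x, y, z) \<in> X \<times> Y \<times> Z. {x, y, z} \<in> snd H} = X \<times> Y \<times> Z" using assms by auto
  then show ?thesis using assms by (simp add: dens_def card_cartesian_product)
qed

lemma dens_eq_0:
  assumes "\<And>x y z. x \<in> X \<Longrightarrow> y \<in> Y \<Longrightarrow> z \<in> Z \<Longrightarrow> {x, y, z} \<notin> snd H"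
  shows "dens H X Y Z = 0"
proof -
  have "{(x, y, z) \<in> X \<times> Y \<times> Z. {x, y, z} \<in> snd H} = {}" using assms by auto
  then show ?thesis by (simp only: dens_def card.empty of_nat_0 div_0)
qed

lemma blowupD:
  assumes "blowup H l u D"
  shows "disjoint_family_on D (roles l)"
    and "r \<in> roles l \<Longrightarrow> D r \<subseteq> fst H"
    and "i \<in> {1..l} \<Longrightarrow> card (D (Inl (Inl i))) = 2 ^ l * u"
    and "i \<in> {1..l} \<Longrightarrow> card (D (Inl (Inr i))) = 2 ^ l * u"
    and "S \<in> Pow {1..l} \<Longrightarrow> card (D (Inr S)) = l * u"
    and "i \<in> {1..l} \<Longrightarrow> S \<in> Pow {1..l} \<Longrightarrow> a \<in> D (Inl (Inl i)) \<Longrightarrow> b \<in> D (Inl (Inr i)) \<Longrightarrow> c \<in> D (Inr S) \<Longrightarrow>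
      {a, b, c} \<in> snd H \<longleftrightarrow> i \<in> S"
proof -
  note D = assms[unfolded blowup_def]
  show "disjoint_family_on D (roles l)" by (rule D[THEN conjunct1])
  show "D r \<subseteq> fst H" if "r \<in> roles l" by (rule bspec[OF D[THEN conjunct2, THEN conjunct1] that])
  show "card (D (Inl (Inl i))) = 2 ^ l * u" if "i \<in> {1..l}"
    by (rule bspec[OF D[THEN conjunct2, THEN conjunct2, THEN conjunct1] that, THEN conjunct1])
  show "card (D (Inl (Inr i))) = 2 ^ l * u" if "i \<in> {1..l}"
    by (rule bspec[OF D[THEN conjunct2, THEN conjunct2, THEN conjunct1] that, THEN conjunct2])
  show "card (D (Inr S)) = l * u" if "S \<in> Pow {1..l}"
    by (rule bspec[OF D[THEN conjunct2, THEN conjunct2, THEN conjunct2, THEN conjunct1] that])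
  show "{a, b, c} \<in> snd H \<longleftrightarrow> i \<in> S"
    if "i \<in> {1..l}" "S \<in> Pow {1..l}" "a \<in> D (Inl (Inl i))" "b \<in> D (Inl (Inr i))" "c \<in> D (Inr S)"
    by (rule bspec[OF bspec[OF bspec[OF bspec[OF bspec[OF
      D[THEN conjunct2, THEN conjunct2, THEN conjunct2, THEN conjunct2] that(1)] that(2)] that(3)] that(4)] that(5)])
qed

lemma card_blowup:
  assumes "blowup H l u D" "finite (fst H)"
  shows "card (\<Union>r\<in>roles l. D r) = 3 * l * 2 ^ l * u"
proof -
  note D = blowupD[OF assms(1)]
  have finR: "finite (roles l)" by (simp add: roles_def)
  have "card (\<Union>r\<in>roles l. D r) = (\<Sum>r\<in>roles l. card (D r))"
  proof (rule card_UN_disjoint[OF finR])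
    show "\<forall>r\<in>roles l. finite (D r)" using D(2) assms(2) finite_subset by blast
    show "\<forall>r\<in>roles l. \<forall>r'\<in>roles l. r \<noteq> r' \<longrightarrow> D r \<inter> D r' = {}"
      using D(1) unfolding disjoint_family_on_def by blast
  qed
  also have "\<dots> = (\<Sum>i\<in>{1..l}. card (D (Inl (Inl i)))) + (\<Sum>i\<in>{1..l}. card (D (Inl (Inr i)))) + (\<Sum>S\<in>Pow {1..l}. card (D (Inr S)))"
    unfolding roles_def by (simp add: sum.Plus)
  also have "\<dots> = (\<Sum>i\<in>{1..l}. 2 ^ l * u) + (\<Sum>i\<in>{1..l}. 2 ^ l * u) + (\<Sum>S\<in>Pow {1..l}. l * u)"
    using D(3-5) by (intro arg_cong2[of _ _ _ _ "(+)"] sum.cong refl)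
  also have "\<dots> = 3 * l * 2 ^ l * u" by (simp add: card_Pow algebra_simps)
  finally show ?thesis .
qed

text \<open>Let \<open>m\<close> be the common size of the three unions. At least half of the
  \<open>m\<close> vertices in the classes \<open>C S\<close> lie in parts \<open>Z\<close> that,
  for every \<open>i\<close>, form a regular triple with a part rich in \<open>A i\<close> and a
  part rich in \<open>B i\<close>. Such a \<open>Z\<close> contains at most \<open>2 * l * u\<close>
  vertices of the classes, twice the size of a single class, so there are at least
  \<open>2 ^ l / 4\<close> parts.\<close>

lemma blowup_parts:
  assumes bl: "blowup H l u D" and V: "fst H = (\<Union>r\<in>roles l. D r)" and H3: "is_3graph H"
    and l: "l \<ge> 1" "u \<ge> 1" and e: "0 < e" "192 * real l ^ 3 * e \<le> 1"
    and reg: "reg_partition e H P"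
  shows "2 ^ l \<le> 4 * card P"
proof -
  let ?V = "fst H"
  define A where "A i = D (Inl (Inl i))" for i
  define B where "B i = D (Inl (Inr i))" for i
  define C where "C S = D (Inr S)" for S
  define CC where "CC = (\<Union>S\<in>Pow {1..l}. C S)"
  define m where "m = l * 2 ^ l * u"
  have rA: "Inl (Inl i) \<in> roles l" "Inl (Inr i) \<in> roles l" if "i \<in> {1..l}" for i
    using that by (auto simp: roles_def)
  have rC: "Inr S \<in> roles l" if "S \<in> Pow {1..l}" for S using that by (auto simp: roles_def)
  have finV: "finite ?V" using H3 by (simp add: is_3graph_def)
  have dis: "D r \<inter> D r' = {}" if "r \<in> roles l" "r' \<in> roles l" "r \<noteq> r'" for r r'
    using blowupD(1)[OF bl] that unfolding disjoint_family_on_def by blast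
  have sub: "D r \<subseteq> ?V" if "r \<in> roles l" for r using V that by blast
  have AV: "A i \<subseteq> ?V" "B i \<subseteq> ?V" if "i \<in> {1..l}" for i
    using sub[OF rA(1)[OF that]] sub[OF rA(2)[OF that]] by (auto simp: A_def B_def)
  have CV: "C S \<subseteq> ?V" if "S \<in> Pow {1..l}" for S using sub[OF rC[OF that]] by (simp add: C_def)
  have CCV: "CC \<subseteq> ?V" using CV by (auto simp: CC_def)
  have cA: "card (A i) = 2 ^ l * u" "card (B i) = 2 ^ l * u" if "i \<in> {1..l}" for i
    using blowupD(3,4)[OF bl that] by (simp_all add: A_def B_def)
  have cC: "card (C S) = l * u" if "S \<in> Pow {1..l}" for S
    using blowupD(5)[OF bl that] by (simp add: C_def)
  have edge: "{a, b, c} \<in> snd H \<longleftrightarrow> i \<in> S"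
    if "i \<in> {1..l}" "S \<in> Pow {1..l}" "a \<in> A i" "b \<in> B i" "c \<in> C S" for i S a b c
    using blowupD(6)[OF bl that(1,2)] that(3-5) unfolding A_def B_def C_def by blast
  have finC: "finite (C S)" if "S \<in> Pow {1..l}" for S using CV[OF that] finV finite_subset by blast
  have cCC: "card CC = m"
  proof -
    have "card CC = (\<Sum>S\<in>Pow {1..l}. card (C S))"
      unfolding CC_def using finC dis rC by (intro card_UN_disjoint) (auto simp: C_def)
    also have "\<dots> = m" using cC by (simp add: card_Pow m_def)
    finally show ?thesis .
  qed
  have cV: "card ?V = 3 * l * 2 ^ l * u" unfolding V using bl finV by (rule card_blowup)
  have rV: "rcard ?V = 3 * real m" using cV by (simp add: m_def)
  have m: "real m > 0" using l by (simp add: m_def)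
  have lr: "real l \<ge> 1" using l by simp
  have el: "192 * e * real l \<le> 1" "192 * e \<le> 1"
  proof -
    have "real l ^ 3 \<ge> real l" using lr power_increasing[of 1 3 "real l"] by simp
    then have "e * real l \<le> e * real l ^ 3" using e by (intro mult_left_mono) auto
    then show 1: "192 * e * real l \<le> 1" using e(2) by (simp add: mult_ac)
    have "e * 1 \<le> e * real l" using e lr by (intro mult_left_mono) auto
    then show "192 * e \<le> 1" using 1 by simp
  qed
  have part: "partition_on ?V P" using reg by (simp add: reg_partition_def good_partition_def)
  have finP: "finite P" using part finV finite_elements by blast
  have XV: "X \<subseteq> ?V" "finite X" "X \<noteq> {}" if "X \<in> P" for X
    using that part finV by (auto simp: partition_on_def intro: finite_subset)
  \<comment> \<open>Poor parts hide at most \<open>\<alpha> * (3 * m)\<close> vertices of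
    \<open>A i\<close>, a quarter of its \<open>m / l\<close> vertices; likewise for
    \<open>B i\<close>.\<close>
  define \<alpha> where "\<alpha> = 1 / (12 * real l)"
  define okA where "okA i X \<longleftrightarrow> X \<in> P \<and> \<alpha> * rcard X \<le> rcard (X \<inter> A i)" for i X
  define okB where "okB i X \<longleftrightarrow> X \<in> P \<and> \<alpha> * rcard X \<le> rcard (X \<inter> B i)" for i X
  define goodZ where "goodZ i Z \<longleftrightarrow> (\<exists>X Y. okA i X \<and> okB i Y \<and> reg_triple e H X Y Z)" for i Z
  define NR where "NR = {(x, y, z) \<in> ?V \<times> ?V \<times> ?V. \<exists>X\<in>P. \<exists>Y\<in>P. \<exists>Z\<in>P. x \<in> X \<and> y \<in> Y \<and> z \<in> Z \<and> \<not> reg_triple e H X Y Z}"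
  have finV3: "finite (?V \<times> ?V \<times> ?V)" using finV by simp
  have finNR: "finite NR" unfolding NR_def by (rule finite_subset[OF _ finV3]) auto
  have cNR: "rcard NR \<le> 27 * e * real m ^ 3"
  proof -
    let ?G = "\<Union>{X \<times> Y \<times> Z | X Y Z. X \<in> P \<and> Y \<in> P \<and> Z \<in> P \<and> reg_triple e H X Y Z}"
    have G: "(1 - e) * rcard ?V ^ 3 \<le> rcard ?G"
      using reg by (simp add: reg_partition_def good_partition_def)
    have GV: "?G \<subseteq> ?V \<times> ?V \<times> ?V" using XV(1) by blast
    have disj: "?G \<inter> NR = {}"
    proof (rule ccontr)
      assume "?G \<inter> NR \<noteq> {}"
      then obtain x y z X Y Z X' Y' Z' where h: "X \<in> P" "Y \<in> P" "Z \<in> P" "reg_triple e H X Y Z"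
        "x \<in> X" "y \<in> Y" "z \<in> Z" "X' \<in> P" "Y' \<in> P" "Z' \<in> P" "\<not> reg_triple e H X' Y' Z'"
        "x \<in> X'" "y \<in> Y'" "z \<in> Z'" unfolding NR_def by blast
      have "X = X'" "Y = Y'" "Z = Z'" using h part unfolding partition_on_def disjoint_def by blast+
      then show False using h by simp
    qed
    have NRV: "NR \<subseteq> ?V \<times> ?V \<times> ?V" by (auto simp: NR_def)
    have "card ?G + card NR = card (?G \<union> NR)"
      by (rule card_Un_disjoint[OF finite_subset[OF GV finV3] finNR disj, symmetric])
    also have "\<dots> \<le> card (?V \<times> ?V \<times> ?V)" by (rule card_mono[OF finV3 Un_least[OF GV NRV]])
    finally have "card ?G + card NR \<le> card (?V \<times> ?V \<times> ?V)" .
    then have "rcard ?G + rcard NR \<le> rcard ?V ^ 3"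
      by (simp add: card_cartesian_product power3_eq_cube flip: of_nat_mult of_nat_add)
    then have "rcard NR \<le> e * rcard ?V ^ 3" using G by (simp add: algebra_simps)
    then show ?thesis by (simp add: rV power_mult_distrib)
  qed
  have rich: "3 / 4 * (real m / real l) \<le> rcard {a \<in> F. \<exists>X\<in>P. a \<in> X \<and> \<alpha> * rcard X \<le> rcard (X \<inter> F)}"
    if F: "F \<subseteq> ?V" "card F = 2 ^ l * u" for F
  proof -
    let ?bad = "{v \<in> F. \<exists>X\<in>P. v \<in> X \<and> rcard (X \<inter> F) < \<alpha> * rcard X}"
    let ?ok = "{a \<in> F. \<exists>X\<in>P. a \<in> X \<and> \<alpha> * rcard X \<le> rcard (X \<inter> F)}"
    have "rcard ?bad \<le> \<alpha> * rcard ?V"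
      using card_poor_parts[OF finV part _ F(1), of \<alpha>] by (simp add: \<alpha>_def)
    also have "\<dots> = 1 / 4 * (real m / real l)" unfolding rV \<alpha>_def by simp
    finally have b: "rcard ?bad \<le> 1 / 4 * (real m / real l)" .
    have finF: "finite F" using F finV finite_subset by blast
    have "F \<subseteq> ?ok \<union> ?bad"
    proof
      fix v assume v: "v \<in> F"
      then obtain X where "X \<in> P" "v \<in> X" using F(1) part by (auto simp: partition_on_def)
      then show "v \<in> ?ok \<union> ?bad" using v by (cases "\<alpha> * rcard X \<le> rcard (X \<inter> F)") (auto simp: not_le)
    qed
    then have "card F \<le> card (?ok \<union> ?bad)" using finF by (intro card_mono) auto
    also have "\<dots> \<le> card ?ok + card ?bad" by (rule card_Un_le)
    finally have "rcard F \<le> rcard ?ok + rcard ?bad" by simp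
    moreover have "rcard F = real m / real l" using F(2) l by (simp add: m_def)
    ultimately show ?thesis using b by linarith
  qed
  \<comment> \<open>A vertex in a part failing at \<open>i\<close> forms a non-regular triple with
    all rich vertices of \<open>A i\<close> and \<open>B i\<close>, at least three quarters of each.
    Comparison with \<open>27 * e * real m ^ 3\<close> leaves at most
    \<open>48 * e * l ^ 2 * m\<close> such vertices. As 192 = 4 * 48, the hypothesis turns this into
    \<open>m / (4 * l)\<close>, so all \<open>i\<close> together lose at most a quarter of
    \<open>CC\<close>.\<close>
  have notgood: "rcard {c \<in> CC. \<exists>Z\<in>P. c \<in> Z \<and> \<not> goodZ i Z} \<le> real m / (4 * real l)" if i: "i \<in> {1..l}" for i
  proof -
    let ?N = "{c \<in> CC. \<exists>Z\<in>P. c \<in> Z \<and> \<not> goodZ i Z}"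
    let ?a = "{a \<in> A i. \<exists>X\<in>P. a \<in> X \<and> \<alpha> * rcard X \<le> rcard (X \<inter> A i)}"
    let ?b = "{a \<in> B i. \<exists>X\<in>P. a \<in> X \<and> \<alpha> * rcard X \<le> rcard (X \<inter> B i)}"
    have "?a \<times> ?b \<times> ?N \<subseteq> NR"
    proof
      fix t assume "t \<in> ?a \<times> ?b \<times> ?N"
      then obtain a b c X Y Z where t: "t = (a, b, c)" "a \<in> A i" "b \<in> B i" "c \<in> CC" "X \<in> P" "a \<in> X"
        "\<alpha> * rcard X \<le> rcard (X \<inter> A i)" "Y \<in> P" "b \<in> Y"
        "\<alpha> * rcard Y \<le> rcard (Y \<inter> B i)" "Z \<in> P" "c \<in> Z" "\<not> goodZ i Z" by blast
      have "\<not> reg_triple e H X Y Z" using t unfolding goodZ_def okA_def okB_def by blast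
      moreover have "a \<in> ?V" "b \<in> ?V" "c \<in> ?V" using t AV[OF i] CCV by blast+
      ultimately show "t \<in> NR" unfolding NR_def t(1) using t by blast
    qed
    then have "card (?a \<times> ?b \<times> ?N) \<le> card NR" using finNR by (intro card_mono)
    then have "rcard ?a * (rcard ?b * rcard ?N) \<le> rcard NR"
      by (simp add: card_cartesian_product flip: of_nat_mult)
    moreover have "(3 / 4 * (real m / real l)) * ((3 / 4 * (real m / real l)) * rcard ?N) \<le>
        rcard ?a * (rcard ?b * rcard ?N)"
      using rich[OF AV(1)[OF i] cA(1)[OF i]] rich[OF AV(2)[OF i] cA(2)[OF i]] m lr
      by (intro mult_mono) auto
    ultimately have "(3 / 4 * (real m / real l)) * ((3 / 4 * (real m / real l)) * rcard ?N) \<le> 27 * e * real m ^ 3"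
      using cNR by linarith
    then have "real m ^ 2 * rcard ?N \<le> real m ^ 2 * (48 * e * real l ^ 2 * real m)"
      using lr by (simp add: field_simps power2_eq_square power3_eq_cube)
    then have "rcard ?N \<le> 48 * e * real l ^ 2 * real m" using m by (simp add: mult_le_cancel_left)
    also have "\<dots> \<le> real m / (4 * real l)"
    proof -
      have "real m * (192 * real l ^ 3 * e) \<le> real m * 1" using e(2) m by (intro mult_left_mono) auto
      then show ?thesis using lr by (simp add: field_simps power2_eq_square power3_eq_cube)
    qed
    finally show ?thesis .
  qed
  \<comment> \<open>The share \<open>1 / 12\<close> of parts in a vertex set of size
    \<open>3 * m\<close> loses a further quarter of \<open>CC\<close>, so half of it
    remains.\<close>
  define PZ where "PZ = {Z \<in> P. (\<forall>i\<in>{1..l}. goodZ i Z) \<and> 1 / 12 * rcard Z \<le> rcard (Z \<inter> CC)}"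
  have covered: "real m / 2 \<le> rcard (\<Union>Z\<in>PZ. Z \<inter> CC)"
  proof -
    let ?N = "\<lambda>i. {c \<in> CC. \<exists>Z\<in>P. c \<in> Z \<and> \<not> goodZ i Z}"
    let ?p = "{v \<in> CC. \<exists>X\<in>P. v \<in> X \<and> rcard (X \<inter> CC) < 1 / 12 * rcard X}"
    have finCC: "finite CC" using CCV finV finite_subset by blast
    have "CC \<subseteq> (\<Union>Z\<in>PZ. Z \<inter> CC) \<union> (?p \<union> (\<Union>i\<in>{1..l}. ?N i))"
    proof
      fix c assume c: "c \<in> CC"
      then obtain Z where Z: "Z \<in> P" "c \<in> Z" using CCV part by (auto simp: partition_on_def)
      show "c \<in> (\<Union>Z\<in>PZ. Z \<inter> CC) \<union> (?p \<union> (\<Union>i\<in>{1..l}. ?N i))"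
      proof (cases "Z \<in> PZ")
        case True then show ?thesis using c Z by blast
      next
        case False
        then have "(\<exists>i\<in>{1..l}. \<not> goodZ i Z) \<or> rcard (Z \<inter> CC) < 1 / 12 * rcard Z"
          using Z by (auto simp: PZ_def not_le)
        then show ?thesis using c Z by blast
      qed
    qed
    then have "card CC \<le> card ((\<Union>Z\<in>PZ. Z \<inter> CC) \<union> (?p \<union> (\<Union>i\<in>{1..l}. ?N i)))"
      using finCC finP by (intro card_mono) (auto simp: PZ_def)
    also have "\<dots> \<le> card (\<Union>Z\<in>PZ. Z \<inter> CC) + (card ?p + card (\<Union>i\<in>{1..l}. ?N i))"
      by (intro order_trans[OF card_Un_le] add_mono order_refl)
    also have "card (\<Union>i\<in>{1..l}. ?N i) \<le> (\<Sum>i\<in>{1..l}. card (?N i))" by (intro card_UN_le) simp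
    finally have "real m \<le> rcard (\<Union>Z\<in>PZ. Z \<inter> CC) + (rcard ?p + (\<Sum>i\<in>{1..l}. rcard (?N i)))"
      unfolding cCC by (simp only: of_nat_add[symmetric] of_nat_sum[symmetric] of_nat_le_iff)
    moreover have "rcard ?p \<le> real m / 4"
      using card_poor_parts[OF finV part _ CCV, of "1 / 12"] rV by simp
    moreover have "(\<Sum>i\<in>{1..l}. rcard (?N i)) \<le> real m / 4"
    proof -
      have "(\<Sum>i\<in>{1..l}. rcard (?N i)) \<le> of_nat (card {1..l}) * (real m / (4 * real l))"
        by (intro sum_bounded_above notgood)
      then show ?thesis using lr by simp
    qed
    ultimately show ?thesis by linarith
  qed
  have small: "rcard (Z \<inter> CC) \<le> 2 * real (l * u)" if Z: "Z \<in> PZ" for Z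
  proof -
    have ZP: "Z \<in> P" using Z by (simp add: PZ_def)
    have finZ: "finite Z" using XV ZP by blast
    have zpos: "rcard Z > 0" using XV[OF ZP] by (simp add: card_gt_0_iff)
    define Zp where "Zp i = (\<Union>S\<in>{S \<in> Pow {1..l}. i \<in> S}. Z \<inter> C S)" for i
    define Zm where "Zm i = (\<Union>S\<in>{S \<in> Pow {1..l}. i \<notin> S}. Z \<inter> C S)" for i
    have ZpZ: "Zp i \<subseteq> Z" "Zm i \<subseteq> Z" for i by (auto simp: Zp_def Zm_def)
    have finZp: "finite (Zp i)" "finite (Zm i)" for i
      by (rule finite_subset[OF ZpZ(1) finZ], rule finite_subset[OF ZpZ(2) finZ])
    \<comment> \<open>Otherwise both pieces are large enough to test regularity against the rich
      parts, with densities 1 and 0.\<close>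
    have one: "rcard (Zp i) < e * rcard Z \<or> rcard (Zm i) < e * rcard Z"
      if i: "i \<in> {1..l}" for i
    proof (rule ccontr)
      assume "\<not> ?thesis"
      then have big: "e * rcard Z \<le> rcard (Zp i)" "e * rcard Z \<le> rcard (Zm i)" by auto
      obtain X Y where XY: "okA i X" "okB i Y" "reg_triple e H X Y Z"
      proof -
        have "goodZ i Z" using Z i unfolding PZ_def by blast
        then show thesis using that unfolding goodZ_def by blast
      qed
      have e\<alpha>: "e \<le> \<alpha>" using el(1) lr e by (simp add: \<alpha>_def field_simps)
      have \<alpha>0: "\<alpha> > 0" using lr by (simp add: \<alpha>_def)
      have XP: "X \<in> P" "Y \<in> P" using XY by (auto simp: okA_def okB_def)
      have cX: "rcard X > 0" "rcard Y > 0" using XV[OF XP(1)] XV[OF XP(2)] by (simp_all add: card_gt_0_iff)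
      have XA: "e * rcard X \<le> rcard (X \<inter> A i)" "e * rcard Y \<le> rcard (Y \<inter> B i)"
        using XY(1,2) mult_right_mono[OF e\<alpha>, of "rcard X"] mult_right_mono[OF e\<alpha>, of "rcard Y"]
        by (auto simp: okA_def okB_def)
      have pos: "e * rcard X > 0" "e * rcard Y > 0" "e * rcard Z > 0" using e cX zpos by simp_all
      then have ne: "X \<inter> A i \<noteq> {}" "Y \<inter> B i \<noteq> {}" "Zp i \<noteq> {}"
        using XA big by (metis card.empty of_nat_0 not_le)+
      have "dens H (X \<inter> A i) (Y \<inter> B i) (Zp i) = 1"
      proof (rule dens_eq_1)
        fix x y z assume "x \<in> X \<inter> A i" "y \<in> Y \<inter> B i" "z \<in> Zp i"
        then obtain S where "S \<in> Pow {1..l}" "i \<in> S" "x \<in> A i" "y \<in> B i" "z \<in> C S" unfolding Zp_def by blast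
        then show "{x, y, z} \<in> snd H" using edge[OF i, of S x y z] by simp
      qed (use ne XV[OF XP(1)] XV[OF XP(2)] finZp in auto)
      moreover have "dens H (X \<inter> A i) (Y \<inter> B i) (Zm i) = 0"
      proof (rule dens_eq_0)
        fix x y z assume "x \<in> X \<inter> A i" "y \<in> Y \<inter> B i" "z \<in> Zm i"
        then obtain S where "S \<in> Pow {1..l}" "i \<notin> S" "x \<in> A i" "y \<in> B i" "z \<in> C S" unfolding Zm_def by blast
        then show "{x, y, z} \<notin> snd H" using edge[OF i, of S x y z] by simp
      qed
      moreover have "\<bar>dens H X Y Z - dens H (X \<inter> A i) (Y \<inter> B i) (Zp i)\<bar> \<le> e"
        using XA big(1) ZpZ(1) by (intro XY(3)[unfolded reg_triple_def, rule_format] conjI) auto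
      moreover have "\<bar>dens H X Y Z - dens H (X \<inter> A i) (Y \<inter> B i) (Zm i)\<bar> \<le> e"
        using XA big(2) ZpZ(2) by (intro XY(3)[unfolded reg_triple_def, rule_format] conjI) auto
      ultimately have "1 \<le> 2 * e" by linarith
      then show False using el(2) by linarith
    qed
    \<comment> \<open>\<open>C S0\<close> is the only class that can dominate \<open>Z\<close>: for
      \<open>S \<noteq> S0\<close> the two index sets differ at some \<open>i\<close>, and then a
      vertex of \<open>Z\<close> in \<open>C S\<close> lies in the minority piece
      \<open>W i\<close>, of size at most \<open>e * rcard Z\<close>.\<close>
    define S0 where "S0 = {i \<in> {1..l}. rcard (Zm i) < e * rcard Z}"
    define W where "W i = (if i \<in> S0 then Zm i else Zp i)" for i
    have cW: "rcard (W i) \<le> e * rcard Z" if "i \<in> {1..l}" for i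
      using one[OF that] that by (auto simp: W_def S0_def)
    have S0: "S0 \<in> Pow {1..l}" by (auto simp: S0_def)
    have "Z \<inter> CC \<subseteq> C S0 \<union> (\<Union>i\<in>{1..l}. W i)"
    proof
      fix z assume z: "z \<in> Z \<inter> CC"
      then obtain S where S: "S \<in> Pow {1..l}" "z \<in> C S" by (auto simp: CC_def)
      show "z \<in> C S0 \<union> (\<Union>i\<in>{1..l}. W i)"
      proof (cases "S = S0")
        case False
        then obtain i where i: "i \<in> {1..l}" "i \<in> S \<longleftrightarrow> i \<notin> S0" using S S0 by blast
        then have "z \<in> W i" using z S by (auto simp: W_def Zm_def Zp_def)
        then show ?thesis using i by blast
      qed (use S in simp)
    qed
    then have "card (Z \<inter> CC) \<le> card (C S0 \<union> (\<Union>i\<in>{1..l}. W i))"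
      using finC[OF S0] finZp by (intro card_mono) (auto simp: W_def)
    also have "\<dots> \<le> card (C S0) + (\<Sum>i\<in>{1..l}. card (W i))"
      by (rule order_trans[OF card_Un_le add_left_mono[OF card_UN_le]]) simp
    finally have "rcard (Z \<inter> CC) \<le> real (l * u) + (\<Sum>i\<in>{1..l}. rcard (W i))"
      unfolding cC[OF S0] by (simp only: of_nat_add[symmetric] of_nat_sum[symmetric] of_nat_le_iff)
    also have "(\<Sum>i\<in>{1..l}. rcard (W i)) \<le> of_nat (card {1..l}) * (e * rcard Z)"
      using cW by (intro sum_bounded_above)
    also have "of_nat (card {1..l}) * (e * rcard Z) \<le> 1 / 2 * rcard (Z \<inter> CC)"
    proof -
      have "rcard Z \<le> 12 * rcard (Z \<inter> CC)" using Z by (simp add: PZ_def)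
      then have "(e * real l) * rcard Z \<le> (1 / 192) * (12 * rcard (Z \<inter> CC))"
        using el(1) e lr by (intro mult_mono) auto
      then show ?thesis by (simp add: mult_ac)
    qed
    finally show ?thesis by simp
  qed
  have finPZ: "finite PZ" using finP by (simp add: PZ_def)
  have "card (\<Union>Z\<in>PZ. Z \<inter> CC) \<le> (\<Sum>Z\<in>PZ. card (Z \<inter> CC))" by (rule card_UN_le[OF finPZ])
  then have "rcard (\<Union>Z\<in>PZ. Z \<inter> CC) \<le> (\<Sum>Z\<in>PZ. rcard (Z \<inter> CC))"
    by (simp only: of_nat_sum[symmetric] of_nat_le_iff)
  also have "\<dots> \<le> of_nat (card PZ) * (2 * real (l * u))" using small by (intro sum_bounded_above)
  also have "\<dots> \<le> rcard P * (2 * real (l * u))"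
    using finP by (intro mult_right_mono) (auto simp: PZ_def intro!: card_mono)
  finally have "real m / 2 \<le> rcard P * (2 * real (l * u))" using covered by linarith
  then have "real (2 ^ l) * real (l * u) \<le> real (4 * card P) * real (l * u)" by (simp add: m_def mult_ac)
  then have "real (2 ^ l) \<le> real (4 * card P)"
    by (rule mult_right_le_imp_le) (use l in simp)
  then show ?thesis by (simp only: of_nat_le_iff)
qed

text \<open>For any candidate \<open>M\<close> with threshold \<open>N\<close>, the blow-up with
  \<open>u = N + 1\<close> spans an induced subgraph on more than \<open>N\<close> vertices, which
  stays in the property by heredity; so \<open>blowup_parts\<close> bounds \<open>M\<close>.\<close>

lemma M_reg_ge:
  assumes k: "k \<ge> 1" and H: "hereditary3 \<H>" "kU k \<notin> TripClass \<H>" and far: "far_from_finite_VC \<H>"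
    and l: "l \<ge> 1" and e: "0 < e" "192 * real l ^ 3 * e \<le> 1"
  shows "ereal (2 ^ l / 4) \<le> M_reg \<H> e"
  unfolding M_reg_def
proof (rule Inf_greatest)
  fix x assume "x \<in> {ereal (real M) | M. \<exists>N. \<forall>H\<in>\<H>. N \<le> card (fst H) \<longrightarrow> (\<exists>P. reg_partition e H P \<and> card P \<le> M)}"
  then obtain M N where M: "x = ereal (real M)"
    "\<And>G. G \<in> \<H> \<Longrightarrow> N \<le> card (fst G) \<Longrightarrow> \<exists>P. reg_partition e G P \<and> card P \<le> M" by blast
  obtain G D where G: "G \<in> \<H>" "blowup G l (N + 1) D"
    using far_imp_blowup[OF k H far l, of "N + 1"] by auto
  define W where "W = (\<Union>r\<in>roles l. D r)"
  define G' where "G' = induced3 G W"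
  have WV: "W \<subseteq> fst G" using blowupD(2)[OF G(2)] unfolding W_def by blast
  have G': "G' \<in> \<H>" using H(1) G(1) WV unfolding hereditary3_def G'_def by blast
  have fst': "fst G' = (\<Union>r\<in>roles l. D r)" by (simp add: G'_def W_def induced3_def)
  have bl: "blowup G' l (N + 1) D"
    unfolding blowup_def
  proof (intro conjI)
    show "disjoint_family_on D (roles l)" "\<forall>i\<in>{1..l}. card (D (Inl (Inl i))) = 2 ^ l * (N + 1) \<and> card (D (Inl (Inr i))) = 2 ^ l * (N + 1)"
      "\<forall>S\<in>Pow {1..l}. card (D (Inr S)) = l * (N + 1)"
      using blowupD(1,3,4,5)[OF G(2)] by simp_all
    show "\<forall>r\<in>roles l. D r \<subseteq> fst G'" using fst' by blast
    show "\<forall>i\<in>{1..l}. \<forall>S\<in>Pow {1..l}. \<forall>a\<in>D (Inl (Inl i)). \<forall>b\<in>D (Inl (Inr i)). \<forall>c\<in>D (Inr S).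
        ({a, b, c} \<in> snd G') = (i \<in> S)"
    proof (intro ballI)
      fix i S a b c assume h: "i \<in> {1..l}" "S \<in> Pow {1..l}" "a \<in> D (Inl (Inl i))" "b \<in> D (Inl (Inr i))" "c \<in> D (Inr S)"
      have "Inl (Inl i) \<in> roles l" "Inl (Inr i) \<in> roles l" "Inr S \<in> roles l" using h by (auto simp: roles_def)
      then have "{a, b, c} \<subseteq> W" using h unfolding W_def by blast
      then have "{a, b, c} \<in> snd G' \<longleftrightarrow> {a, b, c} \<in> snd G" by (simp add: G'_def induced3_def)
      also have "\<dots> \<longleftrightarrow> i \<in> S" using blowupD(6)[OF G(2) h] .
      finally show "({a, b, c} \<in> snd G') = (i \<in> S)" .
    qed
  qed
  have G3: "is_3graph G'" using G' H(1) by (simp add: hereditary3_def)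
  have finG: "finite (fst G')" using G3 by (simp add: is_3graph_def)
  have cG: "card (fst G') = 3 * l * 2 ^ l * (N + 1)" using card_blowup[OF bl finG] unfolding fst'[symmetric] .
  have "1 * (N + 1) \<le> (3 * l * 2 ^ l) * (N + 1)" using l by (intro mult_le_mono1) (simp add: Suc_le_eq)
  then have "N + 1 \<le> card (fst G')" unfolding cG by (simp only: mult_1)
  then have "N \<le> card (fst G')" by simp
  then obtain P where P: "reg_partition e G' P" "card P \<le> M" using M(2)[OF G'] by blast
  have "2 ^ l \<le> 4 * card P" using blowup_parts[OF bl fst' G3 l _ e P(1)] by simp
  then have "(2 ^ l :: nat) \<le> 4 * M" using P(2) by linarith
  then have "real (2 ^ l) \<le> real (4 * M)" by (simp only: of_nat_le_iff)
  then show "ereal (2 ^ l / 4) \<le> x" using M(1) by simp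
qed

subsection \<open>Homogeneous partitions are regular\<close>

text \<open>The minority kind of triples, edges or non-edges, has share below
  \<open>e ^ 4 / 2\<close>. A sub-box whose sides have share at least \<open>e\<close> has volume
  share at least \<open>e ^ 3\<close>, so the minority share in it is at most \<open>e / 2\<close>,
  and both densities are within \<open>e\<close> of the same end of the unit interval. For
  \<open>e > 1\<close> any two densities are close enough.\<close>

lemma reg_triple_if_hom_triple:
  assumes fin: "finite X" "finite Y" "finite Z" and ne: "X \<noteq> {}" "Y \<noteq> {}" "Z \<noteq> {}"
    and e: "0 < e" and hom: "hom_triple (e ^ 4 / 2) H X Y Z"
  shows "reg_triple e H X Y Z"
proof -
  define cnt where "cnt b X Y Z = rcard {(x, y, z) \<in> X \<times> Y \<times> Z. ({x, y, z} \<in> snd H) = b}" for b X Y Z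
  define vol where "vol X Y Z = rcard X * rcard Y * rcard Z" for X Y Z :: "nat set"
  have d: "dens H X Y Z = cnt True X Y Z / vol X Y Z" for X Y Z by (simp add: dens_def cnt_def vol_def)
  have split: "cnt True X Y Z + cnt False X Y Z = vol X Y Z" if "finite X" "finite Y" "finite Z" for X Y Z
  proof -
    have fin': "finite (X \<times> Y \<times> Z)" using that by simp
    have "card {(x, y, z) \<in> X \<times> Y \<times> Z. ({x, y, z} \<in> snd H) = True} + card {(x, y, z) \<in> X \<times> Y \<times> Z. ({x, y, z} \<in> snd H) = False}
      = card (X \<times> Y \<times> Z)"
      by (subst card_Un_disjoint[symmetric])
         (auto intro!: arg_cong[of _ _ card] intro: finite_subset[OF _ fin'])
    then show ?thesis unfolding cnt_def vol_def
      by (simp add: card_cartesian_product mult.assoc flip: of_nat_add of_nat_mult)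
  qed
  have vpos: "vol X Y Z > 0" using fin ne by (simp add: vol_def card_gt_0_iff)
  show ?thesis unfolding reg_triple_def
  proof (intro allI impI)
    fix X' Y' Z'
    assume a: "X' \<subseteq> X \<and> Y' \<subseteq> Y \<and> Z' \<subseteq> Z \<and>
        rcard X' \<ge> e * card X \<and> rcard Y' \<ge> e * card Y \<and> rcard Z' \<ge> e * card Z"
    have fin': "finite X'" "finite Y'" "finite Z'" using a fin finite_subset by blast+
    have mono: "cnt b X' Y' Z' \<le> cnt b X Y Z" for b
    proof -
      have "finite {(x, y, z) \<in> X \<times> Y \<times> Z. ({x, y, z} \<in> snd H) = b}"
        by (rule finite_subset[of _ "X \<times> Y \<times> Z"]) (use fin in auto)
      then show ?thesis unfolding cnt_def using a by (intro of_nat_mono card_mono) auto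
    qed
    have nn: "cnt b X Y Z \<ge> 0" for b X Y Z by (simp add: cnt_def)
    have vol': "e ^ 3 * vol X Y Z \<le> vol X' Y' Z'"
    proof -
      have "(e * rcard X) * (e * rcard Y) * (e * rcard Z) \<le> rcard X' * rcard Y' * rcard Z'"
        using a e by (intro mult_mono) auto
      then show ?thesis by (simp add: vol_def power3_eq_cube mult_ac)
    qed
    moreover have "e ^ 3 * vol X Y Z > 0" using e vpos by simp
    ultimately have v'pos: "vol X' Y' Z' > 0" by linarith
    have key: "cnt b X Y Z / vol X Y Z \<le> e \<and> cnt b X' Y' Z' / vol X' Y' Z' \<le> e \<and> 0 \<le> cnt b X Y Z / vol X Y Z \<and> 0 \<le> cnt b X' Y' Z' / vol X' Y' Z'"
      if b: "cnt b X Y Z < e ^ 4 / 2 * vol X Y Z" and le: "e \<le> 1" for b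
    proof -
      have e4: "e ^ 4 / 2 * vol X Y Z = e / 2 * (e ^ 3 * vol X Y Z)" by (simp add: power4_eq_xxxx power3_eq_cube)
      have "cnt b X' Y' Z' \<le> e / 2 * vol X' Y' Z'"
        using b mono[of b] e4 mult_left_mono[OF vol', of "e / 2"] e by linarith
      also have "\<dots> \<le> e * vol X' Y' Z'" using e v'pos by (intro mult_right_mono) auto
      finally have 1: "cnt b X' Y' Z' \<le> e * vol X' Y' Z'" .
      have "e ^ 4 / 2 \<le> e"
      proof -
        have "e ^ 4 \<le> e" using le e power_decreasing[of 1 4 e] by simp
        then show ?thesis using e by linarith
      qed
      then have "e ^ 4 / 2 * vol X Y Z \<le> e * vol X Y Z" using vpos by (intro mult_right_mono) auto
      then have 2: "cnt b X Y Z \<le> e * vol X Y Z" using b by linarith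
      show ?thesis using 1 2 vpos v'pos nn by (simp add: field_simps)
    qed
    have comp: "dens H X Y Z = 1 - cnt False X Y Z / vol X Y Z" "dens H X' Y' Z' = 1 - cnt False X' Y' Z' / vol X' Y' Z'"
      using split[OF fin] split[OF fin'] vpos v'pos unfolding d by (simp_all add: field_simps)
    have bnd: "0 \<le> dens H X Y Z" "dens H X Y Z \<le> 1" "0 \<le> dens H X' Y' Z'" "dens H X' Y' Z' \<le> 1"
    proof -
      show "0 \<le> dens H X Y Z" "0 \<le> dens H X' Y' Z'" using nn vpos v'pos unfolding d by simp_all
      show "dens H X Y Z \<le> 1" "dens H X' Y' Z' \<le> 1" using nn vpos v'pos unfolding comp by simp_all
    qed
    show "\<bar>dens H X Y Z - dens H X' Y' Z'\<bar> \<le> e"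
    proof (cases "e \<le> 1")
      case False then show ?thesis using bnd by linarith
    next
      case True
      from hom consider "dens H X Y Z < e ^ 4 / 2" | "dens H X Y Z > 1 - e ^ 4 / 2" by (auto simp: hom_triple_def)
      then show ?thesis
      proof cases
        case 1
        then have "cnt True X Y Z < e ^ 4 / 2 * vol X Y Z" using vpos unfolding d by (simp add: divide_less_eq)
        from key[OF this True] show ?thesis unfolding d by linarith
      next
        case 2
        then have "cnt False X Y Z / vol X Y Z < e ^ 4 / 2" unfolding comp(1) by linarith
        then have "cnt False X Y Z < e ^ 4 / 2 * vol X Y Z" using vpos by (simp add: divide_less_eq)
        from key[OF this True] show ?thesis unfolding comp by linarith
      qed
    qed
  qed
qed

lemma reg_partition_if_hom_partition:
  assumes H: "is_3graph H" and e: "0 < e" "e \<le> 1" and hom: "hom_partition (e ^ 4 / 2) H P"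
  shows "reg_partition e H P"
proof -
  let ?U = "\<lambda>Q. \<Union>{X \<times> Y \<times> Z | X Y Z. X \<in> P \<and> Y \<in> P \<and> Z \<in> P \<and> Q X Y Z}"
  have part: "partition_on (fst H) P" and big: "(1 - e ^ 4 / 2) * rcard (fst H) ^ 3 \<le> rcard (?U (hom_triple (e ^ 4 / 2) H))"
    using hom by (auto simp: hom_partition_def good_partition_def)
  have finV: "finite (fst H)" using H by (simp add: is_3graph_def)
  have XV: "X \<subseteq> fst H" "finite X" "X \<noteq> {}" if "X \<in> P" for X
    using that part finV by (auto simp: partition_on_def intro: finite_subset)
  have imp: "reg_triple e H X Y Z" if "X \<in> P" "Y \<in> P" "Z \<in> P" "hom_triple (e ^ 4 / 2) H X Y Z" for X Y Z
    using that XV e by (intro reg_triple_if_hom_triple) auto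
  have "?U (hom_triple (e ^ 4 / 2) H) \<subseteq> ?U (reg_triple e H)" using imp by blast
  moreover have "?U (reg_triple e H) \<subseteq> fst H \<times> fst H \<times> fst H" using XV(1) by blast
  then have "finite (?U (reg_triple e H))" by (rule finite_subset) (use finV in simp)
  ultimately have "card (?U (hom_triple (e ^ 4 / 2) H)) \<le> card (?U (reg_triple e H))" by (intro card_mono)
  then have "rcard (?U (hom_triple (e ^ 4 / 2) H)) \<le> rcard (?U (reg_triple e H))" by simp
  moreover have "(1 - e) * rcard (fst H) ^ 3 \<le> (1 - e ^ 4 / 2) * rcard (fst H) ^ 3"
  proof -
    have "e ^ 4 \<le> e" using e power_decreasing[of 1 4 e] by simp
    then show ?thesis using e by (intro mult_right_mono) auto
  qed
  ultimately show ?thesis using part big unfolding reg_partition_def good_partition_def by linarith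
qed

lemma M_reg_le_M_hom:
  assumes "hereditary3 \<H>" "0 < e" "e \<le> 1"
  shows "M_reg \<H> e \<le> M_hom \<H> (e ^ 4 / 2)"
  unfolding M_reg_def M_hom_def
proof (rule Inf_superset_mono, rule subsetI)
  fix x assume "x \<in> {ereal (real M) | M. \<exists>N. \<forall>H\<in>\<H>. card (fst H) \<ge> N \<longrightarrow> (\<exists>P. hom_partition (e ^ 4 / 2) H P \<and> card P \<le> M)}"
  then obtain M N where M: "x = ereal (real M)"
    "\<forall>H\<in>\<H>. card (fst H) \<ge> N \<longrightarrow> (\<exists>P. hom_partition (e ^ 4 / 2) H P \<and> card P \<le> M)" by blast
  have "\<forall>H\<in>\<H>. card (fst H) \<ge> N \<longrightarrow> (\<exists>P. reg_partition e H P \<and> card P \<le> M)"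
  proof (intro ballI impI)
    fix G assume G: "G \<in> \<H>" "N \<le> card (fst G)"
    then obtain P where "hom_partition (e ^ 4 / 2) G P" "card P \<le> M" using M(2) by blast
    moreover have "is_3graph G" using assms(1) G by (simp add: hereditary3_def)
    ultimately show "\<exists>P. reg_partition e G P \<and> card P \<le> M" using reg_partition_if_hom_partition assms by blast
  qed
  then show "x \<in> {ereal (real M) | M. \<exists>N. \<forall>H\<in>\<H>. card (fst H) \<ge> N \<longrightarrow> (\<exists>P. reg_partition e H P \<and> card P \<le> M)}"
    using M(1) by blast
qed

section \<open>Explicit bounds in \<epsilon>\<close>

text \<open>The size of the net is polynomial in \<open>1 / e\<close>, of degree depending on
  \<open>k\<close>. An exponential dominates every polynomial, so the exponent \<open>- 2\<close>
  can be taken independently of \<open>k\<close>.\<close>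

lemma M_hom_upper:
  assumes k: "k \<ge> 1" and H: "hereditary3 \<H>" "kU k \<notin> TripClass \<H>"
  shows "\<exists>e0>0. \<forall>e. 0 < e \<and> e < e0 \<longrightarrow> M_hom \<H> (e ^ 4 / 2) \<le> ereal (2 powr (2 powr (e powr (- 2))))"
proof -
  obtain \<eta>0 where \<eta>0: "\<eta>0 > 0" "\<And>\<eta>::real. 0 < \<eta> \<and> \<eta> < \<eta>0 \<Longrightarrow>
     ample k \<eta> (nat \<lceil>1 / \<eta> ^ 2\<rceil>)"
    using eventually_small_sample[of k] by blast
  \<comment> \<open>With \<open>x = 1 / e\<close>, the power \<open>x ^ (57 * k)\<close> will bound
    \<open>d ^ 3\<close>, \<open>x ^ 27\<close> will bound \<open>1 / \<eta> ^ 3\<close>, and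
    \<open>x ^ 2\<close> absorbs the remaining constant 257.\<close>
  let ?K = "57 * k + 29"
  have "((\<lambda>x::real. x ^ ?K / exp x) \<longlongrightarrow> 0) at_top" by (rule tendsto_power_div_exp_0)
  then have "\<forall>\<^sub>F x in at_top. x ^ ?K / exp x < (1::real)" by (rule order_tendstoD) simp
  then obtain X where X: "\<And>x. x \<ge> X \<Longrightarrow> x ^ ?K / exp x < (1::real)"
    by (auto simp: eventually_at_top_linorder)
  \<comment> \<open>The 84 lets a further factor \<open>x\<close> absorb the constant in
    \<open>1 / \<eta> = 84 * x ^ 8\<close>.\<close>
  define e0 where "e0 = min \<eta>0 (1 / max 84 X)"
  show ?thesis
  proof (intro exI[of _ e0] conjI allI impI)
    show "e0 > 0" using \<eta>0(1) by (simp add: e0_def)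
    fix e :: real assume e: "0 < e \<and> e < e0"
    define x where "x = 1 / e"
    have x: "x > 84" "x > X"
    proof -
      have "e < 1 / max 84 X" using e by (simp add: e0_def)
      then have "max 84 X < 1 / e" using e less_divide_eq[of "max 84 X" 1 e] less_divide_eq[of e 1 "max 84 X"]
        by (simp add: mult.commute less_max_iff_disj)
      then show "x > 84" "x > X" by (auto simp: x_def)
    qed
    have ex: "e = 1 / x" by (simp add: x_def)
    define \<eta> where "\<eta> = e ^ 8 / 84"
    have eta: "0 < \<eta>" "\<eta> < \<eta>0"
    proof -
      show "0 < \<eta>" using e by (simp add: \<eta>_def)
      have "e \<le> 1" using x by (simp add: ex)
      then have "e ^ 8 \<le> e" using e power_decreasing[of 1 8 e] by simp
      then have "\<eta> < e" using e by (simp add: \<eta>_def)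
      then show "\<eta> < \<eta>0" using e by (simp add: e0_def)
    qed
    define s where "s = nat \<lceil>1 / \<eta> ^ 2\<rceil>"
    define d where "d = (s + 1) ^ k"
    have sd: "\<eta> < 1" "s \<ge> 1" "real d ^ 2 * (1 - \<eta>) ^ s \<le> 1 / 2"
      using \<eta>0(2)[of \<eta>] eta unfolding s_def d_def by blast+
    have e21: "21 * \<eta> \<le> (e ^ 4 / 2) ^ 2" by (simp add: \<eta>_def power_divide power_mult[symmetric])
    have "e ^ 4 / 2 > 0" using e by simp
    from M_hom_le[OF k H eta(1) sd(1,2) d_def sd(3) this e21]
    have le: "M_hom \<H> (e ^ 4 / 2) \<le> ereal (2 ^ nat \<lceil>256 * real d ^ 3 / \<eta> ^ 3\<rceil>)" .
    have inv: "1 / \<eta> \<le> x ^ 9"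
    proof -
      have "1 / \<eta> = 84 * x ^ 8" by (simp add: \<eta>_def ex power_divide)
      also have "\<dots> \<le> x * x ^ 8" using x by (intro mult_right_mono) auto
      finally show ?thesis by (simp add: power_Suc[symmetric] del: power_Suc)
    qed
    have x1: "x \<ge> 1" using x by simp
    have s1: "real s + 1 \<le> x ^ 19"
    proof -
      have "1 / \<eta> ^ 2 = (1 / \<eta>) ^ 2" by (simp add: power_divide)
      also have "\<dots> \<le> (x ^ 9) ^ 2" using inv eta by (intro power_mono) auto
      finally have "1 / \<eta> ^ 2 \<le> x ^ 18" by (simp add: power_mult[symmetric])
      moreover have "1 / \<eta> ^ 2 > 0" using eta by simp
      ultimately have "real s + 1 \<le> x ^ 18 + 2" unfolding s_def by linarith
      also have "\<dots> \<le> 3 * x ^ 18" using one_le_power[OF x1, of 18] by linarith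
      also have "\<dots> \<le> x * x ^ 18" using x by (intro mult_right_mono) auto
      finally show ?thesis by (simp add: power_Suc[symmetric] del: power_Suc)
    qed
    have d1: "real d \<le> x ^ (19 * k)"
    proof -
      have "real d = (real s + 1) ^ k" by (simp add: d_def add.commute)
      also have "\<dots> \<le> (x ^ 19) ^ k" using s1 by (intro power_mono) auto
      finally show ?thesis by (simp add: power_mult)
    qed
    have "256 * real d ^ 3 / \<eta> ^ 3 = 256 * real d ^ 3 * (1 / \<eta>) ^ 3" by (simp add: power_divide)
    also have "\<dots> \<le> 256 * (x ^ (19 * k)) ^ 3 * (x ^ 9) ^ 3"
      using d1 inv eta x1 by (intro mult_mono power_mono) auto
    also have "\<dots> = 256 * x ^ (57 * k + 27)" by (simp add: power_mult[symmetric] power_add mult.commute)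
    finally have "256 * real d ^ 3 / \<eta> ^ 3 \<le> 256 * x ^ (57 * k + 27)" .
    moreover have "256 * real d ^ 3 / \<eta> ^ 3 \<ge> 0" using eta by simp
    ultimately have "real (nat \<lceil>256 * real d ^ 3 / \<eta> ^ 3\<rceil>) \<le> 256 * x ^ (57 * k + 27) + 1" by linarith
    also have "\<dots> \<le> 257 * x ^ (57 * k + 27)" using one_le_power[OF x1, of "57 * k + 27"] by linarith
    also have "\<dots> \<le> x ^ 2 * x ^ (57 * k + 27)"
    proof -
      have "84 ^ 2 \<le> x ^ 2" using x by (intro power_mono) auto
      then show ?thesis using x by (intro mult_right_mono) auto
    qed
    also have "\<dots> = x ^ (2 + (57 * k + 27))" by (rule power_add[symmetric])
    also have "2 + (57 * k + 27) = ?K" by simp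
    also have "x ^ ?K \<le> exp x" using X[of x] x by (simp add: field_simps)
    also have "\<dots> = exp 1 powr x" by (simp add: powr_def)
    also have "\<dots> \<le> (2 powr 2) powr x" using exp_le x by (intro powr_mono2) auto
    also have "\<dots> = 2 powr (2 * x)" by (rule powr_powr)
    also have "\<dots> \<le> 2 powr (x ^ 2)" using x by (intro powr_mono) (auto simp: power2_eq_square)
    also have "x ^ 2 = e powr (- 2)" using e by (simp add: x_def powr_minus power_divide field_simps)
    finally have r: "real (nat \<lceil>256 * real d ^ 3 / \<eta> ^ 3\<rceil>) \<le> 2 powr (e powr (- 2))" .
    have "(2::real) ^ nat \<lceil>256 * real d ^ 3 / \<eta> ^ 3\<rceil> = 2 powr real (nat \<lceil>256 * real d ^ 3 / \<eta> ^ 3\<rceil>)"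
      by (simp add: powr_realpow)
    also have "\<dots> \<le> 2 powr (2 powr (e powr (- 2)))" using r by (intro powr_mono) auto
    finally show "M_hom \<H> (e ^ 4 / 2) \<le> ereal (2 powr (2 powr (e powr (- 2))))"
      using le by (meson ereal_less_eq(3) order_trans)
  qed
qed

text \<open>With \<open>y = e powr (- (1 / 8))\<close> and \<open>l\<close> the integer part of
  \<open>y ^ 2\<close>, the condition of \<open>M_reg_ge\<close> holds because
  \<open>192 * l ^ 3 \<le> y ^ 2 * y ^ 6 = 1 / e\<close>; here \<open>y > 14\<close> provides
  \<open>y ^ 2 \<ge> 196\<close>. The gap between \<open>y ^ 2\<close> and \<open>y\<close> absorbs
  rounding and the division by 4.\<close>

lemma M_reg_lower:
  assumes k: "k \<ge> 1" and H: "hereditary3 \<H>" "kU k \<notin> TripClass \<H>" and far: "far_from_finite_VC \<H>"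
    and e: "0 < e" "e < (1 / 14) ^ 8"
  shows "ereal (2 powr (e powr (- (1 / 8)))) \<le> M_reg \<H> e"
proof -
  define y where "y = e powr (- (1 / 8))"
  have y8: "y ^ 8 * e = 1"
  proof -
    have "y ^ 8 = y powr 8" using e by (simp add: y_def powr_realpow[of _ 8, simplified])
    also have "\<dots> = e powr (- 1)" by (simp add: y_def powr_powr)
    finally show ?thesis using e by (simp add: powr_minus)
  qed
  have ypos: "y > 0" using e by (simp add: y_def)
  have y14: "y > 14"
  proof (rule ccontr)
    assume "\<not> y > 14"
    then have "y ^ 8 \<le> 14 ^ 8" using ypos by (intro power_mono) auto
    then have "y ^ 8 * e \<le> 14 ^ 8 * e" using e by (intro mult_right_mono) auto
    also have "\<dots> < 14 ^ 8 * (1 / 14) ^ 8" using e by (intro mult_strict_left_mono) auto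
    also have "(14::real) ^ 8 * (1 / 14) ^ 8 = 1" by (simp add: power_divide)
    finally show False using y8 by simp
  qed
  define l where "l = nat \<lfloor>y ^ 2\<rfloor>"
  have y2: "14 * y \<le> y ^ 2" "y ^ 2 \<ge> 196"
    using y14 mult_mono[of 14 y 14 y] by (auto simp: power2_eq_square)
  have l: "real l \<le> y ^ 2" "y ^ 2 \<le> real l + 1" "l \<ge> 1"
    using y2 unfolding l_def by linarith+
  have "real l ^ 3 \<le> (y ^ 2) ^ 3" using l by (intro power_mono) auto
  then have "192 * real l ^ 3 \<le> y ^ 2 * (y ^ 2) ^ 3" using y2 by (intro mult_mono) auto
  also have "\<dots> = y ^ 8" by (simp add: power_mult[symmetric] power_add[symmetric])
  finally have "192 * real l ^ 3 * e \<le> y ^ 8 * e" using e by (intro mult_right_mono) auto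
  then have "192 * real l ^ 3 * e \<le> 1" using y8 by simp
  then have "ereal (2 ^ l / 4) \<le> M_reg \<H> e" using M_reg_ge[OF k H far l(3) e(1)] by blast
  moreover have "2 powr y \<le> 2 ^ l / 4"
  proof -
    have "y \<le> real l - 2" using l y2 y14 by linarith
    then have "2 powr y \<le> 2 powr (real l - 2)" by (intro powr_mono) auto
    also have "\<dots> = 2 ^ l / 4" by (simp add: powr_diff powr_realpow)
    finally show ?thesis .
  qed
  ultimately show ?thesis unfolding y_def[symmetric] by (meson ereal_less_eq(3) order_trans)
qed

theorem theorem6p7:
  fixes k :: nat
  assumes "k \<ge> 1"
  shows "\<exists>C1 C2 :: real. C1 > 0 \<and> C2 > 0 \<and>
    (\<forall>\<H>. hereditary3 \<H> \<and> kU k \<notin> TripClass \<H> \<and> far_from_finite_VC \<H> \<longrightarrow>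
       (\<exists>\<epsilon>0>0. \<forall>\<epsilon>::real. 0 < \<epsilon> \<and> \<epsilon> < \<epsilon>0 \<longrightarrow>
          ereal (2 powr (\<epsilon> powr (- C1))) \<le> M_reg \<H> \<epsilon> \<and>
          M_reg \<H> \<epsilon> \<le> M_hom \<H> (\<epsilon>^4 / 2) \<and>
          M_hom \<H> (\<epsilon>^4 / 2) \<le> ereal (2 powr (2 powr (\<epsilon> powr (- C2))))))"
proof (rule exI[of _ "1 / 8"], rule exI[of _ 2], intro conjI allI impI)
  \<comment> \<open>Both exponents, \<open>1 / 8\<close> and \<open>2\<close>, are absolute
    constants; the dependence on \<open>k\<close> is confined to the range of \<epsilon>.\<close>
  fix \<H> assume H: "hereditary3 \<H> \<and> kU k \<notin> TripClass \<H> \<and> far_from_finite_VC \<H>"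
  obtain \<epsilon>1 where \<epsilon>1: "\<epsilon>1 > 0" "\<And>\<epsilon>. 0 < \<epsilon> \<Longrightarrow> \<epsilon> < \<epsilon>1 \<Longrightarrow>
      M_hom \<H> (\<epsilon> ^ 4 / 2) \<le> ereal (2 powr (2 powr (\<epsilon> powr (- 2))))"
    using M_hom_upper[OF assms] H by blast
  show "\<exists>\<epsilon>0>0. \<forall>\<epsilon>::real. 0 < \<epsilon> \<and> \<epsilon> < \<epsilon>0 \<longrightarrow>
          ereal (2 powr (\<epsilon> powr (- (1 / 8)))) \<le> M_reg \<H> \<epsilon> \<and>
          M_reg \<H> \<epsilon> \<le> M_hom \<H> (\<epsilon>^4 / 2) \<and>
          M_hom \<H> (\<epsilon>^4 / 2) \<le> ereal (2 powr (2 powr (\<epsilon> powr (- 2))))"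
  proof (rule exI[of _ "min \<epsilon>1 ((1 / 14) ^ 8)"], intro conjI allI impI)
    show "0 < min \<epsilon>1 ((1 / 14) ^ 8)" using \<epsilon>1 by simp
    fix \<epsilon> :: real assume \<epsilon>: "0 < \<epsilon> \<and> \<epsilon> < min \<epsilon>1 ((1 / 14) ^ 8)"
    have "(1 / 14 :: real) ^ 8 \<le> 1" by (rule power_le_one) auto
    then have \<epsilon>': "0 < \<epsilon>" "\<epsilon> < \<epsilon>1" "\<epsilon> < (1 / 14) ^ 8" "\<epsilon> \<le> 1" using \<epsilon> by linarith+
    show "ereal (2 powr (\<epsilon> powr (- (1 / 8)))) \<le> M_reg \<H> \<epsilon>"
      using M_reg_lower[OF assms] H \<epsilon>' by blast
    show "M_reg \<H> \<epsilon> \<le> M_hom \<H> (\<epsilon>^4 / 2)" using M_reg_le_M_hom H \<epsilon>' by blast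
    show "M_hom \<H> (\<epsilon>^4 / 2) \<le> ereal (2 powr (2 powr (\<epsilon> powr (- 2))))" using \<epsilon>1(2) \<epsilon>' by blast
  qed
qed auto

end
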